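(* Let $d\ge 2$, $1<p<q<\infty$, $1\le\theta\le\infty$, and let $\boldsymbol r\in\mathbb R^d$ satisfy $0<r_1=\dots=r_\nu<r_{\nu+1}\le\dots\le r_d$ for some $1\le \nu\le d$. Put $\boldsymbol\gamma=\boldsymbol r/r_1$. If $r_1>\frac1p-\frac1q$, then $$\mathscr E_{Q_n^{\boldsymbol\gamma}}(B^{\boldsymbol r}_{p,\theta})_{B_{q,1}}\asymp E_{Q_n^{\boldsymbol\gamma}}(B^{\boldsymbol r}_{p,\theta})_{B_{q,1}}\asymp 2^{-n\left(r_1-\frac1p+\frac1q\right)}\,n^{(\nu-1)\left(1-\frac1\theta\right)},\qquad n\in\mathbb N.$$
   Context: Functions are complex-valued, $2\pi$-periodic in each of $d$ variables; $\|\cdot\|_p$ is the $L_p(\mathbb T^d)$ norm with respect to $(2\pi)^{-d}d\boldsymbol x$ on $\mathbb T^d=[0,2\pi)^d$ (essential supremum for $p=\infty$). $L_p^0=\{f\in L_p(\mathbb T^d):\int_0^{2\pi}f(\boldsymbol x)\,dx_j=0\text{ a.e.},\ j=1,\dots,d\}$. $(\boldsymbol x,\boldsymbol y)=\sum_j x_jy_j$. $1/\theta:=0$ for $\theta=\infty$. Blocks. For $\boldsymbol s\in\mathbb N^d$ ($\mathbb N=\{1,2,\dots\}$), $\rho(\boldsymbol s)=\{\boldsymbol k\in\mathbb Z^d:2^{s_j-1}\le|k_j|<2^{s_j},\ j=1,\dots,d\}$ and $\delta_{\boldsymbol s}(f)=\sum_{\boldsymbol k\in\rho(\boldsymbol s)}\widehat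 f(\boldsymbol k)e^{i(\boldsymbol k,\boldsymbol x)}$, with $\widehat f(\boldsymbol k)=(2\pi)^{-d}\int_{\mathbb T^d}f(\boldsymbol t)e^{-i(\boldsymbol k,\boldsymbol t)}d\boldsymbol t$. De la Vallée-Poussin kernel: $V_l(t)=1+2\sum_{k=1}^l\cos kt+2\sum_{k=l+1}^{2l-1}\left(1-\frac{k-l}{l}\right)\cos kt$ (last sum is zero for $l=1$). Put $a_1=V_2-1$, $a_s=V_{2^s}-V_{2^{s-1}}$ for $s\ge2$, $A_{\boldsymbol s}(\boldsymbol x)=\prod_{j=1}^d a_{s_j}(x_j)$, and $A_{\boldsymbol s}(f)=f*A_{\boldsymbol s}$ (convolution with respect to $(2\pi)^{-d}d\boldsymbol x$). Class $B^{\boldsymbol r}_{p,\theta}$ ($1<p<\infty$): the set of $f\in L_p^0$ with $\|f\|_{B^{\boldsymbol r}_{p,\theta}}\le1$, where $\|f\|_{B^{\boldsymbol r}_{p,\theta}}=\left(\sum_{\boldsymbol s\in\mathbb N^d}2^{(\boldsymbol s,\boldsymbol r)\theta}\|\delta_{\boldsymbol s}(f)\|_p^\theta\right)^{1/\theta}$ for $\theta<\infty$ and $\sup_{\boldsymbol s}2^{(\boldsymbol s,\boldsymbol r)}\|\delta_{\boldsymbol s}(f)\|_p$ for $\theta=\infty$. Space $B_{q,1}$ ($1\le q\le\infty$): all $f\in L_q^0$ with $\|f\|_{B_{q,1}}:=\sum_{\boldsymbol s\in\mathbb N^d}\|A_{\boldsymbol s}(f)\|_q<\infty$. Approximation quantities.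 $Q_n^{\boldsymbol\gamma}=\bigcup_{\boldsymbol s\in\mathbb N^d,\ (\boldsymbol s,\boldsymbol\gamma)<n}\rho(\boldsymbol s)$; $T(Q_n^{\boldsymbol\gamma})$ is the set of trigonometric polynomials $\sum_{\boldsymbol k\in Q_n^{\boldsymbol\gamma}}c_{\boldsymbol k}e^{i(\boldsymbol k,\boldsymbol x)}$, $c_{\boldsymbol k}\in\mathbb C$; $S_{Q_n^{\boldsymbol\gamma}}(f)=\sum_{\boldsymbol k\in Q_n^{\boldsymbol\gamma}}\widehat f(\boldsymbol k)e^{i(\boldsymbol k,\boldsymbol x)}$. For a class $F$ in a normed space $\mathscr X$: $E_{Q_n^{\boldsymbol\gamma}}(F)_{\mathscr X}=\sup_{f\in F}\inf_{t\in T(Q_n^{\boldsymbol\gamma})}\|f-t\|_{\mathscr X}$ and $\mathscr E_{Q_n^{\boldsymbol\gamma}}(F)_{\mathscr X}=\sup_{f\in F}\|f-S_{Q_n^{\boldsymbol\gamma}}(f)\|_{\mathscr X}$. $a(n)\asymp b(n)$ means that there are constants $C_1,C_2>0$ independent of $n$ with $C_1a(n)\le b(n)\le C_2a(n)$ (the constants may depend on $d$ and all other fixed parameters). *)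

theory Defs
  imports "HOL-Analysis.Analysis"
begin

text \<open>
  Vectors with \<open>d\<close> coordinates are functions on \<open>nat\<close> of which only the values at \<open>1, ..., d\<close>
  matter. Where they form a set (points, frequencies, block indices) that set is a \<open>PiE {1..d}\<close>,
  so that each vector is represented by exactly one function.
\<close>

definition dot :: "nat \<Rightarrow> (nat \<Rightarrow> real) \<Rightarrow> (nat \<Rightarrow> real) \<Rightarrow> real" where
  "dot d x y = (\<Sum>j\<in>{1..d}. x j * y j)"

definition block_indices :: "nat \<Rightarrow> (nat \<Rightarrow> nat) set" where
  "block_indices d = {1..d} \<rightarrow>\<^sub>E {1..}"

text \<open>
  Each factor is Lebesgue measure restricted to \<open>[0, 2\<pi>)\<close> and divided by \<open>2\<pi>\<close>, so all norms,
  Fourier coefficients and convolutions below carry the normalization \<open>(2\<pi>)\<^sup>-\<^sup>d dx\<close>.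
\<close>

definition torus :: "nat \<Rightarrow> (nat \<Rightarrow> real) measure" where
  "torus d = (\<Pi>\<^sub>M j\<in>{1..d}. uniform_measure lborel {0..<2 * pi})"

definition periodic_fun :: "nat \<Rightarrow> ((nat \<Rightarrow> real) \<Rightarrow> complex) \<Rightarrow> bool" where
  "periodic_fun d f \<longleftrightarrow>
     (\<forall>x \<in> {1..d} \<rightarrow>\<^sub>E UNIV. \<forall>j\<in>{1..d}. f (x(j := x j + 2 * pi)) = f x)"

text \<open>
  Power with exponent \<open>a > 0\<close> on \<open>[0, \<infinity>]\<close>. Norms take values in \<^typ>\<open>ennreal\<close>: the value
  \<open>\<infinity>\<close> means that the function does not belong to the space.
\<close>

definition epowr :: "ennreal \<Rightarrow> real \<Rightarrow> ennreal" where
  "epowr x a = (if x = \<infinity> then \<infinity> else ennreal (enn2real x powr a))"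

definition Lp_norm :: "nat \<Rightarrow> real \<Rightarrow> ((nat \<Rightarrow> real) \<Rightarrow> complex) \<Rightarrow> ennreal" where
  "Lp_norm d p f = epowr (\<integral>\<^sup>+ x. ennreal (cmod (f x) powr p) \<partial>torus d) (1 / p)"

definition Lp :: "nat \<Rightarrow> real \<Rightarrow> ((nat \<Rightarrow> real) \<Rightarrow> complex) set" where
  "Lp d p = {f. periodic_fun d f \<and> f \<in> borel_measurable (torus d) \<and> Lp_norm d p f < \<infinity>}"

definition Lp0 :: "nat \<Rightarrow> real \<Rightarrow> ((nat \<Rightarrow> real) \<Rightarrow> complex) set" where
  "Lp0 d p = {f \<in> Lp d p. \<forall>j\<in>{1..d}.
     AE x in torus d. (LINT u:{0..<2 * pi}|lborel. f (x(j := u))) = 0}"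

definition character :: "nat \<Rightarrow> (nat \<Rightarrow> int) \<Rightarrow> (nat \<Rightarrow> real) \<Rightarrow> complex" where
  "character d k x = exp (\<i> * complex_of_real (dot d (\<lambda>j. real_of_int (k j)) x))"

definition fourier_coeff :: "nat \<Rightarrow> ((nat \<Rightarrow> real) \<Rightarrow> complex) \<Rightarrow> (nat \<Rightarrow> int) \<Rightarrow> complex" where
  "fourier_coeff d f k =
     (LINT t|torus d. f t * exp (- \<i> * complex_of_real (dot d (\<lambda>j. real_of_int (k j)) t)))"

definition convolve ::
  "nat \<Rightarrow> ((nat \<Rightarrow> real) \<Rightarrow> complex) \<Rightarrow> ((nat \<Rightarrow> real) \<Rightarrow> complex) \<Rightarrow> (nat \<Rightarrow> real) \<Rightarrow> complex" where
  "convolve d f g x = (LINT t|torus d. f t * g (\<lambda>j\<in>{1..d}. x j - t j))"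

definition rho :: "nat \<Rightarrow> (nat \<Rightarrow> nat) \<Rightarrow> (nat \<Rightarrow> int) set" where
  "rho d s = {k \<in> {1..d} \<rightarrow>\<^sub>E UNIV. \<forall>j\<in>{1..d}. 2 ^ (s j - 1) \<le> \<bar>k j\<bar> \<and> \<bar>k j\<bar> < 2 ^ s j}"

text \<open>The partial sum of the Fourier series of \<open>f\<close> over a finite set \<open>Q\<close> of frequencies.\<close>

definition fourier_sum ::
  "nat \<Rightarrow> (nat \<Rightarrow> int) set \<Rightarrow> ((nat \<Rightarrow> real) \<Rightarrow> complex) \<Rightarrow> (nat \<Rightarrow> real) \<Rightarrow> complex" where
  "fourier_sum d Q f x = (\<Sum>k\<in>Q. fourier_coeff d f k * character d k x)"

definition delta ::
  "nat \<Rightarrow> (nat \<Rightarrow> nat) \<Rightarrow> ((nat \<Rightarrow> real) \<Rightarrow> complex) \<Rightarrow> (nat \<Rightarrow> real) \<Rightarrow> complex" where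
  "delta d s f = fourier_sum d (rho d s) f"

definition VP_kernel :: "nat \<Rightarrow> real \<Rightarrow> real" where
  "VP_kernel l t = 1 + 2 * (\<Sum>k=1..l. cos (real k * t))
     + 2 * (\<Sum>k=l+1..2*l-1. (1 - (real k - real l) / real l) * cos (real k * t))"

definition a_kernel :: "nat \<Rightarrow> real \<Rightarrow> real" where
  "a_kernel s t =
     (if s = 1 then VP_kernel 2 t - 1 else VP_kernel (2 ^ s) t - VP_kernel (2 ^ (s - 1)) t)"

definition A_kernel :: "nat \<Rightarrow> (nat \<Rightarrow> nat) \<Rightarrow> (nat \<Rightarrow> real) \<Rightarrow> complex" where
  "A_kernel d s x = complex_of_real (\<Prod>j\<in>{1..d}. a_kernel (s j) (x j))"

definition A_op ::
  "nat \<Rightarrow> (nat \<Rightarrow> nat) \<Rightarrow> ((nat \<Rightarrow> real) \<Rightarrow> complex) \<Rightarrow> (nat \<Rightarrow> real) \<Rightarrow> complex" where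
  "A_op d s f = convolve d f (A_kernel d s)"

definition besov_norm ::
  "nat \<Rightarrow> (nat \<Rightarrow> real) \<Rightarrow> real \<Rightarrow> ennreal \<Rightarrow> ((nat \<Rightarrow> real) \<Rightarrow> complex) \<Rightarrow> ennreal" where
  "besov_norm d r p \<theta> f =
     (if \<theta> = \<infinity>
      then (SUP s\<in>block_indices d.
              ennreal (2 powr dot d (\<lambda>j. real (s j)) r) * Lp_norm d p (delta d s f))
      else epowr
             (\<Sum>\<^sub>\<infinity>s\<in>block_indices d.
                ennreal (2 powr (dot d (\<lambda>j. real (s j)) r * enn2real \<theta>))
                * epowr (Lp_norm d p (delta d s f)) (enn2real \<theta>))
             (1 / enn2real \<theta>))"

definition besov_class ::
  "nat \<Rightarrow> (nat \<Rightarrow> real) \<Rightarrow> real \<Rightarrow> ennreal \<Rightarrow> ((nat \<Rightarrow> real) \<Rightarrow> complex) set" where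
  "besov_class d r p \<theta> = {f \<in> Lp0 d p. besov_norm d r p \<theta> f \<le> 1}"

text \<open>
  The space \<open>B_{q,1}\<close> is the set of all \<open>f\<close> with \<open>Bq1_norm d q f < \<infinity>\<close>; the value is \<open>\<infinity>\<close> also
  when \<open>f\<close> is not in \<open>L\<^sub>q\<^sup>0\<close>.
\<close>

definition Bq1_norm :: "nat \<Rightarrow> real \<Rightarrow> ((nat \<Rightarrow> real) \<Rightarrow> complex) \<Rightarrow> ennreal" where
  "Bq1_norm d q f =
     (if f \<in> Lp0 d q then (\<Sum>\<^sub>\<infinity>s\<in>block_indices d. Lp_norm d q (A_op d s f)) else \<infinity>)"

definition hyp_cross :: "nat \<Rightarrow> (nat \<Rightarrow> real) \<Rightarrow> nat \<Rightarrow> (nat \<Rightarrow> int) set" where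
  "hyp_cross d \<gamma> n =
     (\<Union>s\<in>{s \<in> block_indices d. dot d (\<lambda>j. real (s j)) \<gamma> < real n}. rho d s)"

definition trig_polys :: "nat \<Rightarrow> (nat \<Rightarrow> int) set \<Rightarrow> ((nat \<Rightarrow> real) \<Rightarrow> complex) set" where
  "trig_polys d Q = {t. \<exists>c :: (nat \<Rightarrow> int) \<Rightarrow> complex. t = (\<lambda>x. \<Sum>k\<in>Q. c k * character d k x)}"

text \<open>
  In both quantities \<open>N\<close> is the norm of the space in which the error is measured, extended by
  \<open>\<infinity>\<close> outside that space.
\<close>

definition best_approx ::
  "nat \<Rightarrow> (nat \<Rightarrow> int) set \<Rightarrow> ((nat \<Rightarrow> real) \<Rightarrow> complex) set
     \<Rightarrow> (((nat \<Rightarrow> real) \<Rightarrow> complex) \<Rightarrow> ennreal) \<Rightarrow> ennreal" where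
  "best_approx d Q F N = (SUP f\<in>F. INF t\<in>trig_polys d Q. N (\<lambda>x. f x - t x))"

definition fourier_approx ::
  "nat \<Rightarrow> (nat \<Rightarrow> int) set \<Rightarrow> ((nat \<Rightarrow> real) \<Rightarrow> complex) set
     \<Rightarrow> (((nat \<Rightarrow> real) \<Rightarrow> complex) \<Rightarrow> ennreal) \<Rightarrow> ennreal" where
  "fourier_approx d Q F N = (SUP f\<in>F. N (\<lambda>x. f x - fourier_sum d Q f x))"

text \<open>Two-sided comparison for all \<open>n \<ge> 1\<close>, not only for large \<open>n\<close>.\<close>

definition same_order :: "(nat \<Rightarrow> ennreal) \<Rightarrow> (nat \<Rightarrow> ennreal) \<Rightarrow> bool" where
  "same_order a b \<longleftrightarrow>
     (\<exists>C1 C2 :: real. C1 > 0 \<and> C2 > 0 \<and>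
        (\<forall>n\<ge>1. ennreal C1 * a n \<le> b n \<and> b n \<le> ennreal C2 * a n))"

end

theory Submission
  imports Defs "HOL-Probability.Probability" "HOL-Real_Asymp.Real_Asymp"
begin

text \<open>
  The kernel of \<open>A\<^sub>s\<close> has its frequencies in the blocks \<open>\<rho>(s + \<epsilon>)\<close>, \<open>\<epsilon> \<in> {0, 1}\<^sup>d\<close>, and its \<open>L\<^sub>1\<close>-norm is
  bounded independently of \<open>s\<close>, because \<open>V\<^sub>l = 2 F\<^sub>2\<^sub>l - F\<^sub>l\<close> with Fejer kernels \<open>F\<^sub>l\<close>. Hence the
  \<open>B\<^sub>q\<^sub>,\<^sub>1\<close>-norm of \<open>f - S\<^sub>Q(f)\<close> is at most a constant times the sum of \<open>\<parallel>\<delta>\<^sub>s(f)\<parallel>\<^sub>q\<close> over \<open>(s, \<gamma>) \<ge> n\<close>.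
  Nikolskii's inequality replaces \<open>\<parallel>\<delta>\<^sub>s(f)\<parallel>\<^sub>q\<close> by \<open>2 powr (|s| (1/p - 1/q)) \<parallel>\<delta>\<^sub>s(f)\<parallel>\<^sub>p\<close>, and Hoelder's
  inequality with exponent \<open>\<theta>\<close> reduces the upper bound to a sum over the indices outside the
  hyperbolic cross. That the error belongs to \<open>L\<^sub>q\<close> at all follows from the uniqueness of Fourier
  coefficients: \<open>f\<close> is the sum of its blocks, which converges in \<open>L\<^sub>q\<close>.

  For the lower bound, \<open>A\<^sub>s\<close> annihilates \<open>T(Q)\<close> whenever \<open>(s, \<gamma>) \<ge> n\<close>, so the best approximation of
  \<open>f\<close> is at least the sum of \<open>\<parallel>A\<^sub>s(f)\<parallel>\<^sub>q\<close> over these \<open>s\<close>. The test function is a normalized sum of products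
  of modulated Fejer kernels, one for each of about \<open>n ^ (\<nu> - 1)\<close> blocks near the boundary of the
  cross; \<open>\<parallel>A\<^sub>s(f)\<parallel>\<^sub>q\<close> is bounded from below through the value of \<open>A\<^sub>s(f)\<close> at the origin.
\<close>

section \<open>Characters and Fourier coefficients on the torus\<close>

text \<open>The kernel estimates rest on positivity: reversing the minus sign in the Fejer
  representation of V_l gives a nonnegative majorant. Jensen's inequality against it yields the L_q
  bound of \<open>A_op\<close> and also, because V_l reproduces polynomials of degree at most l, the
  sup bound from which Nikolskii's inequality is interpolated.

  The power of n counts blocks. The weight 2 powr (s, r) and the Nikolskii loss 2 powr (\<beta>
  |s|), \<beta> = 1/p - 1/q, combine to 2 powr (\<alpha> (s, \<gamma>)), \<alpha> = r_1 - \<beta>,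
  times extra growth in the s_j with j > \<nu>. So only s_1, ..., s_\<nu> are free, and about n ^
  (\<nu> - 1) blocks matter on a level near n. Spreading an element of the unit ball over M such
  blocks leaves M powr (- 1/\<theta>) for each and a total of M powr (1 - 1/\<theta>).

  The test blocks are extremal for Nikolskii's inequality: a Fejer kernel of order N has value N at
  0 and L_p norm at most N powr (1 - 1/p), and the sup bound read backwards turns that value into a
  lower bound of order N powr (1 - 1/q) for the L_q norm.\<close>

definition circ :: "real measure" where
  "circ = uniform_measure lborel {0..<2 * pi}"

lemma emeasure_arc: "emeasure lborel {0..<2 * pi} = ennreal (2 * pi)"
  by simp

lemma circ_density: "circ = density lborel (\<lambda>x. ennreal (indicator {0..<2 * pi} x / (2 * pi)))"
  unfolding circ_def uniform_measure_def emeasure_arc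
  by (intro density_cong) (auto split: split_indicator simp: divide_ennreal simp flip: ennreal_1)

lemma sets_circ [simp, measurable_cong]: "sets circ = sets borel"
  by (simp add: circ_def)

lemma space_circ [simp]: "space circ = UNIV"
  by (simp add: circ_def)

interpretation circ: prob_space circ
  unfolding circ_def by (intro prob_space_uniform_measure) (auto simp: emeasure_arc)

lemma integral_circ:
  fixes f :: "real \<Rightarrow> complex"
  assumes [measurable]: "f \<in> borel_measurable borel"
  shows "(LINT u|circ. f u) = (LINT u:{0..<2 * pi}|lborel. f u) /\<^sub>R (2 * pi)"
proof -
  have "(LINT u|circ. f u) = (LINT u|lborel. (indicator {0..<2 * pi} u / (2 * pi)) *\<^sub>R f u)"
    unfolding circ_density by (subst integral_density) auto
  also have "\<dots> = (LINT u|lborel. inverse (2 * pi) *\<^sub>R (indicator {0..<2 * pi} u *\<^sub>R f u))"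
    by (intro Bochner_Integration.integral_cong) (auto simp: field_simps)
  also have "\<dots> = (LINT u:{0..<2 * pi}|lborel. f u) /\<^sub>R (2 * pi)"
    unfolding set_lebesgue_integral_def by (rule integral_scaleR_right)
  finally show ?thesis .
qed

lemma AE_circ: "AE u in circ. u \<in> {0..<2 * pi}"
  unfolding circ_def by (intro AE_uniform_measureI) auto

lemma integrable_circ_bounded:
  fixes f :: "real \<Rightarrow> 'b :: {banach, second_countable_topology}"
  assumes "f \<in> borel_measurable borel" "\<And>x. norm (f x) \<le> B"
  shows "integrable circ f"
  using assms by (intro circ.integrable_const_bound[where B = B]) auto

lemma measurable_cis [measurable]: "cis \<in> borel_measurable borel"
  by (intro borel_measurable_continuous_onI continuous_on_cis continuous_on_id)

lemma integral_cis:
  fixes k :: int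
  shows "(LINT u|circ. cis (of_int k * u)) = (if k = 0 then 1 else 0)"
proof (cases "k = 0")
  case True
  then show ?thesis by (simp add: circ.prob_space[simplified])
next
  case False
  \<comment> \<open>The fundamental theorem of calculus is applied on a closed interval; the added
    endpoint is a null set.\<close>
  have "(LINT u:{0..<2 * pi}|lborel. cis (of_int k * u)) = (LINT u:{0..2 * pi}|lborel. cis (of_int k * u))"
    unfolding set_lebesgue_integral_def
  proof (rule integral_cong_AE)
    have "AE x in lborel. x \<noteq> 2 * pi"
      by (rule AE_lborel_singleton)
    then show "AE u in lborel. indicator {0..<2 * pi} u *\<^sub>R cis (of_int k * u) =
        indicator {0..2 * pi} u *\<^sub>R cis (of_int k * u)"
      by eventually_elim (auto split: split_indicator)
  qed auto
  also have "\<dots> = cis (of_int k * (2 * pi)) / (\<i> * of_int k) - cis (of_int k * 0) / (\<i> * of_int k)"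
    unfolding set_lebesgue_integral_def
  proof (rule integral_FTC_Icc)
    fix x :: real
    show "((\<lambda>a. cis (of_int k * a) / (\<i> * of_int k)) has_vector_derivative cis (of_int k * x))
      (at x within {0..2 * pi})"
      unfolding cis_conv_exp of_real_mult of_real_of_int_eq
      using False
      by (auto intro!: derivative_eq_intros has_vector_derivative_real_field simp: field_simps)
  qed (auto intro!: continuous_intros)
  also have "cis (of_int k * (2 * pi)) = 1"
    using cis_multiple_2pi[of "of_int k"] by (simp add: mult_ac)
  finally show ?thesis
    using False by (simp add: integral_circ)
qed

section \<open>The torus as a product of circles, and its characters\<close>

lemma torus_eq: "torus d = PiM {1..d} (\<lambda>_. circ)"
  by (simp add: torus_def circ_def)

interpretation circs: product_sigma_finite "\<lambda>_::nat. circ" ..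

interpretation torus: prob_space "torus d" for d
  unfolding torus_eq by (intro prob_space_PiM circ.prob_space_axioms)

lemma space_torus: "space (torus d) = {1..d} \<rightarrow>\<^sub>E UNIV"
  by (simp add: torus_eq space_PiM)

lemma sets_torus [measurable_cong]: "sets (torus d) = sets (PiM {1..d} (\<lambda>_. borel))"
  unfolding torus_eq by (intro sets_PiM_cong) auto

lemma measurable_torus_component [measurable]:
  "j \<in> {1..d} \<Longrightarrow> (\<lambda>x. x j) \<in> borel_measurable (torus d)"
  unfolding torus_eq by (subst measurable_cong_sets[OF refl, of borel circ]) auto

text \<open>With the product form, Fubini reduces integrals of characters to
  \<open>integral_cis\<close> in each variable.\<close>

lemma character_prod: "character d k x = (\<Prod>j\<in>{1..d}. cis (of_int (k j) * x j))"
proof -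
  have "character d k x = cis (\<Sum>j\<in>{1..d}. of_int (k j) * x j)"
    by (simp add: character_def dot_def cis_conv_exp)
  also have "\<dots> = (\<Prod>j\<in>{1..d}. cis (of_int (k j) * x j))"
    unfolding cis_conv_exp of_real_sum sum_distrib_left by (rule exp_sum) auto
  finally show ?thesis .
qed

lemma norm_character [simp]: "cmod (character d k x) = 1"
  by (simp add: character_prod flip: prod_norm)

lemma measurable_character [measurable]: "character d k \<in> borel_measurable (torus d)"
proof -
  have "(\<lambda>x. \<Prod>j\<in>{1..d}. cis (of_int (k j) * x j)) \<in> borel_measurable (torus d)"
    by (intro borel_measurable_prod) measurable
  then show ?thesis
    by (simp add: character_prod[abs_def])
qed

lemma character_uminus: "exp (- \<i> * complex_of_real (dot d (\<lambda>j. real_of_int (k j)) t)) = character d (\<lambda>j. - k j) t"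
  by (simp add: character_def dot_def sum_negf)

lemma character_mult: "character d k x * character d l x = character d (\<lambda>j. k j + l j) x"
  by (simp add: character_prod prod.distrib[symmetric] cis_mult algebra_simps)

lemma fourier_coeff_eq: "fourier_coeff d f k = (LINT t|torus d. f t * character d (\<lambda>j. - k j) t)"
  by (simp only: fourier_coeff_def character_uminus)

lemma integral_character:
  "(LINT x|torus d. character d k x) = (if \<forall>j\<in>{1..d}. k j = 0 then 1 else 0)"
proof -
  have "(LINT x|torus d. character d k x) = (\<Prod>j\<in>{1..d}. (LINT u|circ. cis (of_int (k j) * u)))"
    unfolding character_prod torus_eq
    by (intro circs.product_integral_prod integrable_circ_bounded[where B = 1]) auto
  also have "\<dots> = (if \<forall>j\<in>{1..d}. k j = 0 then 1 else 0)"
    by (auto simp: integral_cis)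
  finally show ?thesis .
qed

text \<open>The integral only sees the coordinates in \<open>{1..d}\<close>; extensionality of
  \<open>k\<close> and \<open>l\<close> turns agreement there into \<open>k = l\<close>.\<close>

lemma fourier_coeff_character:
  assumes "k \<in> {1..d} \<rightarrow>\<^sub>E UNIV" "l \<in> {1..d} \<rightarrow>\<^sub>E UNIV"
  shows "fourier_coeff d (character d l) k = (if k = l then 1 else 0)"
proof -
  have "(\<forall>j\<in>{1..d}. l j + - k j = 0) \<longleftrightarrow> k = l"
    using assms by (auto intro: PiE_ext)
  then show ?thesis
    by (simp add: fourier_coeff_eq character_mult integral_character)
qed

lemma integrable_torus_bounded:
  assumes "f \<in> borel_measurable (torus d)" "\<And>x. cmod (f x) \<le> B"
  shows "integrable (torus d) f"
  using assms by (intro torus.integrable_const_bound[where B = B]) auto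

lemma integrable_mult_character:
  assumes "integrable (torus d) f"
  shows "integrable (torus d) (\<lambda>x. f x * character d k x)"
proof (rule Bochner_Integration.integrable_bound[OF assms])
  show "(\<lambda>x. f x * character d k x) \<in> borel_measurable (torus d)"
    using assms by (auto intro: borel_measurable_times)
qed (auto simp: norm_mult)

lemma integrable_character: "integrable (torus d) (character d k)"
  by (rule integrable_torus_bounded[where B = 1]) auto

lemma fourier_coeff_sum:
  assumes "\<And>i. i \<in> I \<Longrightarrow> integrable (torus d) (f i)"
  shows "fourier_coeff d (\<lambda>x. \<Sum>i\<in>I. c i * f i x) k = (\<Sum>i\<in>I. c i * fourier_coeff d (f i) k)"
  unfolding fourier_coeff_eq sum_distrib_right mult.assoc
  by (subst Bochner_Integration.integral_sum)
     (auto intro!: integrable_mult_character assms integrable_mult_right)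

lemma fourier_coeff_diff:
  assumes "integrable (torus d) f" "integrable (torus d) g"
  shows "fourier_coeff d (\<lambda>x. f x - g x) k = fourier_coeff d f k - fourier_coeff d g k"
  unfolding fourier_coeff_eq left_diff_distrib
  by (subst Bochner_Integration.integral_diff) (auto intro!: integrable_mult_character assms)

section \<open>Uniqueness of Fourier coefficients\<close>

text \<open>Off the ray of nonnegative reals \<open>Arg2pi\<close> is continuous, and on the ray,
  including 0, it is 0. It serves to recover an angle from its image under
  \<open>cis\<close>.\<close>

lemma borel_measurable_Arg2pi [measurable]: "Arg2pi \<in> borel_measurable borel"
proof -
  have "closed {z. Im z = 0 \<and> 0 \<le> Re z}"
    by (intro closed_Collect_conj closed_Collect_eq closed_Collect_le continuous_intros)
  then have "- {z. Im z = 0 \<and> 0 \<le> Re z} \<in> sets borel"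
    by (simp add: borel_open open_Compl)
  moreover have "continuous_on (- {z. Im z = 0 \<and> 0 \<le> Re z}) Arg2pi"
    by (intro continuous_at_imp_continuous_on ballI continuous_at_Arg2pi)
       (auto simp: complex_nonneg_Reals_iff)
  ultimately have "(\<lambda>z. indicator (- {z. Im z = 0 \<and> 0 \<le> Re z}) z *\<^sub>R Arg2pi z) \<in> borel_measurable borel"
    by (rule borel_measurable_continuous_on_indicator)
  also have "(\<lambda>z. indicator (- {z. Im z = 0 \<and> 0 \<le> Re z}) z *\<^sub>R Arg2pi z) = Arg2pi"
    by (auto simp: fun_eq_iff indicator_def Arg2pi_eq_0 complex_is_Real_iff)
  finally show ?thesis .
qed

text \<open>Dynkin's argument for a complex density: the sets over which \<open>g\<close> integrates
  to 0 contain the generator, are closed under complements because the total integral is 0, and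
  under disjoint unions by dominated convergence with majorant |g|.\<close>

lemma integral_mult_indicator_eq_0:
  fixes g :: "'a \<Rightarrow> complex"
  assumes g: "integrable M g" and Y [measurable]: "Y \<in> measurable M N"
    and G: "sets N = sigma_sets (space N) G" "Int_stable G" "G \<subseteq> Pow (space N)"
    and basic: "\<And>A. A \<in> G \<Longrightarrow> (LINT x|M. g x * indicator A (Y x)) = 0"
    and total: "(LINT x|M. g x) = 0"
    and A: "A \<in> sets N"
  shows "(LINT x|M. g x * indicator A (Y x)) = 0"
proof -
  have [measurable]: "g \<in> borel_measurable M"
    using g by auto
  have int: "integrable M (\<lambda>x. g x * indicator B (Y x))" if [measurable]: "B \<in> sets N" for B
    by (rule Bochner_Integration.integrable_bound[OF g]) (auto simp: norm_mult indicator_def)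
  have "A \<in> sigma_sets (space N) G"
    using A G(1) by simp
  with G(2,3) show ?thesis
  proof (induction rule: sigma_sets_induct_disjoint)
    case (basic A)
    then show ?case by (rule assms)
  next
    case empty
    show ?case by simp
  next
    case (compl A)
    then have [measurable]: "A \<in> sets N"
      using G(1) by simp
    have "(LINT x|M. g x * indicator (space N - A) (Y x)) = (LINT x|M. g x - g x * indicator A (Y x))"
      by (intro Bochner_Integration.integral_cong)
         (use measurable_space[OF Y] in \<open>auto simp: indicator_def\<close>)
    also have "\<dots> = 0"
      using compl by (simp add: Bochner_Integration.integral_diff[OF g int] total)
    finally show ?case .
  next
    case (union A)
    then have [measurable]: "A i \<in> sets N" for i
      using G(1) by auto
    have "(LINT x|M. g x * indicator (\<Union>i<n. A i) (Y x)) = 0" for n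
    proof -
      have "indicator (\<Union>i<n. A i) y = (\<Sum>i<n. indicator (A i) y :: complex)" for y
        by (intro indicator_UN_disjoint) (use union(1) in \<open>auto simp: disjoint_family_on_def\<close>)
      then have "(LINT x|M. g x * indicator (\<Union>i<n. A i) (Y x)) = (LINT x|M. (\<Sum>i<n. g x * indicator (A i) (Y x)))"
        by (simp only: sum_distrib_left)
      also have "\<dots> = (\<Sum>i<n. LINT x|M. g x * indicator (A i) (Y x))"
        by (rule Bochner_Integration.integral_sum) (rule int, measurable)
      finally show ?thesis
        using union by simp
    qed
    moreover have "(\<lambda>n. LINT x|M. g x * indicator (\<Union>i<n. A i) (Y x)) \<longlonglongrightarrow>
        (LINT x|M. g x * indicator (\<Union>i. A i) (Y x))"
    proof (rule integral_dominated_convergence[where w = "\<lambda>x. cmod (g x)"])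
      show "AE x in M. (\<lambda>n. g x * indicator (\<Union>i<n. A i) (Y x)) \<longlonglongrightarrow> g x * indicator (\<Union>i. A i) (Y x)"
        by (intro AE_I2 tendsto_mult tendsto_const LIMSEQ_indicator_UN)
    qed (use g in \<open>auto simp: norm_mult indicator_def\<close>)
    ultimately show ?case
      by (simp add: LIMSEQ_const_iff)
  qed
qed

text \<open>The complex measure with density \<open>g\<close>, carried to the unit circle by
  \<open>cis (X x)\<close>, has only zero Fourier coefficients. With general \<open>M\<close> and
  \<open>X\<close>, a single coordinate of the torus can play the role of \<open>X\<close> while
  \<open>g\<close> carries the factors of the other coordinates.\<close>

definition trig_null :: "'a measure \<Rightarrow> ('a \<Rightarrow> real) \<Rightarrow> ('a \<Rightarrow> complex) \<Rightarrow> bool" where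
  "trig_null M X g \<longleftrightarrow> integrable M g \<and> (\<forall>k::int. (LINT x|M. g x * cis (of_int k * X x)) = 0)"

lemma integrable_mult_cis:
  assumes "integrable M g" and [measurable]: "X \<in> borel_measurable M"
  shows "integrable M (\<lambda>x. g x * cis (X x))"
  using assms by (intro Bochner_Integration.integrable_bound[OF assms(1)]) (auto simp: norm_mult)

text \<open>On the circle a real linear functional is a combination of \<open>cis t\<close> and
  \<open>cis (- t)\<close>, so multiplication by it only shifts the index \<open>k\<close>. The
  induction generalizes \<open>g\<close> so that a product is handled one factor after the
  other.\<close>

lemma trig_null_mult_polynomial:
  assumes "real_polynomial_function p" and X [measurable]: "X \<in> borel_measurable M"
  shows "trig_null M X g \<Longrightarrow> trig_null M X (\<lambda>x. g x * of_real (p (cis (X x))))"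
  using assms(1)
proof (induction arbitrary: g rule: real_polynomial_function.induct)
  case (linear f)
  interpret bounded_linear f by fact
  have g: "integrable M g" and null: "(LINT x|M. g x * cis (of_int k * X x)) = 0" for k :: int
    using linear.prems by (auto simp: trig_null_def)
  \<comment> \<open>Euler's formulas applied to
    \<open>f (cis t) = cos t * f 1 + sin t * f \<i>\<close>.\<close>
  define a b where "a = (of_real (f 1) - \<i> * of_real (f \<i>)) / 2"
    and "b = (of_real (f 1) + \<i> * of_real (f \<i>)) / 2"
  have f: "of_real (f (cis t)) = a * cis t + b * cis (- t)" for t
  proof -
    have "cis t = cos t *\<^sub>R 1 + sin t *\<^sub>R \<i>"
      by (simp add: complex_eq_iff)
    then have "f (cis t) = cos t * f 1 + sin t * f \<i>"
      by (simp add: add scale)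
    then show ?thesis
      by (simp add: complex_eq_iff a_def b_def field_simps)
  qed
  have i: "integrable M (\<lambda>x. g x * cis (of_int k * X x))" for k :: int
    by (intro integrable_mult_cis g) auto
  have eq: "g x * of_real (f (cis (X x))) * cis (of_int k * X x) =
      a * (g x * cis (of_int (k + 1) * X x)) + b * (g x * cis (of_int (k - 1) * X x))" for x and k :: int
  proof -
    have "cis (of_int (k + 1) * X x) = cis (of_int k * X x) * cis (X x)"
      and "cis (of_int (k - 1) * X x) = cis (of_int k * X x) * cis (- X x)"
      by (simp_all add: cis_mult algebra_simps)
    then show ?thesis
      by (simp add: f algebra_simps)
  qed
  have "integrable M (\<lambda>x. g x * of_real (f (cis (X x))))"
    using eq[of _ 0] i[of 1] i[of "-1"] by simp
  moreover have "(LINT x|M. g x * of_real (f (cis (X x))) * cis (of_int k * X x)) = 0" for k :: int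
    unfolding eq
    by (subst Bochner_Integration.integral_add) (auto intro!: i integrable_mult_right simp del: of_int_add of_int_diff simp: null)
  ultimately show ?case
    by (simp add: trig_null_def)
next
  case (const c)
  then show ?case
    by (auto simp: trig_null_def mult.assoc mult.left_commute[of _ "of_real c"] mult.commute[of _ "of_real c"])
next
  case (add p q)
  then have "trig_null M X (\<lambda>x. g x * of_real (p (cis (X x))))" "trig_null M X (\<lambda>x. g x * of_real (q (cis (X x))))"
    by auto
  then show ?case
    by (auto simp: trig_null_def ring_distribs Bochner_Integration.integral_add integrable_mult_cis)
next
  case (mult p q)
  then show ?case
    using mult.IH(2)[OF mult.IH(1)[OF mult.prems]] by (simp add: mult_ac)
qed

text \<open>Stone-Weierstrass on the unit circle: if \<open>p\<close> is within e of
  \<open>h\<close> there, the integral for \<open>h\<close> differs from the vanishing one for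
  \<open>p\<close> by at most e times the L_1 norm of \<open>g\<close>.\<close>

lemma trig_null_continuous:
  fixes h :: "complex \<Rightarrow> real"
  assumes null: "trig_null M X g" and X [measurable]: "X \<in> borel_measurable M"
    and h: "continuous_on UNIV h" and B: "\<And>z. \<bar>h z\<bar> \<le> B"
  shows "(LINT x|M. g x * of_real (h (cis (X x)))) = 0"
proof -
  have g: "integrable M g" using null by (simp add: trig_null_def)
  then have [measurable]: "g \<in> borel_measurable M" by auto
  have [measurable]: "h \<in> borel_measurable borel"
    using h by (rule borel_measurable_continuous_onI)
  have ih: "integrable M (\<lambda>x. g x * of_real (h (cis (X x))))"
    by (rule Bochner_Integration.integrable_bound[of _ "\<lambda>x. B * g x"])
       (use g mult_right_mono[OF order_trans[OF B abs_ge_self] norm_ge_zero] in \<open>auto simp: norm_mult mult.commute\<close>)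
  have "cmod (LINT x|M. g x * of_real (h (cis (X x)))) \<le> e * (LINT x|M. cmod (g x))" if "e > 0" for e
  proof -
    obtain p where p: "real_polynomial_function p" "\<And>z. z \<in> sphere 0 1 \<Longrightarrow> \<bar>h z - p z\<bar> < e"
      using Stone_Weierstrass_real_polynomial_function[of "sphere 0 1" h e] \<open>e > 0\<close> h
        continuous_on_subset compact_sphere by (metis top_greatest)
    have "trig_null M X (\<lambda>x. g x * of_real (p (cis (X x))))"
      by (rule trig_null_mult_polynomial[OF p(1) X null])
    then have ip: "integrable M (\<lambda>x. g x * of_real (p (cis (X x))))"
      and "(LINT x|M. g x * of_real (p (cis (X x))) * cis (of_int 0 * X x)) = 0"
      unfolding trig_null_def by blast+
    then have "(LINT x|M. g x * of_real (h (cis (X x)))) =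
        (LINT x|M. g x * of_real (h (cis (X x))) - g x * of_real (p (cis (X x))))"
      by (simp add: Bochner_Integration.integral_diff ih ip)
    also have "cmod \<dots> \<le> (LINT x|M. e * cmod (g x))"
    proof (rule order_trans[OF integral_norm_bound integral_mono])
      fix x
      have "cmod (g x * of_real (h (cis (X x))) - g x * of_real (p (cis (X x)))) =
          cmod (g x) * \<bar>h (cis (X x)) - p (cis (X x))\<bar>"
        by (simp add: norm_mult flip: right_diff_distrib of_real_diff)
      also have "\<dots> \<le> cmod (g x) * e"
        using p(2)[of "cis (X x)"] by (intro mult_left_mono) auto
      finally show "cmod (g x * of_real (h (cis (X x))) - g x * of_real (p (cis (X x)))) \<le> e * cmod (g x)"
        by (simp add: mult_ac)
    qed (use g ih ip in auto)
    finally show ?thesis by simp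
  qed
  note le = this
  have "cmod (LINT x|M. g x * of_real (h (cis (X x)))) \<le> 0 + e" if "e > 0" for e
  proof -
    define I where "I = (LINT x|M. cmod (g x))"
    have "I \<ge> 0" by (simp add: I_def)
    \<comment> \<open>Dividing by \<open>I + 1\<close> rather than \<open>I\<close> also covers a
      null function \<open>g\<close>.\<close>
    have "cmod (LINT x|M. g x * of_real (h (cis (X x)))) \<le> e / (I + 1) * I"
      unfolding I_def by (rule le) (use that \<open>I \<ge> 0\<close> in \<open>simp add: I_def add_nonneg_pos\<close>)
    also have "\<dots> \<le> e"
      using that \<open>I \<ge> 0\<close> by (simp add: field_simps)
    finally show ?thesis by simp
  qed
  then have "cmod (LINT x|M. g x * of_real (h (cis (X x)))) \<le> 0"
    by (rule field_le_epsilon)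
  then show ?thesis by simp
qed

text \<open>The indicator of an open set is the pointwise limit of the continuous functions min(1, n
  * distance to the complement).\<close>

lemma trig_null_open:
  assumes null: "trig_null M X g" and X [measurable]: "X \<in> borel_measurable M"
    and U: "open U"
  shows "(LINT x|M. g x * indicator U (cis (X x))) = 0"
\<comment> \<open>\<open>infdist\<close> to the empty set is 0, so the approximating functions would
  vanish for \<open>U = UNIV\<close>; that case is the coefficient with k = 0.\<close>
proof (cases "U = UNIV")
  case True
  then show ?thesis
    using null unfolding trig_null_def by (auto dest: spec[of _ 0])
next
  case False
  have g: "integrable M g" using null by (simp add: trig_null_def)
  then have [measurable]: "g \<in> borel_measurable M" by auto
  have [measurable]: "U \<in> sets borel" using U by auto
  define h where "h n z = min 1 (real n * infdist z (- U))" for n z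
  have h01: "0 \<le> h n z" "h n z \<le> 1" for n z
    by (auto simp: h_def infdist_nonneg)
  have cont: "continuous_on UNIV (h n)" for n
    unfolding h_def by (intro continuous_intros)
  have [measurable]: "h n \<in> borel_measurable borel" for n
    using cont by (rule borel_measurable_continuous_onI)
  have "(LINT x|M. g x * of_real (h n (cis (X x)))) = 0" for n
    by (rule trig_null_continuous[OF null X cont, where B = 1]) (use h01 in auto)
  moreover have "(\<lambda>n. LINT x|M. g x * of_real (h n (cis (X x)))) \<longlonglongrightarrow> (LINT x|M. g x * indicator U (cis (X x)))"
  proof (rule integral_dominated_convergence[where w = "\<lambda>x. cmod (g x)"])
    have lim: "(\<lambda>n. of_real (h n z)) \<longlonglongrightarrow> (indicator U z :: complex)" for z
    proof (cases "z \<in> U")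
      case True
      have "infdist z (- U) > 0"
        using in_closed_iff_infdist_zero[of "- U" z] U False True infdist_nonneg[of z "- U"]
        by (auto simp: closed_Compl less_le)
      have "eventually (\<lambda>n. 1 / infdist z (- U) \<le> real n) sequentially"
        by real_asymp
      then have "eventually (\<lambda>n. of_real (h n z) = (1 :: complex)) sequentially"
      proof eventually_elim
        case (elim n)
        with \<open>infdist z (- U) > 0\<close> show ?case
          by (simp add: h_def field_simps)
      qed
      then show ?thesis
        using True by (simp add: tendsto_eventually)
    next
      case False
      then show ?thesis
        using infdist_zero[of z "- U"] by (simp add: h_def)
    qed
    then show "AE x in M. (\<lambda>n. g x * of_real (h n (cis (X x)))) \<longlonglongrightarrow> g x * indicator U (cis (X x))"
      by (intro AE_I2 tendsto_mult tendsto_const)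
    show "AE x in M. cmod (g x * of_real (h n (cis (X x)))) \<le> cmod (g x)" for n
      using h01[of n] by (auto simp: norm_mult intro!: mult_left_le)
  qed (use g in auto)
  ultimately show ?thesis
    by (simp add: LIMSEQ_const_iff)
qed

text \<open>On [0, 2 pi) \<open>Arg2pi\<close> inverts \<open>cis\<close>, so a Borel set of angles
  becomes a Borel set of the plane, and these are generated by the open sets.\<close>

lemma trig_null_indicator:
  assumes null: "trig_null M X g" and X [measurable]: "X \<in> borel_measurable M"
    and AE: "AE x in M. X x \<in> {0..<2 * pi}" and A [measurable]: "A \<in> sets borel"
  shows "(LINT x|M. g x * indicator A (X x)) = 0"
proof -
  have g: "integrable M g" using null by (simp add: trig_null_def)
  then have [measurable]: "g \<in> borel_measurable M" by auto
  have "(LINT x|M. g x * indicator (Arg2pi -` A) (cis (X x))) = 0"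
  proof (rule integral_mult_indicator_eq_0[OF g, where N = borel and G = "{S. open S}"])
    show "Int_stable {S::complex set. open S}"
      by (auto simp: Int_stable_def)
    show "(LINT x|M. g x) = 0"
      using null unfolding trig_null_def by (auto dest: spec[of _ 0])
    show "Arg2pi -` A \<in> sets borel"
      using measurable_sets[OF borel_measurable_Arg2pi A] by simp
  qed (auto simp: sets_borel trig_null_open[OF null X])
  also have "(LINT x|M. g x * indicator (Arg2pi -` A) (cis (X x))) = (LINT x|M. g x * indicator A (X x))"
  proof (rule integral_cong_AE)
    show "(\<lambda>x. g x * indicator (Arg2pi -` A) (cis (X x))) \<in> borel_measurable M"
      using measurable_sets[OF borel_measurable_Arg2pi A] by simp
    show "AE x in M. g x * indicator (Arg2pi -` A) (cis (X x)) = g x * indicator A (X x)"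
      using AE
    proof eventually_elim
      case (elim x)
      then have "Arg2pi (cis (X x)) = X x"
        by (intro Arg2pi_unique[of 1]) (auto simp: cis_conv_exp)
      then show ?case by (simp add: indicator_def)
    qed
  qed auto
  finally show ?thesis .
qed

lemma AE_torus_component:
  assumes "i \<in> {1..d}"
  shows "AE x in torus d. x i \<in> {0..<2 * pi}"
  unfolding torus_eq
  by (rule AE_PiM_component[where M = "\<lambda>_. circ"]) (use assms AE_circ circ.prob_space_axioms in auto)

text \<open>Characters are traded for indicators one variable at a time. Vanishing for every
  frequency in variable \<open>i\<close> says that the remaining product \<open>g\<close> is
  \<open>trig_null\<close> for that coordinate, and \<open>trig_null_indicator\<close> then
  exchanges the factor.\<close>

lemma fourier_coeff_zero_boxes:
  assumes f: "integrable (torus d) f"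
    and zero: "\<And>k. k \<in> {1..d} \<rightarrow>\<^sub>E UNIV \<Longrightarrow> fourier_coeff d f k = 0"
    and A: "\<And>j. A j \<in> sets borel"
    and J: "J \<subseteq> {1..d}"
  shows "(LINT x|torus d. f x * (\<Prod>j\<in>J. indicator (A j) (x j)) *
           (\<Prod>j\<in>{1..d} - J. cis (of_int (k j) * x j))) = 0"
  using finite_subset[OF J finite_atLeastAtMost] J
proof (induction J arbitrary: k rule: finite_induct)
  case empty
  \<comment> \<open>The sign gives the character inside \<open>fourier_coeff\<close>, and the
    restriction makes \<open>l\<close> extensional, as \<open>zero\<close> requires.\<close>
  define l where "l = (\<lambda>j\<in>{1..d}. - k j)"
  have "(LINT x|torus d. f x * (\<Prod>j\<in>{1..d}. cis (of_int (k j) * x j))) = fourier_coeff d f l"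
    unfolding fourier_coeff_eq character_prod
    by (intro Bochner_Integration.integral_cong arg_cong2[of _ _ _ _ "(*)"] prod.cong) (auto simp: l_def)
  also have "\<dots> = 0"
    by (rule zero) (auto simp: l_def)
  finally show ?case by simp
next
  case (insert i J)
  define g where "g x = f x * (\<Prod>j\<in>J. indicator (A j) (x j)) *
      (\<Prod>j\<in>{1..d} - insert i J. cis (of_int (k j) * x j))" for x
  have [measurable]: "f \<in> borel_measurable (torus d)" using f by auto
  have i: "i \<in> {1..d}" "i \<notin> J" and J: "J \<subseteq> {1..d}" using insert by auto
  have [measurable]: "A j \<in> sets borel" for j by (rule A)
  have meas [measurable]: "(\<lambda>x. x j) \<in> borel_measurable (torus d)" if "j \<in> {1..d}" for j
    using that by (rule measurable_torus_component)
  have "integrable (torus d) g"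
  proof (rule Bochner_Integration.integrable_bound[OF f])
    have 1: "(\<lambda>x. indicator (A j) (x j) :: complex) \<in> borel_measurable (torus d)" if "j \<in> J" for j
      using measurable_compose[OF meas borel_measurable_indicator[OF A], of j] subsetD[OF J that] by simp
    have 2: "(\<lambda>x. cis (of_int (k j) * x j)) \<in> borel_measurable (torus d)" if "j \<in> {1..d} - insert i J" for j
    proof -
      have "j \<in> {1..d}" using that by simp
      then show ?thesis
        by (intro measurable_compose[OF _ measurable_cis] borel_measurable_times borel_measurable_const meas)
    qed
    show "g \<in> borel_measurable (torus d)"
      unfolding g_def
      by (intro borel_measurable_times borel_measurable_prod borel_measurable_integrable[OF f] 1 2)
    have "cmod (g x) \<le> cmod (f x)" for x
    proof -
      have "cmod (\<Prod>j\<in>J. indicator (A j) (x j) :: complex) \<le> 1"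
        unfolding prod_norm[symmetric] by (intro prod_le_1) (auto simp: indicator_def)
      moreover have "cmod (\<Prod>j\<in>{1..d} - insert i J. cis (of_int (k j) * x j)) = 1"
        unfolding prod_norm[symmetric] by simp
      ultimately show ?thesis
        unfolding g_def norm_mult by (simp only: mult_1_right) (rule mult_left_le, simp_all)
    qed
    then show "AE x in torus d. cmod (g x) \<le> cmod (f x)"
      by (rule AE_I2)
  qed
  moreover have "(LINT x|torus d. g x * cis (of_int m * x i)) = 0" for m :: int
  proof -
    have "(\<Prod>j\<in>{1..d} - J. cis (of_int ((k(i := m)) j) * x j)) =
        (\<Prod>j\<in>{1..d} - insert i J. cis (of_int (k j) * x j)) * cis (of_int m * x i)" for x
    proof -
      have "{1..d} - J - {i} = {1..d} - insert i J" by auto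
      then have "(\<Prod>j\<in>{1..d} - J. cis (of_int ((k(i := m)) j) * x j)) =
          cis (of_int ((k(i := m)) i) * x i) * (\<Prod>j\<in>{1..d} - insert i J. cis (of_int ((k(i := m)) j) * x j))"
        using i by (subst prod.remove[of _ i]) auto
      also have "(\<Prod>j\<in>{1..d} - insert i J. cis (of_int ((k(i := m)) j) * x j)) =
          (\<Prod>j\<in>{1..d} - insert i J. cis (of_int (k j) * x j))"
        by (rule prod.cong) auto
      finally show ?thesis by (simp only: fun_upd_same mult.commute)
    qed
    then show ?thesis
      using insert.IH[OF J, of "k(i := m)"] by (simp only: g_def mult.assoc)
  qed
  ultimately have "trig_null (torus d) (\<lambda>x. x i) g"
    by (simp add: trig_null_def)
  then have "(LINT x|torus d. g x * indicator (A i) (x i)) = 0"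
    by (rule trig_null_indicator) (use i AE_torus_component A in auto)
  then show ?case
    by (simp only: g_def prod.insert[OF insert.hyps] mult.assoc mult.commute mult.left_commute)
qed

text \<open>Boxes generate the product sigma-algebra and are stable under intersection, so
  \<open>f\<close> integrates to 0 over every measurable set; its real and imaginary parts are then
  densities of the zero measure.\<close>

theorem fourier_coeff_unique:
  assumes f: "integrable (torus d) f"
    and zero: "\<And>k. k \<in> {1..d} \<rightarrow>\<^sub>E UNIV \<Longrightarrow> fourier_coeff d f k = 0"
  shows "AE x in torus d. f x = 0"
proof -
  have box: "(LINT x|torus d. f x * (\<Prod>j\<in>{1..d}. indicator (E j) (x j))) = 0"
    if "\<And>j. E j \<in> sets borel" for E
    using fourier_coeff_zero_boxes[OF f zero that order_refl] by simp
  have all: "(LINT x|torus d. f x * indicator A x) = 0" if "A \<in> sets (torus d)" for A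
  proof (rule integral_mult_indicator_eq_0[OF f, where N = "torus d" and G = "prod_algebra {1..d} (\<lambda>_. circ)"])
    show "sets (torus d) = sigma_sets (space (torus d)) (prod_algebra {1..d} (\<lambda>_. circ))"
      by (simp add: torus_eq sets_PiM space_PiM)
    show "Int_stable (prod_algebra {1..d} (\<lambda>_. circ))"
      by (rule Int_stable_prod_algebra)
    show "prod_algebra {1..d} (\<lambda>_. circ) \<subseteq> Pow (space (torus d))"
      using prod_algebra_sets_into_space[of "{1..d}" "\<lambda>_. circ"] by (simp add: torus_eq space_PiM)
    show "(LINT x|torus d. f x) = 0"
      using box[of "\<lambda>_. UNIV"] by simp
    fix A assume "A \<in> prod_algebra {1..d} (\<lambda>_. circ)"
    then obtain E where E: "A = Pi\<^sub>E {1..d} E" "E \<in> (\<Pi> i\<in>{1..d}. sets circ)"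
      by (rule prod_algebraE_all)
    \<comment> \<open>\<open>fourier_coeff_zero_boxes\<close> wants Borel sets at all indices, while
      \<open>E\<close> is controlled only on \<open>{1..d}\<close>.\<close>
    define E' where "E' j = (if j \<in> {1..d} then E j else {})" for j
    have "(LINT x|torus d. f x * indicator A x) = (LINT x|torus d. f x * (\<Prod>j\<in>{1..d}. indicator (E' j) (x j)))"
    proof (intro Bochner_Integration.integral_cong refl arg_cong2[of _ _ _ _ "(*)"])
      fix x assume "x \<in> space (torus d)"
      then have "x \<in> A \<longleftrightarrow> (\<forall>j\<in>{1..d}. x j \<in> E' j)"
        by (auto simp: E(1) E'_def space_torus PiE_iff)
      then show "indicator A x = (\<Prod>j\<in>{1..d}. indicator (E' j) (x j) :: complex)"
        by (auto simp: indicator_def)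
    qed
    also have "\<dots> = 0"
      using E(2) by (intro box) (auto simp: E'_def)
    finally show "(LINT x|torus d. f x * indicator A x) = 0" .
  qed (use that in auto)
  have int: "integrable (torus d) (\<lambda>x. f x * indicator A x)" if "A \<in> sets (torus d)" for A
  proof (rule Bochner_Integration.integrable_bound[OF f])
    show "(\<lambda>x. f x * indicator A x) \<in> borel_measurable (torus d)"
      by (intro borel_measurable_times borel_measurable_integrable[OF f] borel_measurable_indicator that)
    show "AE x in torus d. cmod (f x * indicator A x) \<le> cmod (f x)"
      by (intro AE_I2) (simp add: norm_mult indicator_def)
  qed
  have "AE x in torus d. Re (f x) = 0"
  proof (rule density_unique_real)
    fix A assume A: "A \<in> sets (torus d)"
    have "(LINT x:A|torus d. Re (f x)) = (LINT x|torus d. Re (f x * indicator A x))"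
      unfolding set_lebesgue_integral_def
      by (intro Bochner_Integration.integral_cong refl) (simp add: indicator_def)
    also have "\<dots> = Re (LINT x|torus d. f x * indicator A x)"
      by (rule integral_Re[OF int[OF A]])
    finally show "(LINT x:A|torus d. Re (f x)) = (LINT x:A|torus d. 0)"
      using all[OF A] by (simp add: set_lebesgue_integral_def)
  qed (use f in auto)
  moreover have "AE x in torus d. Im (f x) = 0"
  proof (rule density_unique_real)
    fix A assume A: "A \<in> sets (torus d)"
    have "(LINT x:A|torus d. Im (f x)) = (LINT x|torus d. Im (f x * indicator A x))"
      unfolding set_lebesgue_integral_def
      by (intro Bochner_Integration.integral_cong refl) (simp add: indicator_def)
    also have "\<dots> = Im (LINT x|torus d. f x * indicator A x)"
      by (rule integral_Im[OF int[OF A]])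
    finally show "(LINT x:A|torus d. Im (f x)) = (LINT x:A|torus d. 0)"
      using all[OF A] by (simp add: set_lebesgue_integral_def)
  qed (use f in auto)
  ultimately show ?thesis
    by eventually_elim (simp add: complex_eq_iff)
qed

section \<open>Fejer and de la Vallee-Poussin kernels\<close>

lemma powr_ge_tangent:
  fixes q y g :: real
  assumes "1 \<le> q" "0 < y" "0 \<le> g"
  shows "q * y powr (q - 1) * g \<le> g powr q + (q - 1) * y powr q"
proof (cases "q = 1")
  case True
  with assms show ?thesis by simp
next
  case False
  define q' where "q' = q / (q - 1)"
  have "q > 1" using False assms by simp
  then have "q' > 1" "1 / q + 1 / q' = 1"
    by (auto simp: q'_def field_simps)
  with \<open>q > 1\<close> assms have "g * y powr (q - 1) \<le> g powr q / q + (y powr (q - 1)) powr q' / q'"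
    by (intro Youngs_inequality) auto
  also have "(y powr (q - 1)) powr q' = y powr q"
    using \<open>q > 1\<close> by (simp add: powr_powr q'_def)
  finally have "q * (g * y powr (q - 1)) \<le> q * (g powr q / q + y powr q / q')"
    using \<open>q > 1\<close> by (intro mult_left_mono) auto
  also have "\<dots> = g powr q + (q - 1) * y powr q"
    using \<open>q > 1\<close> by (simp add: q'_def field_simps)
  finally show ?thesis by (simp add: mult_ac)
qed

text \<open>Jensen's inequality for a weight of mass at most \<open>L\<close>, by integrating the
  tangent inequality. It is applied to convolutions, to the comparison of L_1 with L_q, and to
  series, as integrals over a counting measure.\<close>

lemma powr_nn_integral_le:
  fixes g w :: "'a \<Rightarrow> real"
  assumes [measurable]: "g \<in> borel_measurable M" "w \<in> borel_measurable M"
    and g: "\<And>x. 0 \<le> g x" and w: "\<And>x. 0 \<le> w x"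
    and q: "1 \<le> q" and L: "0 < L" "(\<integral>\<^sup>+x. ennreal (w x) \<partial>M) \<le> ennreal L"
    and c: "0 \<le> c" "ennreal c \<le> (\<integral>\<^sup>+x. ennreal (g x * w x) \<partial>M)"
  shows "ennreal (c powr q) \<le> ennreal (L powr (q - 1)) * (\<integral>\<^sup>+x. ennreal (g x powr q * w x) \<partial>M)"
proof (cases "c = 0")
  case False
  with c have "c > 0" by simp
  \<comment> \<open>The tangent is taken at the mean value c / L, where the estimate is
    sharp.\<close>
  define y where "y = c / L"
  have "y > 0" using \<open>c > 0\<close> L by (simp add: y_def)
  define z where "z = y powr (q - 1) * c"
  have "z \<ge> 0" using c by (simp add: z_def)
  have yL: "y powr q * L = z"
    using \<open>y > 0\<close> L by (simp add: z_def y_def powr_diff field_simps)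
  define B where "B = (\<integral>\<^sup>+x. ennreal (g x powr q * w x) \<partial>M)"
  have "ennreal (q * z) = ennreal (q * y powr (q - 1)) * ennreal c"
    using q c by (simp add: z_def ennreal_mult mult.assoc)
  also have "\<dots> \<le> ennreal (q * y powr (q - 1)) * (\<integral>\<^sup>+x. ennreal (g x * w x) \<partial>M)"
    by (intro mult_left_mono c) auto
  also have "\<dots> = (\<integral>\<^sup>+x. ennreal (q * y powr (q - 1)) * ennreal (g x * w x) \<partial>M)"
    by (rule nn_integral_cmult[symmetric]) simp
  also have "\<dots> \<le> (\<integral>\<^sup>+x. ennreal (g x powr q * w x) + ennreal ((q - 1) * y powr q) * ennreal (w x) \<partial>M)"
  proof (rule nn_integral_mono)
    fix x
    have "ennreal (q * y powr (q - 1)) * ennreal (g x * w x) = ennreal (q * y powr (q - 1) * g x * w x)"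
      using q g w by (simp add: ennreal_mult[symmetric] mult.assoc)
    also have "\<dots> \<le> ennreal ((g x powr q + (q - 1) * y powr q) * w x)"
      using powr_ge_tangent[OF q \<open>y > 0\<close> g] w by (intro ennreal_leI mult_right_mono)
    also have "\<dots> = ennreal (g x powr q * w x) + ennreal ((q - 1) * y powr q) * ennreal (w x)"
      using q w by (simp add: distrib_right ennreal_mult)
    finally show "ennreal (q * y powr (q - 1)) * ennreal (g x * w x) \<le>
        ennreal (g x powr q * w x) + ennreal ((q - 1) * y powr q) * ennreal (w x)" .
  qed
  also have "\<dots> = B + ennreal ((q - 1) * y powr q) * (\<integral>\<^sup>+x. ennreal (w x) \<partial>M)"
    by (simp add: B_def nn_integral_add nn_integral_cmult)
  also have "\<dots> \<le> B + ennreal ((q - 1) * y powr q) * ennreal L"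
    by (intro add_left_mono mult_left_mono L) auto
  also have "ennreal ((q - 1) * y powr q) * ennreal L = ennreal ((q - 1) * z)"
    using q L by (simp add: ennreal_mult[symmetric] mult.assoc yL)
  finally have le: "ennreal (q * z) \<le> B + ennreal ((q - 1) * z)" .
  have "ennreal z \<le> B"
  proof (cases B)
    case (real b)
    then have "q * z \<le> b + (q - 1) * z"
      using le q \<open>z \<ge> 0\<close> by (simp flip: ennreal_plus)
    then show ?thesis
      using real by (simp add: algebra_simps ennreal_leI)
  qed auto
  have "c powr q = L powr (q - 1) * z"
    using \<open>c > 0\<close> L by (simp add: z_def y_def powr_divide powr_diff)
  then have "ennreal (c powr q) = ennreal (L powr (q - 1)) * ennreal z"
    using \<open>z \<ge> 0\<close> by (simp add: ennreal_mult)
  also have "\<dots> \<le> ennreal (L powr (q - 1)) * B"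
    by (intro mult_left_mono \<open>ennreal z \<le> B\<close>) auto
  finally show ?thesis by (simp add: B_def)
qed simp

text \<open>The squared modulus makes nonnegativity and the bound \<open>N\<close> immediate; the
  Fourier expansions follow in \<open>fejer_cis\<close> and \<open>fejer_cos\<close>.\<close>

definition fejer :: "nat \<Rightarrow> real \<Rightarrow> real" where
  "fejer N t = (cmod (\<Sum>a<N. cis (real a * t)))\<^sup>2 / real N"

lemma fejer_nonneg: "0 \<le> fejer N t"
  by (simp add: fejer_def)

lemma fejer_le: "fejer N t \<le> real N"
proof -
  have "cmod (\<Sum>a<N. cis (real a * t)) \<le> (\<Sum>a<N. 1)"
    by (intro order_trans[OF norm_sum] sum_mono) simp
  then have "(cmod (\<Sum>a<N. cis (real a * t)))\<^sup>2 \<le> (real N)\<^sup>2"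
    by (intro power_mono) auto
  then show ?thesis
    by (cases "N = 0") (simp_all add: fejer_def field_simps power2_eq_square)
qed

lemma measurable_fejer [measurable]: "fejer N \<in> borel_measurable borel"
  unfolding fejer_def[abs_def] by measurable

lemma fejer_1 [simp]: "fejer (Suc 0) t = 1"
  by (simp add: fejer_def)

lemma fejer_cis:
  "complex_of_real (fejer N t) = (\<Sum>(a, b)\<in>{..<N} \<times> {..<N}. cis (of_int (int a - int b) * t)) / of_nat N"
proof -
  have "complex_of_real ((cmod (\<Sum>a<N. cis (real a * t)))\<^sup>2) =
      (\<Sum>a<N. cis (real a * t)) * (\<Sum>b<N. cis (- (real b * t)))"
    unfolding complex_norm_square by (simp add: cis_cnj)
  also have "\<dots> = (\<Sum>(a, b)\<in>{..<N} \<times> {..<N}. cis (of_int (int a - int b) * t))"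
    unfolding sum_product sum.cartesian_product
    by (intro sum.cong) (auto simp: cis_mult algebra_simps)
  finally show ?thesis
    by (simp add: fejer_def)
qed

text \<open>Adding the term \<open>cis (N * t)\<close> to the sum contributes 1 and the cross terms
  2 cos(k t), k = 1, ..., N, which raises each weight N - k by one. The factor \<open>N\<close> on
  the left clears the denominator.\<close>

lemma fejer_cos: "real N * fejer N t = real N + 2 * (\<Sum>k=1..<N. (real N - real k) * cos (real k * t))"
proof (cases "N = 0")
  case False
  have "(cmod (\<Sum>a<N. cis (real a * t)))\<^sup>2 = real N + 2 * (\<Sum>k=1..<N. (real N - real k) * cos (real k * t))"
  proof (induction N)
    case (Suc N)
    have "(cmod (\<Sum>a<Suc N. cis (real a * t)))\<^sup>2 =
        (cmod (\<Sum>a<N. cis (real a * t)))\<^sup>2 + 1 + 2 * Re ((\<Sum>a<N. cis (real a * t)) * cnj (cis (real N * t)))"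
    proof -
      have "(cmod (z + w))\<^sup>2 = (cmod z)\<^sup>2 + (cmod w)\<^sup>2 + 2 * Re (z * cnj w)" for z w
        unfolding cmod_power2 by (simp add: power2_eq_square algebra_simps)
      then show ?thesis
        unfolding sum.lessThan_Suc by simp
    qed
    also have "Re ((\<Sum>a<N. cis (real a * t)) * cnj (cis (real N * t))) = (\<Sum>a<N. cos ((real N - real a) * t))"
      by (simp add: sum_distrib_right cis_cnj cis_mult)
        (intro sum.cong refl, simp add: algebra_simps cos_diff)
    also have "\<dots> = (\<Sum>k=1..<Suc N. cos (real k * t))"
      by (rule sum.reindex_bij_witness[of _ "\<lambda>k. N - k" "\<lambda>a. N - a"]) (auto simp: of_nat_diff)
    also note Suc.IH
    also have "real N + 2 * (\<Sum>k=1..<N. (real N - real k) * cos (real k * t)) + 1 +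
        2 * (\<Sum>k=1..<Suc N. cos (real k * t)) =
        real (Suc N) + 2 * (\<Sum>k=1..<Suc N. (real (Suc N) - real k) * cos (real k * t))"
    proof -
      have "(\<Sum>k=1..<N. (real N - real k) * cos (real k * t)) =
          (\<Sum>k=1..<Suc N. (real N - real k) * cos (real k * t))"
        by (cases "N = 0") auto
      then show ?thesis
        by (simp add: sum.distrib[symmetric] sum_distrib_left algebra_simps)
    qed
    finally show ?case .
  qed simp
  with False show ?thesis
    by (simp add: fejer_def)
qed simp

text \<open>Comparison of coefficients: 2 (1 - k / 2l) - (1 - k / l) = 1 for k up to l, and beyond l
  only the first kernel contributes, with 2 - k / l = 1 - (k - l) / l.\<close>

lemma VP_kernel_fejer:
  assumes "l \<ge> 1"
  shows "VP_kernel l t = 2 * fejer (2 * l) t - fejer l t"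
proof -
  have 1: "fejer (2 * l) t = 1 + 2 * (\<Sum>k=1..2*l-1. (1 - real k / real (2 * l)) * cos (real k * t))"
  proof -
    have "real (2 * l) * fejer (2 * l) t = real (2 * l) *
        (1 + 2 * (\<Sum>k=1..2*l-1. (1 - real k / real (2 * l)) * cos (real k * t)))"
      unfolding fejer_cos distrib_left sum_distrib_left
      using assms by (intro arg_cong2[of _ _ _ _ "(+)"] sum.cong) (auto simp: field_simps)
    then show ?thesis using assms by simp
  qed
  have 2: "fejer l t = 1 + 2 * (\<Sum>k=1..l. (1 - real k / real l) * cos (real k * t))"
  proof -
    have "{1..l} = insert l {1..<l}" using assms by auto
    then have "(\<Sum>k=1..l. (1 - real k / real l) * cos (real k * t)) = (\<Sum>k=1..<l. (1 - real k / real l) * cos (real k * t))"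
      using assms by simp
    moreover have "real l * fejer l t = real l *
        (1 + 2 * (\<Sum>k=1..<l. (1 - real k / real l) * cos (real k * t)))"
      unfolding fejer_cos distrib_left sum_distrib_left
      using assms by (intro arg_cong2[of _ _ _ _ "(+)"] sum.cong) (auto simp: field_simps)
    ultimately show ?thesis using assms by simp
  qed
  have "(\<Sum>k=1..2*l-1. (2 - real k / real l) * cos (real k * t)) =
      (\<Sum>k=1..l. (2 - real k / real l) * cos (real k * t)) +
      (\<Sum>k=l+1..2*l-1. (2 - real k / real l) * cos (real k * t))"
    by (subst sum.union_disjoint[symmetric]) (use assms in \<open>auto intro!: sum.cong\<close>)
  also have "(\<Sum>k=1..l. (2 - real k / real l) * cos (real k * t)) =
      (\<Sum>k=1..l. cos (real k * t)) + (\<Sum>k=1..l. (1 - real k / real l) * cos (real k * t))"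
    by (simp add: sum.distrib[symmetric] algebra_simps)
  finally have 3: "(\<Sum>k=1..2*l-1. (2 - real k / real l) * cos (real k * t)) =
      (\<Sum>k=1..l. cos (real k * t)) + (\<Sum>k=1..l. (1 - real k / real l) * cos (real k * t)) +
      (\<Sum>k=l+1..2*l-1. (2 - real k / real l) * cos (real k * t))" .
  have "2 * (\<Sum>k=1..2*l-1. (1 - real k / real (2 * l)) * cos (real k * t)) =
      (\<Sum>k=1..2*l-1. (2 - real k / real l) * cos (real k * t))"
    unfolding sum_distrib_left by (intro sum.cong) (auto simp: algebra_simps)
  moreover have "(\<Sum>k=l+1..2*l-1. (1 - (real k - real l) / real l) * cos (real k * t)) =
      (\<Sum>k=l+1..2*l-1. (2 - real k / real l) * cos (real k * t))"
    using assms by (intro sum.cong) (auto simp: field_simps)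
  ultimately show ?thesis
    unfolding VP_kernel_def 1 2 using 3 by simp
qed

section \<open>Fourier coefficients of the kernels\<close>

lemma sum_cis_symmetric:
  "(\<Sum>k\<in>{- int n..int n}. complex_of_real (c (nat \<bar>k\<bar>)) * cis (of_int k * t)) =
     complex_of_real (c 0 + 2 * (\<Sum>k=1..n. c k * cos (real k * t)))"
proof (induction n)
  case (Suc n)
  have "{- int (Suc n)..int (Suc n)} = insert (int (Suc n)) (insert (- int (Suc n)) {- int n..int n})"
    by auto
  then have "(\<Sum>k\<in>{- int (Suc n)..int (Suc n)}. complex_of_real (c (nat \<bar>k\<bar>)) * cis (of_int k * t)) =
      complex_of_real (c (Suc n)) * (cis (real (Suc n) * t) + cis (- (real (Suc n) * t))) +
      (\<Sum>k\<in>{- int n..int n}. complex_of_real (c (nat \<bar>k\<bar>)) * cis (of_int k * t))"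
    by (simp add: algebra_simps nat_add_distrib)
  also have "cis (real (Suc n) * t) + cis (- (real (Suc n) * t)) = complex_of_real (2 * cos (real (Suc n) * t))"
    by (simp add: complex_eq_iff)
  finally show ?case
    unfolding Suc.IH by (simp add: algebra_simps)
qed simp

text \<open>A trapezoid, 1 for |k| up to l and 0 from 2l on: the Fourier coefficients of V_l in
  closed form.\<close>

definition vp_coeff :: "nat \<Rightarrow> int \<Rightarrow> real" where
  "vp_coeff l k = max 0 (min 1 (2 - real_of_int \<bar>k\<bar> / real l))"

text \<open>The range \<open>n\<close> is free so that kernels of different orders can be written
  over a common range and subtracted.\<close>

lemma VP_kernel_cis:
  assumes "1 \<le> l" "2 * l \<le> n"
  shows "complex_of_real (VP_kernel l t) = (\<Sum>k\<in>{- int n..int n}. complex_of_real (vp_coeff l k) * cis (of_int k * t))"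
proof -
  define c where "c k = vp_coeff l (int k)" for k
  have c: "c 0 = 1" "\<And>k. k \<le> l \<Longrightarrow> c k = 1" "\<And>k. 2 * l \<le> k \<Longrightarrow> c k = 0"
    "\<And>k. l \<le> k \<Longrightarrow> k \<le> 2 * l \<Longrightarrow> c k = 1 - (real k - real l) / real l"
    using assms by (auto simp: c_def vp_coeff_def field_simps max_def min_def)
  have "(\<Sum>k\<in>{- int n..int n}. complex_of_real (vp_coeff l k) * cis (of_int k * t)) =
      (\<Sum>k\<in>{- int n..int n}. complex_of_real (c (nat \<bar>k\<bar>)) * cis (of_int k * t))"
    by (intro sum.cong) (auto simp: c_def vp_coeff_def)
  also have "\<dots> = complex_of_real (c 0 + 2 * (\<Sum>k=1..n. c k * cos (real k * t)))"
    by (rule sum_cis_symmetric)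
  also have "(\<Sum>k=1..n. c k * cos (real k * t)) = (\<Sum>k\<in>{1..l} \<union> {l+1..2*l-1}. c k * cos (real k * t))"
    using assms by (intro sum.mono_neutral_right) (auto simp: c)
  also have "\<dots> = (\<Sum>k=1..l. c k * cos (real k * t)) + (\<Sum>k=l+1..2*l-1. c k * cos (real k * t))"
    by (intro sum.union_disjoint) auto
  also have "(\<Sum>k=1..l. c k * cos (real k * t)) = (\<Sum>k=1..l. cos (real k * t))"
    by (intro sum.cong) (auto simp: c)
  also have "(\<Sum>k=l+1..2*l-1. c k * cos (real k * t)) =
      (\<Sum>k=l+1..2*l-1. (1 - (real k - real l) / real l) * cos (real k * t))"
    by (intro sum.cong) (auto simp: c)
  also have "c 0 + 2 * ((\<Sum>k=1..l. cos (real k * t)) +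
      (\<Sum>k=l+1..2*l-1. (1 - (real k - real l) / real l) * cos (real k * t))) = VP_kernel l t"
    by (simp add: VP_kernel_def c)
  finally show ?thesis by simp
qed

text \<open>For s = 1 the constant 1 is subtracted rather than V_1, so the frequencies 1 and -1 keep
  the coefficient 1.\<close>

definition a_coeff :: "nat \<Rightarrow> int \<Rightarrow> real" where
  "a_coeff s k = vp_coeff (2 ^ s) k - (if s = 1 then of_bool (k = 0) else vp_coeff (2 ^ (s - 1)) k)"

lemma a_kernel_cis:
  assumes "1 \<le> s"
  shows "complex_of_real (a_kernel s t) =
    (\<Sum>k\<in>{- int (2 ^ (s + 1))..int (2 ^ (s + 1))}. complex_of_real (a_coeff s k) * cis (of_int k * t))"
proof (cases "s = 1")
  case True
  have "(\<Sum>k\<in>{- 4..4::int}. complex_of_real (of_bool (k = 0)) * cis (of_int k * t)) =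
      (\<Sum>k\<in>{- 4..4::int}. if k = 0 then 1 else 0)"
    by (intro sum.cong) auto
  also have "\<dots> = 1" by simp
  finally show ?thesis
    using VP_kernel_cis[of 2 4 t] True
    by (simp add: a_kernel_def a_coeff_def left_diff_distrib sum_subtractf)
next
  case False
  have "2 * 2 ^ (s - 1) \<le> (2::nat) ^ (s + 1)"
    by (cases s) auto
  then show ?thesis
    using VP_kernel_cis[of "2 ^ s" "2 ^ (s + 1)" t] VP_kernel_cis[of "2 ^ (s - 1)" "2 ^ (s + 1)" t] False
    by (simp add: a_kernel_def a_coeff_def left_diff_distrib sum_subtractf)
qed

text \<open>Below 2 ^ (s - 1) both trapezoids are 1, from 2 ^ (s + 1) on both are 0. For s = 1 the
  lower range is k = 0, where the subtracted constant cancels.\<close>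

lemma a_coeff_eq_0:
  assumes "1 \<le> s" "\<bar>k\<bar> < 2 ^ (s - 1) \<or> 2 ^ (s + 1) \<le> \<bar>k\<bar>"
  shows "a_coeff s k = 0"
proof -
  obtain m where m: "s = Suc m" using assms by (cases s) auto
  define x where "x = \<bar>real_of_int k\<bar>"
  have x: "x < 2 ^ m \<or> 4 * 2 ^ m \<le> x"
  proof -
    have "\<bar>k\<bar> < 2 ^ m \<or> 4 * 2 ^ m \<le> \<bar>k\<bar>"
      using assms(2) by (simp add: m)
    then have "real_of_int \<bar>k\<bar> < real_of_int (2 ^ m) \<or> real_of_int (4 * 2 ^ m) \<le> real_of_int \<bar>k\<bar>"
      by (simp only: of_int_less_iff of_int_le_iff)
    then show ?thesis by (simp add: x_def)
  qed
  have "x \<ge> 0" by (simp add: x_def)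
  have v: "vp_coeff (2 ^ i) k = (if x < 2 ^ m then 1 else 0)" if "i = m \<or> i = Suc m" for i
  proof (cases "x < 2 ^ m")
    case True
    then have "x \<le> 2 ^ i"
      using that \<open>x \<ge> 0\<close> by auto
    then show ?thesis
      using True by (simp add: vp_coeff_def field_simps x_def[symmetric])
  next
    case False
    then have "2 * 2 ^ i \<le> x"
      using that x zero_le_power[of "2::real" m] by (auto simp del: zero_le_power)
    then have le: "(2 * 2 ^ i - x) / 2 ^ i \<le> 0"
      by (simp add: divide_le_0_iff)
    have "vp_coeff (2 ^ i) k = max 0 (min 1 ((2 * 2 ^ i - x) / 2 ^ i))"
      by (simp add: vp_coeff_def x_def field_simps)
    also have "\<dots> = 0"
      by (rule max_absorb1[OF min.coboundedI2[OF le]])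
    finally show ?thesis
      using False by simp
  qed
  show ?thesis
  proof (cases "m = 0")
    case True
    then have "k = 0 \<longleftrightarrow> x < 2 ^ m" by (auto simp: x_def)
    then show ?thesis
      using v[of "Suc m"] True by (simp add: a_coeff_def m)
  next
    case False
    then show ?thesis
      using v[of m] v[of "Suc m"] by (simp add: a_coeff_def m)
  qed
qed

text \<open>Here the wider trapezoid is still 1 while the narrower one descends linearly. These
  values are averaged in \<open>sum_a_coeff_bump\<close>.\<close>

lemma a_coeff_ramp:
  assumes "2 \<le> s" "2 ^ (s - 1) \<le> \<bar>k\<bar>" "\<bar>k\<bar> \<le> 2 ^ s"
  shows "a_coeff s k = real_of_int \<bar>k\<bar> / 2 ^ (s - 1) - 1"
proof -
  obtain m where m: "s = Suc m" using assms by (cases s) auto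
  define x where "x = \<bar>real_of_int k\<bar>"
  have "real_of_int (2 ^ m) \<le> real_of_int \<bar>k\<bar>" "real_of_int \<bar>k\<bar> \<le> real_of_int (2 * 2 ^ m)"
    using assms(2,3) unfolding of_int_le_iff by (simp_all add: m)
  then have "2 ^ m \<le> x" "x \<le> 2 * 2 ^ m" by (simp_all add: x_def)
  then show ?thesis
    using assms(1) by (simp add: a_coeff_def vp_coeff_def m x_def[symmetric] field_simps max_def min_def)
qed

text \<open>Common conditions on a nonnegative majorant of a kernel. The height \<open>H\<close>
  enters sup bounds, the mass enters L_q bounds; 6 is the mass of \<open>a_weight\<close>, and
  \<open>vp_weight\<close>, of mass 3, fits as well. Both variables of x - t are integrated because
  \<open>w\<close> is assumed neither even nor periodic.\<close>

definition weight :: "real \<Rightarrow> (real \<Rightarrow> real) \<Rightarrow> bool" where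
  "weight H w \<longleftrightarrow> w \<in> borel_measurable borel \<and> (\<forall>t. 0 \<le> w t \<and> w t \<le> H) \<and>
     (\<forall>x. (\<integral>\<^sup>+t. ennreal (w (x - t)) \<partial>circ) \<le> 6) \<and> (\<forall>t. (\<integral>\<^sup>+x. ennreal (w (x - t)) \<partial>circ) \<le> 6)"

lemma nn_integral_fejer:
  assumes "N \<ge> 1"
  shows "(\<integral>\<^sup>+t. ennreal (fejer N (x - t)) \<partial>circ) = 1" "(\<integral>\<^sup>+x. ennreal (fejer N (x - t)) \<partial>circ) = 1"
proof -
  have count: "(\<Sum>(a, b)\<in>{..<N} \<times> {..<N}. if int a - int b = 0 then 1 else 0 :: complex) = of_nat N"
  proof -
    have "(\<Sum>(a, b)\<in>{..<N} \<times> {..<N}. if int a - int b = 0 then 1 else 0 :: complex) =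
        (\<Sum>a<N. \<Sum>b<N. if a = b then 1 else 0)"
      unfolding sum.cartesian_product by (intro sum.cong) auto
    then show ?thesis by simp
  qed
  \<comment> \<open>The slopes 1 and -1 cover both claims; only the N diagonal pairs a = b survive
    the integration.\<close>
  have main: "(\<integral>\<^sup>+t. ennreal (fejer N (c * t + e)) \<partial>circ) = 1" if m: "m = 1 \<or> m = - 1" and c: "c = real_of_int m" for m c e
  proof -
    have int: "integrable circ (\<lambda>t. fejer N (c * t + e))"
      using fejer_nonneg fejer_le by (intro integrable_circ_bounded[where B = "real N"]) (auto simp: abs_of_nonneg)
    have "complex_of_real (LINT t|circ. fejer N (c * t + e)) = (LINT t|circ. complex_of_real (fejer N (c * t + e)))"
      by simp
    also have "\<dots> = (LINT t|circ. (\<Sum>(a, b)\<in>{..<N} \<times> {..<N}.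
        cis (of_int (int a - int b) * e) / of_nat N * cis (of_int (m * (int a - int b)) * t)))"
      unfolding fejer_cis sum_divide_distrib
      by (intro Bochner_Integration.integral_cong sum.cong refl)
         (use c m in \<open>auto simp: cis_mult algebra_simps\<close>)
    also have "\<dots> = (\<Sum>(a, b)\<in>{..<N} \<times> {..<N}.
        cis (of_int (int a - int b) * e) / of_nat N * (if m * (int a - int b) = 0 then 1 else 0))"
      unfolding case_prod_beta
      by (subst Bochner_Integration.integral_sum)
         (auto simp only: integral_cis integral_mult_right_zero
           intro!: integrable_mult_right integrable_circ_bounded[where B = 1] sum.cong,
           auto)
    also have "\<dots> = (\<Sum>(a, b)\<in>{..<N} \<times> {..<N}. (if int a - int b = 0 then 1 else 0) / of_nat N)"
      using m by (intro sum.cong) auto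
    also have "\<dots> = 1"
      using assms count by (simp add: case_prod_beta flip: sum_divide_distrib)
    finally have "(LINT t|circ. fejer N (c * t + e)) = 1" by simp
    with int show ?thesis
      by (subst nn_integral_eq_integral) (auto simp: fejer_nonneg)
  qed
  show "(\<integral>\<^sup>+t. ennreal (fejer N (x - t)) \<partial>circ) = 1"
    using main[of "- 1" "- 1" x] by (simp add: add.commute)
  show "(\<integral>\<^sup>+x. ennreal (fejer N (x - t)) \<partial>circ) = 1"
    using main[of 1 1 "- t"] by simp
qed

text \<open>\<open>VP_kernel_fejer\<close> with the minus sign reversed: a majorant of |V_l| with
  mass 2 + 1 and height at most 4l + l.\<close>

definition vp_weight :: "nat \<Rightarrow> real \<Rightarrow> real" where
  "vp_weight l t = 2 * fejer (2 * l) t + fejer l t"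

lemma measurable_vp_weight [measurable]: "vp_weight l \<in> borel_measurable borel"
  unfolding vp_weight_def[abs_def] by measurable

lemma vp_weight_bounds: "0 \<le> vp_weight l t" "vp_weight l t \<le> 5 * real l"
  using fejer_nonneg[of "2 * l" t] fejer_nonneg[of l t] fejer_le[of "2 * l" t] fejer_le[of l t]
  by (auto simp: vp_weight_def)

lemma nn_integral_vp_weight:
  assumes "l \<ge> 1"
  shows "(\<integral>\<^sup>+t. ennreal (vp_weight l (x - t)) \<partial>circ) = 3" "(\<integral>\<^sup>+x. ennreal (vp_weight l (x - t)) \<partial>circ) = 3"
proof -
  have [measurable]: "(\<lambda>t. ennreal (fejer n (x - t))) \<in> borel_measurable circ"
    "(\<lambda>x. ennreal (fejer n (x - t))) \<in> borel_measurable circ" for n t x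
    unfolding measurable_cong_sets[OF sets_circ refl] by measurable
  have "2 * l \<ge> 1" using assms by simp
  note int = nn_integral_fejer[OF this] nn_integral_fejer[OF assms]
  have split: "ennreal (vp_weight l u) = 2 * ennreal (fejer (2 * l) u) + ennreal (fejer l u)" for u
    by (simp add: vp_weight_def ennreal_plus ennreal_mult fejer_nonneg)
  have "(\<integral>\<^sup>+t. ennreal (vp_weight l (x - t)) \<partial>circ) = 2 * 1 + 1"
    unfolding split by (subst nn_integral_add, measurable, subst nn_integral_cmult, measurable, simp only: int)
  moreover have "(\<integral>\<^sup>+x. ennreal (vp_weight l (x - t)) \<partial>circ) = 2 * 1 + 1"
    unfolding split by (subst nn_integral_add, measurable, subst nn_integral_cmult, measurable, simp only: int)
  ultimately show "(\<integral>\<^sup>+t. ennreal (vp_weight l (x - t)) \<partial>circ) = 3" "(\<integral>\<^sup>+x. ennreal (vp_weight l (x - t)) \<partial>circ) = 3"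
    by simp_all
qed

lemma weight_vp_weight:
  assumes "l \<ge> 1"
  shows "weight (5 * real l) (vp_weight l)"
  using vp_weight_bounds[of l] nn_integral_vp_weight[OF assms] by (simp add: weight_def)

lemma VP_kernel_le: "l \<ge> 1 \<Longrightarrow> \<bar>VP_kernel l t\<bar> \<le> vp_weight l t"
  using fejer_nonneg[of "2 * l" t] fejer_nonneg[of l t] by (simp add: VP_kernel_fejer vp_weight_def)

text \<open>Triangle inequality for a difference of two kernels. For s = 1 the summand
  \<open>vp_weight 1\<close> contains the kernel of order 1, which is constantly 1, and so majorizes
  the subtracted constant.\<close>

definition a_weight :: "nat \<Rightarrow> real \<Rightarrow> real" where
  "a_weight s t = vp_weight (2 ^ s) t + vp_weight (2 ^ (s - 1)) t"

lemma weight_a_weight: "weight (10 * 2 ^ s) (a_weight s)"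
proof -
  have "real (2 ^ (s - 1)) \<le> 2 ^ s" "real (2 ^ s) = 2 ^ s"
    by (simp_all add: power_increasing)
  then have le: "a_weight s t \<le> 10 * 2 ^ s" for t
    using vp_weight_bounds(2)[of "2 ^ s" t] vp_weight_bounds(2)[of "2 ^ (s - 1)" t]
    unfolding a_weight_def by linarith
  have m: "(\<lambda>t. ennreal (vp_weight n (x - t))) \<in> borel_measurable circ"
    "(\<lambda>x. ennreal (vp_weight n (x - t))) \<in> borel_measurable circ" for n t x
    unfolding measurable_cong_sets[OF sets_circ refl] by measurable
  have split: "ennreal (a_weight s u) = ennreal (vp_weight (2 ^ s) u) + ennreal (vp_weight (2 ^ (s - 1)) u)" for u
    by (simp add: a_weight_def ennreal_plus vp_weight_bounds)
  have "1 \<le> (2::nat) ^ s" "1 \<le> (2::nat) ^ (s - 1)" by simp_all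
  note int = nn_integral_vp_weight[OF this(1)] nn_integral_vp_weight[OF this(2)]
  have "(\<integral>\<^sup>+t. ennreal (a_weight s (x - t)) \<partial>circ) = 3 + 3" for x
    unfolding split by (subst nn_integral_add[OF m(1) m(1)]) (simp only: int)
  moreover have "(\<integral>\<^sup>+x. ennreal (a_weight s (x - t)) \<partial>circ) = 3 + 3" for t
    unfolding split by (subst nn_integral_add[OF m(2) m(2)]) (simp only: int)
  moreover have "a_weight s \<in> borel_measurable borel"
    unfolding a_weight_def[abs_def] by measurable
  ultimately show ?thesis
    using le by (auto simp: weight_def a_weight_def vp_weight_bounds)
qed

lemma a_kernel_le:
  assumes "1 \<le> s"
  shows "\<bar>a_kernel s t\<bar> \<le> a_weight s t"
proof (cases "s = 1")
  case True
  have "\<bar>VP_kernel 2 t\<bar> \<le> vp_weight 2 t" by (rule VP_kernel_le) simp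
  moreover have "1 \<le> vp_weight 1 t"
    using fejer_nonneg[of 2 t] by (simp add: vp_weight_def)
  ultimately show ?thesis
    using True by (simp add: a_kernel_def a_weight_def)
next
  case False
  have "\<bar>VP_kernel (2 ^ s) t\<bar> \<le> vp_weight (2 ^ s) t" "\<bar>VP_kernel (2 ^ (s - 1)) t\<bar> \<le> vp_weight (2 ^ (s - 1)) t"
    by (rule VP_kernel_le; simp)+
  then show ?thesis
    using False by (simp add: a_kernel_def a_weight_def)
qed

section \<open>Trigonometric polynomials and convolution\<close>

lemma powr_le_imp_base_le:
  fixes x y q :: real
  shows "0 < q \<Longrightarrow> 0 \<le> y \<Longrightarrow> x powr q \<le> y powr q \<Longrightarrow> x \<le> y"
  using powr_less_mono2[of q y x] by (meson leD leI)

lemma Lp_norm_le_iff: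
  assumes "p > 0" "B \<ge> 0"
  shows "Lp_norm d p f \<le> ennreal B \<longleftrightarrow> (\<integral>\<^sup>+x. ennreal (cmod (f x) powr p) \<partial>torus d) \<le> ennreal (B powr p)"
proof (cases "\<integral>\<^sup>+x. ennreal (cmod (f x) powr p) \<partial>torus d")
  case (real b)
  have "b powr (1 / p) \<le> B \<longleftrightarrow> b \<le> B powr p"
  proof
    assume "b powr (1 / p) \<le> B"
    then have "(b powr (1 / p)) powr p \<le> B powr p"
      using assms by (intro powr_mono2) auto
    then show "b \<le> B powr p"
      using assms real by (simp add: powr_powr)
  next
    assume "b \<le> B powr p"
    then have "b powr (1 / p) \<le> (B powr p) powr (1 / p)"
      using assms real by (intro powr_mono2) auto
    then show "b powr (1 / p) \<le> B"
      using assms by (simp add: powr_powr)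
  qed
  then show ?thesis
    using real assms by (simp add: Lp_norm_def epowr_def)
next
  case top
  then show ?thesis
    by (simp add: Lp_norm_def epowr_def top_unique)
qed

lemma Lp_norm_eqD:
  assumes "p > 0" "B \<ge> 0" "Lp_norm d p f = ennreal B"
  shows "(\<integral>\<^sup>+x. ennreal (cmod (f x) powr p) \<partial>torus d) = ennreal (B powr p)"
proof (cases "\<integral>\<^sup>+x. ennreal (cmod (f x) powr p) \<partial>torus d")
  case (real b)
  then have "b powr (1 / p) = B"
    using assms by (simp add: Lp_norm_def epowr_def)
  then have "B powr p = b"
    using assms real by (auto simp: powr_powr)
  then show ?thesis using real by simp
next
  case top
  then show ?thesis
    using assms by (simp add: Lp_norm_def epowr_def)
qed

section \<open>Algebra and Fourier coefficients of trigonometric polynomials\<close>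

lemma trig_polys_zero: "(\<lambda>x. 0) \<in> trig_polys d Q"
  unfolding trig_polys_def by (intro CollectI exI[of _ "\<lambda>_. 0"]) simp

lemma trig_polys_scale: "T \<in> trig_polys d Q \<Longrightarrow> (\<lambda>x. c * T x) \<in> trig_polys d Q"
  unfolding trig_polys_def
proof safe
  fix a
  show "\<exists>b. (\<lambda>x. c * (\<Sum>k\<in>Q. a k * character d k x)) = (\<lambda>x. \<Sum>k\<in>Q. b k * character d k x)"
    by (intro exI[of _ "\<lambda>k. c * a k"]) (simp add: sum_distrib_left mult.assoc)
qed

lemma trig_polys_add: "S \<in> trig_polys d Q \<Longrightarrow> T \<in> trig_polys d Q \<Longrightarrow> (\<lambda>x. S x + T x) \<in> trig_polys d Q"
  unfolding trig_polys_def
proof safe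
  fix a b
  show "\<exists>c. (\<lambda>x. (\<Sum>k\<in>Q. a k * character d k x) + (\<Sum>k\<in>Q. b k * character d k x)) = (\<lambda>x. \<Sum>k\<in>Q. c k * character d k x)"
    by (intro exI[of _ "\<lambda>k. a k + b k"]) (simp add: sum.distrib distrib_right)
qed

lemma trig_polys_sum: "(\<And>i. i \<in> I \<Longrightarrow> T i \<in> trig_polys d Q) \<Longrightarrow> (\<lambda>x. \<Sum>i\<in>I. T i x) \<in> trig_polys d Q"
  by (induction I rule: infinite_finite_induct) (auto intro: trig_polys_zero trig_polys_add)

lemma trig_polys_character:
  assumes "finite Q" "k \<in> Q"
  shows "character d k \<in> trig_polys d Q"
proof -
  have "(\<Sum>l\<in>Q. of_bool (l = k) * character d l x) = (\<Sum>l\<in>Q. if l = k then character d k x else 0)" for x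
    by (intro sum.cong) auto
  then have "character d k = (\<lambda>x. \<Sum>l\<in>Q. of_bool (l = k) * character d l x)"
    using assms by auto
  then show ?thesis
    unfolding trig_polys_def by (intro CollectI exI[of _ "\<lambda>l. of_bool (l = k)"])
qed

lemma trig_polys_mono:
  assumes "T \<in> trig_polys d Q" "finite Q'" "Q \<subseteq> Q'"
  shows "T \<in> trig_polys d Q'"
proof -
  obtain c where "T = (\<lambda>x. \<Sum>k\<in>Q. c k * character d k x)"
    using assms by (auto simp: trig_polys_def)
  then show ?thesis
    using assms by (auto intro!: trig_polys_sum trig_polys_scale trig_polys_character)
qed

lemma fourier_sum_in_trig_polys: "fourier_sum d Q f \<in> trig_polys d Q"
  unfolding trig_polys_def fourier_sum_def[abs_def] by blast

lemma trig_poly_measurable: "T \<in> trig_polys d Q \<Longrightarrow> T \<in> borel_measurable (torus d)"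
  unfolding trig_polys_def by auto

lemma trig_poly_bounded:
  assumes "T \<in> trig_polys d Q"
  obtains B where "B \<ge> 0" "\<And>x. cmod (T x) \<le> B"
proof -
  obtain c where T: "T = (\<lambda>x. \<Sum>k\<in>Q. c k * character d k x)"
    using assms by (auto simp: trig_polys_def)
  have "cmod (T x) \<le> (\<Sum>k\<in>Q. cmod (c k))" for x
    unfolding T by (rule order_trans[OF norm_sum]) (simp add: norm_mult)
  then show ?thesis
    by (intro that[of "\<Sum>k\<in>Q. cmod (c k)"]) (auto intro: sum_nonneg)
qed

lemma trig_poly_integrable: "T \<in> trig_polys d Q \<Longrightarrow> integrable (torus d) T"
  by (rule trig_poly_bounded) (auto intro: integrable_torus_bounded trig_poly_measurable)

lemma trig_poly_Lp_norm_finite: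
  assumes "T \<in> trig_polys d Q" "p > 0"
  shows "Lp_norm d p T < \<infinity>"
proof -
  obtain B where B: "B \<ge> 0" "\<And>x. cmod (T x) \<le> B"
    using trig_poly_bounded[OF assms(1)] by blast
  have "(\<integral>\<^sup>+x. ennreal (cmod (T x) powr p) \<partial>torus d) \<le> (\<integral>\<^sup>+x. ennreal (B powr p) \<partial>torus d)"
    using B assms by (intro nn_integral_mono ennreal_leI powr_mono2) auto
  then have "Lp_norm d p T \<le> ennreal B"
    using B assms by (subst Lp_norm_le_iff) (auto simp: torus.emeasure_space_1)
  then show ?thesis
    by (simp add: le_less_trans)
qed

lemma fourier_coeff_trig_poly:
  assumes Q: "Q \<subseteq> {1..d} \<rightarrow>\<^sub>E UNIV" "finite Q" and k: "k \<in> {1..d} \<rightarrow>\<^sub>E UNIV"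
  shows "fourier_coeff d (\<lambda>x. \<Sum>l\<in>Q. c l * character d l x) k = (if k \<in> Q then c k else 0)"
proof -
  have "fourier_coeff d (\<lambda>x. \<Sum>l\<in>Q. c l * character d l x) k = (\<Sum>l\<in>Q. c l * fourier_coeff d (character d l) k)"
    by (rule fourier_coeff_sum) (rule integrable_character)
  also have "\<dots> = (\<Sum>l\<in>Q. if l = k then c k else 0)"
    using Q k by (intro sum.cong) (auto simp: fourier_coeff_character)
  finally show ?thesis using Q by simp
qed

lemma fourier_coeff_trig_poly_eq_0:
  assumes "T \<in> trig_polys d Q" "Q \<subseteq> {1..d} \<rightarrow>\<^sub>E UNIV" "finite Q" "k \<in> {1..d} \<rightarrow>\<^sub>E UNIV" "k \<notin> Q"
  shows "fourier_coeff d T k = 0"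
  using assms fourier_coeff_trig_poly[OF assms(2-4)] by (auto simp: trig_polys_def)

lemma fourier_sum_trig_poly:
  assumes "T \<in> trig_polys d Q" "Q \<subseteq> {1..d} \<rightarrow>\<^sub>E UNIV" "finite Q"
  shows "fourier_sum d Q T = T"
proof -
  obtain c where T: "T = (\<lambda>x. \<Sum>k\<in>Q. c k * character d k x)"
    using assms by (auto simp: trig_polys_def)
  show ?thesis
    unfolding fourier_sum_def T
    by (intro ext sum.cong refl, subst fourier_coeff_trig_poly[OF assms(2,3)]) (use assms(2) in auto)
qed

text \<open>Each character of x - t splits into one of x and one of t, so convolution with a tensor
  kernel multiplies the Fourier coefficients of \<open>f\<close> by products of one-dimensional
  coefficients.\<close>

lemma convolve_tensor:
  assumes f: "integrable (torus d) f"
    and \<kappa>: "\<And>j t. j \<in> {1..d} \<Longrightarrow> complex_of_real (\<kappa> j t) = (\<Sum>k\<in>K j. c j k * cis (of_int k * t))"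
    and K: "\<And>j. finite (K j)"
  shows "convolve d f (\<lambda>x. complex_of_real (\<Prod>j\<in>{1..d}. \<kappa> j (x j))) x =
    (\<Sum>k\<in>Pi\<^sub>E {1..d} K. (\<Prod>j\<in>{1..d}. c j (k j)) * fourier_coeff d f k * character d k x)"
proof -
  have "complex_of_real (\<Prod>j\<in>{1..d}. \<kappa> j ((\<lambda>j\<in>{1..d}. x j - t j) j)) =
      (\<Sum>k\<in>Pi\<^sub>E {1..d} K. (\<Prod>j\<in>{1..d}. c j (k j)) * character d k x * character d (\<lambda>j. - k j) t)" for t
  proof -
    have "complex_of_real (\<Prod>j\<in>{1..d}. \<kappa> j ((\<lambda>j\<in>{1..d}. x j - t j) j)) =
        (\<Prod>j\<in>{1..d}. \<Sum>k\<in>K j. c j k * cis (of_int k * (x j - t j)))"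
      unfolding of_real_prod by (intro prod.cong) (auto simp: \<kappa>)
    also have "\<dots> = (\<Sum>k\<in>Pi\<^sub>E {1..d} K. \<Prod>j\<in>{1..d}. c j (k j) * cis (of_int (k j) * (x j - t j)))"
      by (rule prod_sum_PiE) (auto simp: K)
    also have "\<dots> = (\<Sum>k\<in>Pi\<^sub>E {1..d} K. (\<Prod>j\<in>{1..d}. c j (k j)) * character d k x * character d (\<lambda>j. - k j) t)"
      unfolding character_prod prod.distrib[symmetric]
      by (intro sum.cong prod.cong refl) (simp add: cis_mult algebra_simps)
    finally show ?thesis .
  qed
  then have "convolve d f (\<lambda>x. complex_of_real (\<Prod>j\<in>{1..d}. \<kappa> j (x j))) x =
      (LINT t|torus d. (\<Sum>k\<in>Pi\<^sub>E {1..d} K. (\<Prod>j\<in>{1..d}. c j (k j)) * character d k x * (f t * character d (\<lambda>j. - k j) t)))"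
    unfolding convolve_def by (simp add: sum_distrib_left mult_ac)
  also have "\<dots> = (\<Sum>k\<in>Pi\<^sub>E {1..d} K. (\<Prod>j\<in>{1..d}. c j (k j)) * character d k x * fourier_coeff d f k)"
    unfolding fourier_coeff_eq
    by (subst Bochner_Integration.integral_sum) (auto intro!: integrable_mult_character integrable_mult_right f)
  finally show ?thesis
    by (simp add: mult_ac)
qed

lemma nn_integral_tensor_weight:
  assumes w: "\<And>j. j \<in> {1..d} \<Longrightarrow> weight (H j) (w j)"
  shows "(\<integral>\<^sup>+t. ennreal (\<Prod>j\<in>{1..d}. w j (x j - t j)) \<partial>torus d) \<le> ennreal (6 ^ d)"
    and "(\<integral>\<^sup>+x. ennreal (\<Prod>j\<in>{1..d}. w j (x j - t j)) \<partial>torus d) \<le> ennreal (6 ^ d)"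
proof -
  have [measurable]: "w j \<in> borel_measurable borel" if "j \<in> {1..d}" for j
    using w[OF that] by (simp add: weight_def)
  have nonneg: "0 \<le> w j u" if "j \<in> {1..d}" for j u
    using w[OF that] by (simp add: weight_def)
  have m: "(\<lambda>u. ennreal (w j (x j - u))) \<in> borel_measurable circ" "(\<lambda>u. ennreal (w j (u - t j))) \<in> borel_measurable circ"
    if j: "j \<in> {1..d}" for j
    using j unfolding measurable_cong_sets[OF sets_circ refl] by measurable
  have "(\<integral>\<^sup>+t. ennreal (\<Prod>j\<in>{1..d}. w j (x j - t j)) \<partial>torus d) =
      (\<integral>\<^sup>+t. (\<Prod>j\<in>{1..d}. ennreal (w j (x j - t j))) \<partial>torus d)"
    by (intro nn_integral_cong prod_ennreal[symmetric] nonneg)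
  also have "\<dots> = (\<Prod>j\<in>{1..d}. \<integral>\<^sup>+u. ennreal (w j (x j - u)) \<partial>circ)"
    unfolding torus_eq by (intro circs.product_nn_integral_prod m) auto
  also have "\<dots> \<le> (\<Prod>j\<in>{1..d}. 6)"
    using w by (intro prod_mono_ennreal) (auto simp: weight_def)
  finally show "(\<integral>\<^sup>+t. ennreal (\<Prod>j\<in>{1..d}. w j (x j - t j)) \<partial>torus d) \<le> ennreal (6 ^ d)"
    by (simp flip: ennreal_power)
  have "(\<integral>\<^sup>+x. ennreal (\<Prod>j\<in>{1..d}. w j (x j - t j)) \<partial>torus d) =
      (\<integral>\<^sup>+x. (\<Prod>j\<in>{1..d}. ennreal (w j (x j - t j))) \<partial>torus d)"
    by (intro nn_integral_cong prod_ennreal[symmetric] nonneg)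
  also have "\<dots> = (\<Prod>j\<in>{1..d}. \<integral>\<^sup>+u. ennreal (w j (u - t j)) \<partial>circ)"
    unfolding torus_eq by (intro circs.product_nn_integral_prod m) auto
  also have "\<dots> \<le> (\<Prod>j\<in>{1..d}. 6)"
    using w by (intro prod_mono_ennreal) (auto simp: weight_def)
  finally show "(\<integral>\<^sup>+x. ennreal (\<Prod>j\<in>{1..d}. w j (x j - t j)) \<partial>torus d) \<le> ennreal (6 ^ d)"
    by (simp flip: ennreal_power)
qed

lemma measurable_tensor_weight:
  assumes w: "\<And>j. j \<in> {1..d} \<Longrightarrow> weight (H j) (w j)"
    and g: "g \<in> borel_measurable (torus d)"
  shows "(\<lambda>(x, t). ennreal (g t * (\<Prod>j\<in>{1..d}. w j (x j - t j)))) \<in> borel_measurable (torus d \<Otimes>\<^sub>M torus d)"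
proof -
  have 1: "(\<lambda>z. g (snd z)) \<in> borel_measurable (torus d \<Otimes>\<^sub>M torus d)"
    using g by (rule measurable_compose[OF measurable_snd])
  have 2: "(\<lambda>z. w j (fst z j - snd z j)) \<in> borel_measurable (torus d \<Otimes>\<^sub>M torus d)" if j: "j \<in> {1..d}" for j
  proof -
    have "(\<lambda>z. fst z j - snd z j) \<in> borel_measurable (torus d \<Otimes>\<^sub>M torus d)"
      by (intro borel_measurable_diff measurable_compose[OF measurable_fst measurable_torus_component[OF j]]
          measurable_compose[OF measurable_snd measurable_torus_component[OF j]])
    moreover have "w j \<in> borel_measurable borel"
      using w[OF j] by (simp add: weight_def)
    ultimately show ?thesis by (rule measurable_compose)
  qed
  have "(\<lambda>z. ennreal (g (snd z) * (\<Prod>j\<in>{1..d}. w j (fst z j - snd z j)))) \<in> borel_measurable (torus d \<Otimes>\<^sub>M torus d)"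
    by (intro measurable_compose[OF _ measurable_ennreal] borel_measurable_times borel_measurable_prod 1 2)
  then show ?thesis by (simp add: case_prod_beta')
qed

text \<open>Jensen's inequality at a fixed \<open>x\<close>, with |f| as the function and the tensor
  majorant at x - t as a weight of mass at most 6 ^ d.\<close>

lemma convolve_powr_le:
  assumes f: "integrable (torus d) f" and q: "1 \<le> q"
    and w: "\<And>j. j \<in> {1..d} \<Longrightarrow> weight (H j) (w j)"
    and \<kappa>: "\<And>j t. j \<in> {1..d} \<Longrightarrow> \<bar>\<kappa> j t\<bar> \<le> w j t"
    and x: "x \<in> space (torus d)"
  shows "ennreal (cmod (convolve d f (\<lambda>x. complex_of_real (\<Prod>j\<in>{1..d}. \<kappa> j (x j))) x) powr q) \<le>
    ennreal ((6 ^ d) powr (q - 1)) * (\<integral>\<^sup>+t. ennreal (cmod (f t) powr q * (\<Prod>j\<in>{1..d}. w j (x j - t j))) \<partial>torus d)"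
proof (rule powr_nn_integral_le)
  let ?K = "\<lambda>t. complex_of_real (\<Prod>j\<in>{1..d}. \<kappa> j ((\<lambda>j\<in>{1..d}. x j - t j) j))"
  show "(\<lambda>t. \<Prod>j\<in>{1..d}. w j (x j - t j)) \<in> borel_measurable (torus d)"
  proof (intro borel_measurable_prod)
    fix j assume j: "j \<in> {1..d}"
    have "(\<lambda>t. x j - t j) \<in> borel_measurable (torus d)"
      by (intro borel_measurable_diff borel_measurable_const measurable_torus_component[OF j])
    then show "(\<lambda>t. w j (x j - t j)) \<in> borel_measurable (torus d)"
      by (rule measurable_compose) (use w[OF j] in \<open>simp add: weight_def\<close>)
  qed
  show "0 \<le> (\<Prod>j\<in>{1..d}. w j (x j - t j))" for t
    using w by (intro prod_nonneg) (auto simp: weight_def)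
  show "(\<integral>\<^sup>+t. ennreal (\<Prod>j\<in>{1..d}. w j (x j - t j)) \<partial>torus d) \<le> ennreal (6 ^ d)"
    by (rule nn_integral_tensor_weight) (rule w)
  have "ennreal (cmod (LINT t|torus d. f t * ?K t)) \<le> (\<integral>\<^sup>+t. ennreal (cmod (f t * ?K t)) \<partial>torus d)"
  \<comment> \<open>Without integrability the Bochner integral is 0 by convention and the bound is
    trivial.\<close>
  proof (cases "integrable (torus d) (\<lambda>t. f t * ?K t)")
    case True
    then show ?thesis by (rule integral_norm_bound_ennreal)
  next
    case False
    then show ?thesis by (simp add: not_integrable_integral_eq)
  qed
  also have "\<dots> \<le> (\<integral>\<^sup>+t. ennreal (cmod (f t) * (\<Prod>j\<in>{1..d}. w j (x j - t j))) \<partial>torus d)"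
  proof (intro nn_integral_mono ennreal_leI)
    fix t
    have "cmod (?K t) \<le> (\<Prod>j\<in>{1..d}. w j (x j - t j))"
      unfolding norm_of_real abs_prod using \<kappa> by (intro prod_mono) auto
    then show "cmod (f t * ?K t) \<le> cmod (f t) * (\<Prod>j\<in>{1..d}. w j (x j - t j))"
      by (simp only: norm_mult mult_left_mono norm_ge_zero)
  qed
  finally show "ennreal (cmod (convolve d f (\<lambda>x. complex_of_real (\<Prod>j\<in>{1..d}. \<kappa> j (x j))) x)) \<le>
      (\<integral>\<^sup>+t. ennreal (cmod (f t) * (\<Prod>j\<in>{1..d}. w j (x j - t j))) \<partial>torus d)"
    by (simp only: convolve_def)
qed (use f q in auto)

text \<open>Young's inequality: the pointwise bound is integrated in \<open>x\<close> and the order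
  of integration exchanged. The factor (6 ^ d) powr (q - 1) and the mass 6 ^ d in \<open>x\<close>
  combine to (6 ^ d) powr q.\<close>

lemma Lp_norm_convolve_le:
  assumes f: "integrable (torus d) f" and q: "1 \<le> q"
    and w: "\<And>j. j \<in> {1..d} \<Longrightarrow> weight (H j) (w j)"
    and \<kappa>: "\<And>j t. j \<in> {1..d} \<Longrightarrow> \<bar>\<kappa> j t\<bar> \<le> w j t"
  shows "Lp_norm d q (convolve d f (\<lambda>x. complex_of_real (\<Prod>j\<in>{1..d}. \<kappa> j (x j)))) \<le> ennreal (6 ^ d) * Lp_norm d q f"
proof (cases "Lp_norm d q f")
  case (real B)
  interpret pair: pair_sigma_finite "torus d" "torus d" ..
  have [measurable]: "f \<in> borel_measurable (torus d)" using f by auto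
  have fq: "(\<lambda>t. cmod (f t) powr q) \<in> borel_measurable (torus d)" by measurable
  let ?g = "convolve d f (\<lambda>x. complex_of_real (\<Prod>j\<in>{1..d}. \<kappa> j (x j)))"
  let ?W = "\<lambda>x t. \<Prod>j\<in>{1..d}. w j (x j - t j)"
  have W: "0 \<le> ?W x t" for x t
    using w by (intro prod_nonneg) (auto simp: weight_def)
  have F: "(\<lambda>(x, t). ennreal (cmod (f t) powr q * ?W x t)) \<in> borel_measurable (torus d \<Otimes>\<^sub>M torus d)"
    by (rule measurable_tensor_weight[where H = H]) (rule w, assumption, rule fq)
  have "(\<lambda>(x, t). ennreal (1 * ?W x t)) \<in> borel_measurable (torus d \<Otimes>\<^sub>M torus d)"
    by (rule measurable_tensor_weight[where H = H and g = "\<lambda>_. 1"]) (rule w, assumption, rule borel_measurable_const)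
  from measurable_compose[OF measurable_Pair2' this]
  have W_meas: "(\<lambda>x. ennreal (?W x t)) \<in> borel_measurable (torus d)" if "t \<in> space (torus d)" for t
    using that by simp
  have "(\<integral>\<^sup>+x. ennreal (cmod (?g x) powr q) \<partial>torus d) \<le>
      (\<integral>\<^sup>+x. ennreal ((6 ^ d) powr (q - 1)) * (\<integral>\<^sup>+t. ennreal (cmod (f t) powr q * ?W x t) \<partial>torus d) \<partial>torus d)"
    by (intro nn_integral_mono convolve_powr_le[OF f q w \<kappa>])
  also have "\<dots> = ennreal ((6 ^ d) powr (q - 1)) *
      (\<integral>\<^sup>+x. (\<integral>\<^sup>+t. ennreal (cmod (f t) powr q * ?W x t) \<partial>torus d) \<partial>torus d)"
    by (rule nn_integral_cmult[OF torus.borel_measurable_nn_integral[OF F]])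
  also have "(\<integral>\<^sup>+x. (\<integral>\<^sup>+t. ennreal (cmod (f t) powr q * ?W x t) \<partial>torus d) \<partial>torus d) =
      (\<integral>\<^sup>+t. (\<integral>\<^sup>+x. ennreal (cmod (f t) powr q * ?W x t) \<partial>torus d) \<partial>torus d)"
    by (rule pair.Fubini'[OF F, symmetric])
  also have "\<dots> \<le> (\<integral>\<^sup>+t. ennreal (cmod (f t) powr q) * ennreal (6 ^ d) \<partial>torus d)"
  proof (rule nn_integral_mono)
    fix t assume t: "t \<in> space (torus d)"
    have "(\<integral>\<^sup>+x. ennreal (cmod (f t) powr q * ?W x t) \<partial>torus d) =
        (\<integral>\<^sup>+x. ennreal (cmod (f t) powr q) * ennreal (?W x t) \<partial>torus d)"
      using W by (simp only: ennreal_mult powr_ge_zero)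
    also have "\<dots> = ennreal (cmod (f t) powr q) * (\<integral>\<^sup>+x. ennreal (?W x t) \<partial>torus d)"
      using W_meas[OF t] by (rule nn_integral_cmult)
    also have "\<dots> \<le> ennreal (cmod (f t) powr q) * ennreal (6 ^ d)"
      by (intro mult_left_mono nn_integral_tensor_weight[where H = H] w) auto
    finally show "(\<integral>\<^sup>+x. ennreal (cmod (f t) powr q * ?W x t) \<partial>torus d) \<le> ennreal (cmod (f t) powr q) * ennreal (6 ^ d)" .
  qed
  also have "\<dots> = (\<integral>\<^sup>+t. ennreal (cmod (f t) powr q) \<partial>torus d) * ennreal (6 ^ d)"
    by (rule nn_integral_multc) simp
  also have "(\<integral>\<^sup>+t. ennreal (cmod (f t) powr q) \<partial>torus d) = ennreal (B powr q)"
    using real q by (intro Lp_norm_eqD) auto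
  finally have "(\<integral>\<^sup>+x. ennreal (cmod (?g x) powr q) \<partial>torus d) \<le>
      ennreal ((6 ^ d) powr (q - 1)) * (ennreal (B powr q) * ennreal (6 ^ d))"
    by (simp add: mult_left_mono)
  also have "\<dots> = ennreal ((6 ^ d * B) powr q)"
    using real by (simp add: ennreal_mult[symmetric] powr_mult powr_diff)
  finally have "Lp_norm d q ?g \<le> ennreal (6 ^ d * B)"
    using real q by (subst Lp_norm_le_iff) auto
  then show ?thesis
    using real by (simp add: ennreal_mult)
next
  case top
  then show ?thesis by (simp add: ennreal_mult_top)
qed

text \<open>The same pointwise bound, now with the weight estimated by its height. The power 1 / q
  of the heights is the source of the exponents in Nikolskii's inequality.\<close>

lemma norm_convolve_le:
  assumes f: "integrable (torus d) f" and q: "1 \<le> q"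
    and w: "\<And>j. j \<in> {1..d} \<Longrightarrow> weight (H j) (w j)"
    and \<kappa>: "\<And>j t. j \<in> {1..d} \<Longrightarrow> \<bar>\<kappa> j t\<bar> \<le> w j t"
    and x: "x \<in> space (torus d)"
    and B: "B \<ge> 0" "Lp_norm d q f = ennreal B"
  shows "cmod (convolve d f (\<lambda>x. complex_of_real (\<Prod>j\<in>{1..d}. \<kappa> j (x j))) x) \<le> 6 ^ d * (\<Prod>j\<in>{1..d}. H j) powr (1 / q) * B"
proof -
  let ?c = "cmod (convolve d f (\<lambda>x. complex_of_real (\<Prod>j\<in>{1..d}. \<kappa> j (x j))) x)"
  have [measurable]: "f \<in> borel_measurable (torus d)" using f by auto
  define P where "P = (\<Prod>j\<in>{1..d}. H j)"
  have H: "0 \<le> w j t" "w j t \<le> H j" if "j \<in> {1..d}" for j t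
    using w[OF that] by (auto simp: weight_def)
  have "P \<ge> 0"
    unfolding P_def using H order_trans by (intro prod_nonneg) blast
  have "ennreal (?c powr q) \<le>
      ennreal ((6 ^ d) powr (q - 1)) * (\<integral>\<^sup>+t. ennreal (cmod (f t) powr q * (\<Prod>j\<in>{1..d}. w j (x j - t j))) \<partial>torus d)"
    by (rule convolve_powr_le[OF f q w \<kappa> x])
  also have "\<dots> \<le> ennreal ((6 ^ d) powr (q - 1)) * (\<integral>\<^sup>+t. ennreal (cmod (f t) powr q * P) \<partial>torus d)"
    unfolding P_def by (intro mult_left_mono nn_integral_mono ennreal_leI prod_mono) (auto simp: H)
  also have "(\<integral>\<^sup>+t. ennreal (cmod (f t) powr q * P) \<partial>torus d) = (\<integral>\<^sup>+t. ennreal (cmod (f t) powr q) \<partial>torus d) * ennreal P"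
    using \<open>P \<ge> 0\<close> by (simp add: ennreal_mult nn_integral_multc)
  also have "(\<integral>\<^sup>+t. ennreal (cmod (f t) powr q) \<partial>torus d) = ennreal (B powr q)"
    using B q by (intro Lp_norm_eqD) auto
  also have "ennreal ((6 ^ d) powr (q - 1)) * (ennreal (B powr q) * ennreal P) = ennreal ((6 ^ d) powr (q - 1) * (B powr q * P))"
    using \<open>P \<ge> 0\<close> by (simp add: ennreal_mult)
  finally have "?c powr q \<le> (6 ^ d) powr (q - 1) * (B powr q * P)"
    using \<open>P \<ge> 0\<close> by simp
  also have "\<dots> \<le> (6 ^ d) powr q * (B powr q * P)"
    using \<open>P \<ge> 0\<close> by (intro mult_right_mono powr_mono) auto
  also have "\<dots> = (6 ^ d * P powr (1 / q) * B) powr q"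
    using \<open>P \<ge> 0\<close> B q by (simp add: powr_mult powr_powr)
  finally show ?thesis
    unfolding P_def[symmetric]
    by (rule powr_le_imp_base_le[rotated 2]) (use q B in auto)
qed

section \<open>Dyadic blocks and Nikolskii's inequality\<close>

lemma rho_eq: "rho d s = (\<Pi>\<^sub>E j\<in>{1..d}. {k. 2 ^ (s j - 1) \<le> \<bar>k\<bar> \<and> \<bar>k\<bar> < 2 ^ s j})"
  unfolding rho_def by (auto simp: PiE_iff extensional_def)

definition wide_block :: "nat \<Rightarrow> (nat \<Rightarrow> nat) \<Rightarrow> (nat \<Rightarrow> int) set" where
  "wide_block d s = (\<Pi>\<^sub>E j\<in>{1..d}. {k. 2 ^ (s j - 1) \<le> \<bar>k\<bar> \<and> \<bar>k\<bar> < 2 ^ (s j + 1)})"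

definition shift_index :: "nat \<Rightarrow> (nat \<Rightarrow> nat) \<Rightarrow> (nat \<Rightarrow> nat) \<Rightarrow> nat \<Rightarrow> nat" where
  "shift_index d s e = (\<lambda>j\<in>{1..d}. s j + e j)"

definition corners :: "nat \<Rightarrow> (nat \<Rightarrow> nat) set" where
  "corners d = {1..d} \<rightarrow>\<^sub>E {0, 1}"

lemma finite_corners [simp]: "finite (corners d)"
  unfolding corners_def by (intro finite_PiE) auto

lemma card_corners: "card (corners d) = 2 ^ d"
  unfolding corners_def by (subst card_PiE) (auto simp: numeral_2_eq_2)

lemma shift_index_in: "s \<in> block_indices d \<Longrightarrow> shift_index d s e \<in> block_indices d"
  by (fastforce simp: block_indices_def shift_index_def PiE_iff)

lemma inj_shift_index: "e \<in> corners d \<Longrightarrow> inj_on (\<lambda>s. shift_index d s e) (block_indices d)"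
  unfolding inj_on_def
proof safe
  fix s s' assume s: "s \<in> block_indices d" "s' \<in> block_indices d" "shift_index d s e = shift_index d s' e"
  show "s = s'"
  proof (rule PiE_ext)
    show "s \<in> {1..d} \<rightarrow>\<^sub>E {1..}" "s' \<in> {1..d} \<rightarrow>\<^sub>E {1..}"
      using s by (auto simp: block_indices_def)
    fix j assume "j \<in> {1..d}"
    then show "s j = s' j"
      using fun_cong[OF s(3), of j] by (simp add: shift_index_def)
  qed
qed

lemma finite_abs_less: "finite {k::int. P k \<and> \<bar>k\<bar> < n}"
  by (rule finite_subset[of _ "{- n..n}"]) auto

lemma finite_rho [simp]: "finite (rho d s)"
  unfolding rho_eq by (intro finite_PiE finite_abs_less) auto

lemma finite_wide_block [simp]: "finite (wide_block d s)"
  unfolding wide_block_def by (intro finite_PiE finite_abs_less) auto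

lemma rho_subset: "rho d s \<subseteq> {1..d} \<rightarrow>\<^sub>E UNIV"
  by (auto simp: rho_def)

lemma wide_block_subset: "wide_block d s \<subseteq> {1..d} \<rightarrow>\<^sub>E UNIV"
  unfolding wide_block_def by (intro PiE_mono) auto

lemma dyadic_unique:
  fixes m :: int
  assumes "2 ^ (a - 1) \<le> m" "m < 2 ^ a" "2 ^ (b - 1) \<le> m" "m < 2 ^ b" "1 \<le> a" "1 \<le> b"
  shows "a = b"
proof -
  have "(2::int) ^ (a - 1) < 2 ^ b" "(2::int) ^ (b - 1) < 2 ^ a"
    using assms by linarith+
  then have "a - 1 < b" "b - 1 < a"
    by (auto intro: power_less_imp_less_exp[of "2::int"])
  with assms show ?thesis by linarith
qed

lemma rho_unique:
  assumes "k \<in> rho d s" "k \<in> rho d s'" "s \<in> block_indices d" "s' \<in> block_indices d"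
  shows "s = s'"
proof (rule PiE_ext)
  show "s \<in> {1..d} \<rightarrow>\<^sub>E {1..}" "s' \<in> {1..d} \<rightarrow>\<^sub>E {1..}"
    using assms by (auto simp: block_indices_def)
  fix j assume "j \<in> {1..d}"
  then show "s j = s' j"
    using assms by (intro dyadic_unique[of "s j" "\<bar>k j\<bar>" "s' j"]) (auto simp: rho_def block_indices_def PiE_iff)
qed

lemma dyadic_exists:
  fixes m :: int
  assumes "m \<noteq> 0"
  shows "\<exists>a\<ge>1. 2 ^ (a - 1) \<le> \<bar>m\<bar> \<and> \<bar>m\<bar> < 2 ^ a"
proof -
  have "\<exists>n. 2 ^ n \<le> nat \<bar>m\<bar> \<and> nat \<bar>m\<bar> < 2 ^ (n + 1)"
    using assms ex_power_ivl1[of 2 "nat \<bar>m\<bar>"] by auto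
  then obtain n where "2 ^ n \<le> nat \<bar>m\<bar>" "nat \<bar>m\<bar> < 2 ^ (n + 1)" by blast
  then have "int (2 ^ n) \<le> \<bar>m\<bar>" "\<bar>m\<bar> < int (2 ^ (n + 1))" by linarith+
  then show ?thesis
    by (intro exI[of _ "Suc n"]) auto
qed

lemma rho_exists:
  assumes "k \<in> {1..d} \<rightarrow>\<^sub>E UNIV" "\<And>j. j \<in> {1..d} \<Longrightarrow> k j \<noteq> 0"
  shows "\<exists>s\<in>block_indices d. k \<in> rho d s"
proof -
  have "\<forall>j\<in>{1..d}. \<exists>a\<ge>1. 2 ^ (a - 1) \<le> \<bar>k j\<bar> \<and> \<bar>k j\<bar> < 2 ^ a"
    using assms(2) dyadic_exists by blast
  then obtain a where "\<forall>j\<in>{1..d}. 1 \<le> a j \<and> 2 ^ (a j - 1) \<le> \<bar>k j\<bar> \<and> \<bar>k j\<bar> < 2 ^ a j"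
    by metis
  then have "restrict a {1..d} \<in> block_indices d" "k \<in> rho d (restrict a {1..d})"
    using assms(1) by (auto simp: block_indices_def rho_def)
  then show ?thesis by blast
qed

text \<open>In each variable the range from 2 ^ (s j - 1) to 2 ^ (s j + 1) consists of two
  consecutive dyadic ranges, and a corner records which of them is taken.\<close>

lemma wide_block_eq:
  assumes s: "s \<in> block_indices d"
  shows "wide_block d s = (\<Union>e\<in>corners d. rho d (shift_index d s e))"
proof (intro equalityI subsetI)
  fix k assume k: "k \<in> wide_block d s"
  define e where "e = (\<lambda>j\<in>{1..d}. if \<bar>k j\<bar> < 2 ^ s j then 0 else 1 :: nat)"
  have "e \<in> corners d" by (auto simp: e_def corners_def)
  moreover have "k \<in> rho d (shift_index d s e)"
    using k by (auto simp: rho_eq wide_block_def shift_index_def e_def PiE_iff)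
  ultimately show "k \<in> (\<Union>e\<in>corners d. rho d (shift_index d s e))" by blast
next
  fix k assume "k \<in> (\<Union>e\<in>corners d. rho d (shift_index d s e))"
  then obtain e where e: "e \<in> corners d" and k: "k \<in> rho d (shift_index d s e)" by blast
  have "2 ^ (s j - 1) \<le> \<bar>k j\<bar> \<and> \<bar>k j\<bar> < 2 ^ (s j + 1)" if j: "j \<in> {1..d}" for j
  proof -
    have "e j = 0 \<or> e j = 1" using e j by (auto simp: corners_def PiE_iff)
    moreover have "2 ^ (s j + e j - 1) \<le> \<bar>k j\<bar>" "\<bar>k j\<bar> < 2 ^ (s j + e j)"
      using k j by (auto simp: rho_def shift_index_def)
    moreover have "(2::int) ^ (s j - 1) \<le> 2 ^ (s j + e j - 1)"
      by (rule power_increasing) auto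
    moreover have "(2::int) ^ (s j + e j) \<le> 2 ^ (s j + 1)"
      using \<open>e j = 0 \<or> e j = 1\<close> by (intro power_increasing) auto
    ultimately show ?thesis by linarith
  qed
  then show "k \<in> wide_block d s"
    using k by (auto simp: wide_block_def rho_def)
qed

lemma sum_wide_block:
  fixes h :: "(nat \<Rightarrow> int) \<Rightarrow> 'b :: comm_monoid_add"
  assumes s: "s \<in> block_indices d"
  shows "(\<Sum>k\<in>wide_block d s. h k) = (\<Sum>e\<in>corners d. \<Sum>k\<in>rho d (shift_index d s e). h k)"
  unfolding wide_block_eq[OF s]
proof (rule sum.UNION_disjoint)
  show "\<forall>e\<in>corners d. \<forall>e'\<in>corners d. e \<noteq> e' \<longrightarrow> rho d (shift_index d s e) \<inter> rho d (shift_index d s e') = {}"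
  proof (intro ballI impI, rule ccontr)
    fix e e' assume e: "e \<in> corners d" "e' \<in> corners d" "e \<noteq> e'"
      and "rho d (shift_index d s e) \<inter> rho d (shift_index d s e') \<noteq> {}"
    then have eq: "shift_index d s e = shift_index d s e'"
      using rho_unique shift_index_in[OF s] by (metis disjoint_iff)
    have "e = e'"
    proof (rule PiE_ext)
      show "e \<in> {1..d} \<rightarrow>\<^sub>E {0, 1}" "e' \<in> {1..d} \<rightarrow>\<^sub>E {0, 1}" using e by (auto simp: corners_def)
      fix j assume "j \<in> {1..d}"
      then show "e j = e' j"
        using fun_cong[OF eq, of j] by (simp add: shift_index_def)
    qed
    with e show False by simp
  qed
qed auto

text \<open>\<open>convolve_tensor\<close> gives a sum over a full box, which
  \<open>a_coeff_eq_0\<close> cuts down to the wide block.\<close>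

lemma A_op_eq:
  assumes f: "integrable (torus d) f" and s: "s \<in> block_indices d"
  shows "A_op d s f x = (\<Sum>k\<in>wide_block d s.
    complex_of_real (\<Prod>j\<in>{1..d}. a_coeff (s j) (k j)) * fourier_coeff d f k * character d k x)"
proof -
  define K where "K j = {- int (2 ^ (s j + 1))..int (2 ^ (s j + 1))}" for j
  have s1: "1 \<le> s j" if "j \<in> {1..d}" for j
    using s that by (auto simp: block_indices_def PiE_iff)
  have "A_op d s f x = (\<Sum>k\<in>Pi\<^sub>E {1..d} K.
      (\<Prod>j\<in>{1..d}. complex_of_real (a_coeff (s j) (k j))) * fourier_coeff d f k * character d k x)"
    unfolding A_op_def A_kernel_def
    by (rule convolve_tensor[OF f]) (auto simp: K_def a_kernel_cis[OF s1])
  also have "\<dots> = (\<Sum>k\<in>wide_block d s.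
      (\<Prod>j\<in>{1..d}. complex_of_real (a_coeff (s j) (k j))) * fourier_coeff d f k * character d k x)"
  proof (rule sum.mono_neutral_right)
    show "finite (Pi\<^sub>E {1..d} K)" by (intro finite_PiE) (auto simp: K_def)
    show "wide_block d s \<subseteq> Pi\<^sub>E {1..d} K"
      unfolding wide_block_def K_def by (intro PiE_mono) auto
    show "\<forall>k\<in>Pi\<^sub>E {1..d} K - wide_block d s.
        (\<Prod>j\<in>{1..d}. complex_of_real (a_coeff (s j) (k j))) * fourier_coeff d f k * character d k x = 0"
    proof
      fix k assume "k \<in> Pi\<^sub>E {1..d} K - wide_block d s"
      then obtain j where j: "j \<in> {1..d}" "\<bar>k j\<bar> < 2 ^ (s j - 1) \<or> 2 ^ (s j + 1) \<le> \<bar>k j\<bar>"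
        by (force simp: wide_block_def PiE_iff)
      then have "a_coeff (s j) (k j) = 0"
        by (intro a_coeff_eq_0 s1)
      with j have "(\<Prod>j\<in>{1..d}. complex_of_real (a_coeff (s j) (k j))) = 0"
        by (intro prod_zero) auto
      then show "(\<Prod>j\<in>{1..d}. complex_of_real (a_coeff (s j) (k j))) * fourier_coeff d f k * character d k x = 0"
        by simp
    qed
  qed
  finally show ?thesis by simp
qed

lemma A_op_in_trig_polys:
  assumes "integrable (torus d) f" "s \<in> block_indices d"
  shows "A_op d s f \<in> trig_polys d (wide_block d s)"
  unfolding trig_polys_def
  by (intro CollectI ext exI[of _ "\<lambda>k. complex_of_real (\<Prod>j\<in>{1..d}. a_coeff (s j) (k j)) * fourier_coeff d f k"]
      A_op_eq assms)

lemma delta_in_trig_polys: "delta d s f \<in> trig_polys d (rho d s)"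
  unfolding delta_def by (rule fourier_sum_in_trig_polys)

lemma fourier_coeff_delta:
  assumes "k \<in> {1..d} \<rightarrow>\<^sub>E UNIV"
  shows "fourier_coeff d (delta d s f) k = (if k \<in> rho d s then fourier_coeff d f k else 0)"
  unfolding delta_def fourier_sum_def by (intro fourier_coeff_trig_poly rho_subset finite_rho assms)

text \<open>After this splitting \<open>A_op\<close> acts on single blocks, so its L_q bound
  produces the block norms of \<open>f\<close> on the right-hand side.\<close>

lemma A_op_decompose:
  assumes f: "integrable (torus d) f" and s: "s \<in> block_indices d"
  shows "A_op d s f x = (\<Sum>e\<in>corners d. A_op d s (delta d (shift_index d s e) f) x)"
proof -
  let ?a = "\<lambda>k. complex_of_real (\<Prod>j\<in>{1..d}. a_coeff (s j) (k j))"
  have "A_op d s f x = (\<Sum>e\<in>corners d. \<Sum>k\<in>rho d (shift_index d s e). ?a k * fourier_coeff d f k * character d k x)"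
    unfolding A_op_eq[OF f s] by (rule sum_wide_block[OF s])
  also have "\<dots> = (\<Sum>e\<in>corners d. A_op d s (delta d (shift_index d s e) f) x)"
  proof (rule sum.cong[OF refl])
    fix e assume e: "e \<in> corners d"
    have "A_op d s (delta d (shift_index d s e) f) x =
        (\<Sum>k\<in>wide_block d s. ?a k * fourier_coeff d (delta d (shift_index d s e) f) k * character d k x)"
      by (rule A_op_eq[OF trig_poly_integrable[OF delta_in_trig_polys] s])
    also have "\<dots> = (\<Sum>k\<in>rho d (shift_index d s e). ?a k * fourier_coeff d f k * character d k x)"
    proof (rule sum.mono_neutral_cong_right)
      show "rho d (shift_index d s e) \<subseteq> wide_block d s"
        using e wide_block_eq[OF s] by blast
    qed (use subsetD[OF wide_block_subset[of d s]] subsetD[OF rho_subset] in \<open>auto simp: fourier_coeff_delta\<close>)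
    finally show "(\<Sum>k\<in>rho d (shift_index d s e). ?a k * fourier_coeff d f k * character d k x) =
        A_op d s (delta d (shift_index d s e) f) x" by simp
  qed
  finally show ?thesis .
qed

lemma A_op_cong:
  assumes "integrable (torus d) f" "integrable (torus d) g" "s \<in> block_indices d"
    and "\<And>k. k \<in> wide_block d s \<Longrightarrow> fourier_coeff d f k = fourier_coeff d g k"
  shows "A_op d s f = A_op d s g"
  using assms by (intro ext) (simp add: A_op_eq)

lemma Lp_norm_A_op_le:
  assumes f: "integrable (torus d) f" and q: "1 \<le> q" and s: "s \<in> block_indices d"
  shows "Lp_norm d q (A_op d s f) \<le> ennreal (6 ^ d) * Lp_norm d q f"
proof -
  have "1 \<le> s j" if "j \<in> {1..d}" for j
    using s that by (auto simp: block_indices_def PiE_iff)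
  then show ?thesis
    unfolding A_op_def A_kernel_def
    by (intro Lp_norm_convolve_le[where w = "\<lambda>j. a_weight (s j)" and H = "\<lambda>j. 10 * 2 ^ s j"] f q weight_a_weight a_kernel_le)
qed

text \<open>The trapezoids are 1 on the spectrum of \<open>T\<close>, so the tensor kernel acts as
  the identity.\<close>

lemma trig_poly_reproduce:
  assumes T: "T \<in> trig_polys d Q" "finite Q" "Q \<subseteq> {1..d} \<rightarrow>\<^sub>E UNIV"
    and l: "\<And>j. j \<in> {1..d} \<Longrightarrow> 1 \<le> l j" "\<And>k j. k \<in> Q \<Longrightarrow> j \<in> {1..d} \<Longrightarrow> \<bar>k j\<bar> \<le> int (l j)"
  shows "convolve d T (\<lambda>x. complex_of_real (\<Prod>j\<in>{1..d}. VP_kernel (l j) (x j))) x = T x"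
proof -
  define K where "K j = {- int (2 * l j)..int (2 * l j)}" for j
  have "convolve d T (\<lambda>x. complex_of_real (\<Prod>j\<in>{1..d}. VP_kernel (l j) (x j))) x =
      (\<Sum>k\<in>Pi\<^sub>E {1..d} K. (\<Prod>j\<in>{1..d}. complex_of_real (vp_coeff (l j) (k j))) * fourier_coeff d T k * character d k x)"
    unfolding K_def by (rule convolve_tensor[OF trig_poly_integrable[OF T(1)] VP_kernel_cis[OF l(1)]]) auto
  also have "\<dots> = (\<Sum>k\<in>Q. fourier_coeff d T k * character d k x)"
  proof (rule sum.mono_neutral_cong_right)
    show "finite (Pi\<^sub>E {1..d} K)" by (intro finite_PiE) (auto simp: K_def)
    show "Q \<subseteq> Pi\<^sub>E {1..d} K"
    proof
      fix k assume k: "k \<in> Q"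
      have "k j \<in> K j" if "j \<in> {1..d}" for j
        using l(2)[OF k that] by (auto simp: K_def)
      with k T(3) show "k \<in> Pi\<^sub>E {1..d} K" by (auto simp: PiE_iff)
    qed
    show "\<forall>k\<in>Pi\<^sub>E {1..d} K - Q. (\<Prod>j\<in>{1..d}. complex_of_real (vp_coeff (l j) (k j))) * fourier_coeff d T k * character d k x = 0"
      using fourier_coeff_trig_poly_eq_0[OF T(1,3,2)] by (auto simp: PiE_iff)
    fix k assume k: "k \<in> Q"
    have "vp_coeff (l j) (k j) = 1" if j: "j \<in> {1..d}" for j
    proof -
      have "real_of_int \<bar>k j\<bar> \<le> real (l j)"
        using l(2)[OF k j] by linarith
      then show ?thesis
        using l(1)[OF j] by (simp add: vp_coeff_def field_simps)
    qed
    then show "(\<Prod>j\<in>{1..d}. complex_of_real (vp_coeff (l j) (k j))) * fourier_coeff d T k * character d k x =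
        fourier_coeff d T k * character d k x"
      by simp
  qed
  also have "\<dots> = T x"
    using fun_cong[OF fourier_sum_trig_poly[OF T(1,3,2)], of x] by (simp add: fourier_sum_def)
  finally show ?thesis .
qed

text \<open>Real form of the norm, for functions whose norm is finite; an infinite norm would be
  sent to 0.\<close>

definition Lp_real :: "nat \<Rightarrow> real \<Rightarrow> ((nat \<Rightarrow> real) \<Rightarrow> complex) \<Rightarrow> real" where
  "Lp_real d p f = enn2real (Lp_norm d p f)"

lemma Lp_real_nonneg [simp]: "0 \<le> Lp_real d p f"
  by (simp add: Lp_real_def)

lemma Lp_norm_trig_poly:
  assumes "T \<in> trig_polys d Q" "p > 0"
  shows "Lp_norm d p T = ennreal (Lp_real d p T)"
  using trig_poly_Lp_norm_finite[OF assms] by (simp add: Lp_real_def)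

text \<open>\<open>T\<close> is its own convolution with a kernel whose majorant has height 5 * 2 ^
  s j in variable j; the constant is 30 ^ d = 6 ^ d * 5 ^ d.\<close>

lemma trig_poly_sup_bound:
  assumes T: "T \<in> trig_polys d Q" "finite Q" "Q \<subseteq> {1..d} \<rightarrow>\<^sub>E UNIV"
    and s: "\<And>k j. k \<in> Q \<Longrightarrow> j \<in> {1..d} \<Longrightarrow> \<bar>k j\<bar> \<le> 2 ^ s j"
    and p: "1 \<le> p" and x: "x \<in> space (torus d)"
  shows "cmod (T x) \<le> 30 ^ d * 2 powr (real (\<Sum>j\<in>{1..d}. s j) / p) * Lp_real d p T"
proof -
  have "cmod (T x) = cmod (convolve d T (\<lambda>x. complex_of_real (\<Prod>j\<in>{1..d}. VP_kernel (2 ^ s j) (x j))) x)"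
    by (subst trig_poly_reproduce[OF T]) (use s in auto)
  also have "\<dots> \<le> 6 ^ d * (\<Prod>j\<in>{1..d}. 5 * real (2 ^ s j)) powr (1 / p) * Lp_real d p T"
    using p by (intro norm_convolve_le[where w = "\<lambda>j. vp_weight (2 ^ s j)"] trig_poly_integrable[OF T(1)]
        weight_vp_weight VP_kernel_le x Lp_norm_trig_poly[OF T(1)]) auto
  also have "(\<Prod>j\<in>{1..d}. 5 * real (2 ^ s j)) = 5 ^ d * 2 powr real (\<Sum>j\<in>{1..d}. s j)"
    by (simp add: prod.distrib powr_realpow del: of_nat_sum flip: power_sum)
  also have "(5 ^ d * 2 powr real (\<Sum>j\<in>{1..d}. s j)) powr (1 / p) =
      (5 ^ d) powr (1 / p) * 2 powr (real (\<Sum>j\<in>{1..d}. s j) / p)"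
    by (simp add: powr_mult powr_powr)
  also have "(5 ^ d) powr (1 / p) \<le> ((5::real) ^ d) powr 1"
    using p by (intro powr_mono) auto
  also have "6 ^ d * (((5::real) ^ d) powr 1 * 2 powr (real (\<Sum>j\<in>{1..d}. s j) / p)) =
      30 ^ d * 2 powr (real (\<Sum>j\<in>{1..d}. s j) / p)"
    by (simp flip: power_mult_distrib mult.assoc)
  finally show ?thesis
    by (simp add: mult_left_mono mult_right_mono)
qed

text \<open>Interpolation with the sup bound S: |T| powr q is at most S powr (q - p) * |T| powr p.
  Taking the q-th root turns the exponent R / p in S into R (1/p - 1/q).\<close>

lemma nikolskii_inequality:
  assumes T: "T \<in> trig_polys d Q" "finite Q" "Q \<subseteq> {1..d} \<rightarrow>\<^sub>E UNIV"
    and s: "\<And>k j. k \<in> Q \<Longrightarrow> j \<in> {1..d} \<Longrightarrow> \<bar>k j\<bar> \<le> 2 ^ s j"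
    and p: "1 \<le> p" "p < q"
  shows "Lp_real d q T \<le> 30 ^ d * 2 powr (real (\<Sum>j\<in>{1..d}. s j) * (1 / p - 1 / q)) * Lp_real d p T"
proof -
  define N where "N = Lp_real d p T"
  define R where "R = real (\<Sum>j\<in>{1..d}. s j)"
  define S where "S = 30 ^ d * 2 powr (R / p) * N"
  have N: "N \<ge> 0" by (simp add: N_def)
  have "cmod (T x) \<le> S" if "x \<in> space (torus d)" for x
    unfolding S_def N_def R_def by (rule trig_poly_sup_bound[OF T _ p(1) that]) (rule s)
  then have S: "S \<ge> 0" "\<And>x. x \<in> space (torus d) \<Longrightarrow> cmod (T x) \<le> S"
    using N by (auto simp: S_def)
  have "(\<integral>\<^sup>+x. ennreal (cmod (T x) powr q) \<partial>torus d) \<le>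
      (\<integral>\<^sup>+x. ennreal (S powr (q - p)) * ennreal (cmod (T x) powr p) \<partial>torus d)"
  proof (rule nn_integral_mono)
    fix x assume x: "x \<in> space (torus d)"
    have "cmod (T x) powr q = cmod (T x) powr (q - p) * cmod (T x) powr p"
      by (simp flip: powr_add)
    also have "\<dots> \<le> S powr (q - p) * cmod (T x) powr p"
      using S x p by (intro mult_right_mono powr_mono2) auto
    finally show "ennreal (cmod (T x) powr q) \<le> ennreal (S powr (q - p)) * ennreal (cmod (T x) powr p)"
      by (simp flip: ennreal_mult)
  qed
  also have "\<dots> = ennreal (S powr (q - p)) * (\<integral>\<^sup>+x. ennreal (cmod (T x) powr p) \<partial>torus d)"
    using trig_poly_measurable[OF T(1)] by (intro nn_integral_cmult) simp
  also have "(\<integral>\<^sup>+x. ennreal (cmod (T x) powr p) \<partial>torus d) = ennreal (N powr p)"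
    using p N Lp_norm_trig_poly[OF T(1)] by (intro Lp_norm_eqD) (auto simp: N_def)
  also have "ennreal (S powr (q - p)) * ennreal (N powr p) = ennreal ((((30 ^ d) powr (1 - p / q)) * 2 powr (R * (1 / p - 1 / q)) * N) powr q)"
  proof -
    have e: "R * (q - p) / p = R * (q * (1 / p - 1 / q))" "q * (1 - p / q) = q - p"
      using p by (auto simp: field_simps)
    have "N powr q = N powr p * N powr (q - p)"
      by (simp flip: powr_add)
    then show ?thesis
      using N p by (simp add: S_def powr_mult powr_powr e ennreal_mult'[symmetric] mult_ac)
  qed
  also have "\<dots> \<le> ennreal ((30 ^ d * 2 powr (R * (1 / p - 1 / q)) * N) powr q)"
  proof (intro ennreal_leI powr_mono2 mult_right_mono)
    have "((30::real) ^ d) powr (1 - p / q) \<le> (30 ^ d) powr 1"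
      using p by (intro powr_mono) auto
    then show "((30::real) ^ d) powr (1 - p / q) \<le> 30 ^ d" by simp
  qed (use N p in auto)
  finally have "Lp_norm d q T \<le> ennreal (30 ^ d * 2 powr (R * (1 / p - 1 / q)) * N)"
    using N p by (subst Lp_norm_le_iff) auto
  moreover have "Lp_norm d q T = ennreal (Lp_real d q T)"
    using p by (intro Lp_norm_trig_poly[OF T(1)]) auto
  ultimately show ?thesis
    using N by (simp add: N_def R_def)
qed

text \<open>Minkowski's inequality up to a factor \<open>card I\<close>, harmless for the sums of 2
  or 2 ^ d terms that occur. Pointwise, every summand is at most the l_q norm \<open>A\<close> of
  the family.\<close>

lemma Lp_norm_sum_le:
  assumes meas: "\<And>i. i \<in> I \<Longrightarrow> T i \<in> borel_measurable (torus d)"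
    and I: "finite I" and q: "1 \<le> q"
    and B: "\<And>i. i \<in> I \<Longrightarrow> 0 \<le> B i" "\<And>i. i \<in> I \<Longrightarrow> Lp_norm d q (T i) \<le> ennreal (B i)"
  shows "Lp_norm d q (\<lambda>x. \<Sum>i\<in>I. T i x) \<le> ennreal (real (card I) * (\<Sum>i\<in>I. B i))"
proof -
  define S where "S = (\<Sum>i\<in>I. B i)"
  have S: "0 \<le> S" "\<And>i. i \<in> I \<Longrightarrow> B i \<le> S"
    using B I by (auto simp: S_def intro: sum_nonneg member_le_sum)
  have m: "(\<lambda>x. ennreal (cmod (T i x) powr q)) \<in> borel_measurable (torus d)" if "i \<in> I" for i
    using meas[OF that] by measurable
  have "(\<integral>\<^sup>+x. ennreal (cmod (\<Sum>i\<in>I. T i x) powr q) \<partial>torus d) \<le>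
      (\<integral>\<^sup>+x. ennreal (real (card I) powr q) * (\<Sum>i\<in>I. ennreal (cmod (T i x) powr q)) \<partial>torus d)"
  proof (rule nn_integral_mono)
    fix x
    define A where "A = (\<Sum>i\<in>I. cmod (T i x) powr q) powr (1 / q)"
    have "cmod (T i x) \<le> A" if "i \<in> I" for i
    proof (rule powr_le_imp_base_le[of q])
      have "cmod (T i x) powr q \<le> (\<Sum>i\<in>I. cmod (T i x) powr q)"
        using I that by (intro member_le_sum) auto
      then show "cmod (T i x) powr q \<le> A powr q"
        using q by (simp add: A_def powr_powr sum_nonneg)
    qed (use q in \<open>auto simp: A_def\<close>)
    then have "cmod (\<Sum>i\<in>I. T i x) \<le> real (card I) * A"
      by (intro order_trans[OF norm_sum] sum_bounded_above)
    then have "cmod (\<Sum>i\<in>I. T i x) powr q \<le> (real (card I) * A) powr q"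
      using q by (intro powr_mono2) auto
    also have "\<dots> = real (card I) powr q * (\<Sum>i\<in>I. cmod (T i x) powr q)"
      using q by (simp add: A_def powr_mult powr_powr sum_nonneg)
    finally have "ennreal (cmod (\<Sum>i\<in>I. T i x) powr q) \<le> ennreal (real (card I) powr q * (\<Sum>i\<in>I. cmod (T i x) powr q))"
      by (rule ennreal_leI)
    then show "ennreal (cmod (\<Sum>i\<in>I. T i x) powr q) \<le>
        ennreal (real (card I) powr q) * (\<Sum>i\<in>I. ennreal (cmod (T i x) powr q))"
      by (simp add: ennreal_mult sum_nonneg)
  qed
  also have "\<dots> = ennreal (real (card I) powr q) * (\<Sum>i\<in>I. \<integral>\<^sup>+x. ennreal (cmod (T i x) powr q) \<partial>torus d)"
    by (subst nn_integral_cmult, intro borel_measurable_sum m, assumption, subst nn_integral_sum[OF m]) auto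
  also have "\<dots> \<le> ennreal (real (card I) powr q) * (\<Sum>i\<in>I. ennreal (B i * S powr (q - 1)))"
  proof (intro mult_left_mono sum_mono)
    fix i assume i: "i \<in> I"
    have "(\<integral>\<^sup>+x. ennreal (cmod (T i x) powr q) \<partial>torus d) \<le> ennreal (B i powr q)"
      using B[OF i] q by (subst Lp_norm_le_iff[symmetric]) auto
    also have "B i powr q = B i * B i powr (q - 1)"
      using B[OF i] powr_mult_base[of "B i" "q - 1"] by simp
    also have "ennreal (B i * B i powr (q - 1)) \<le> ennreal (B i * S powr (q - 1))"
      using B[OF i] S i q by (intro ennreal_leI mult_left_mono powr_mono2) auto
    finally show "(\<integral>\<^sup>+x. ennreal (cmod (T i x) powr q) \<partial>torus d) \<le> ennreal (B i * S powr (q - 1))" .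
  qed auto
  also have "(\<Sum>i\<in>I. ennreal (B i * S powr (q - 1))) = ennreal (S * S powr (q - 1))"
    using B by (simp add: S_def sum_distrib_right)
  also have "S * S powr (q - 1) = S powr q"
    using S powr_mult_base[of S "q - 1"] by simp
  also have "ennreal (real (card I) powr q) * ennreal (S powr q) = ennreal ((real (card I) * S) powr q)"
    using S by (simp add: powr_mult ennreal_mult)
  finally have "Lp_norm d q (\<lambda>x. \<Sum>i\<in>I. T i x) \<le> ennreal (real (card I) * S)"
    using S q by (subst Lp_norm_le_iff) auto
  then show ?thesis by (simp add: S_def)
qed

section \<open>Sums outside the hyperbolic cross\<close>

lemma sum_geometric_powr_le:
  fixes b :: real
  assumes "b > 0"
  shows "(\<Sum>k=1..R. 2 powr (- b * real k)) \<le> 1 / (1 - 2 powr (- b))"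
proof -
  have lt: "(2::real) powr (- b) < 1"
    using assms by (simp add: powr_minus_divide)
  have "(\<Sum>k=1..R. 2 powr (- b * real k)) = (\<Sum>k=1..R. (2 powr (- b)) ^ k)"
    by (intro sum.cong) (auto simp: powr_powr powr_realpow[symmetric])
  also have "\<dots> \<le> (\<Sum>k. (2 powr (- b)) ^ k)"
    using lt by (intro sum_le_suminf summable_geometric) auto
  also have "\<dots> = 1 / (1 - 2 powr (- b))"
    using lt by (intro suminf_geometric) auto
  finally show ?thesis .
qed

text \<open>Half of the exponential decay absorbs the polynomial factor and leaves a geometric
  series.\<close>

lemma summable_powr_times_power:
  fixes c :: real
  assumes "c > 0"
  shows "summable (\<lambda>i. 2 powr (- c * real i) * (1 + real i) ^ m)"
proof (rule summable_comparison_test_bigo)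
  have "(2::real) powr (- (c / 2)) < 1"
    using assms by (simp add: powr_minus_divide)
  then show "summable (\<lambda>i. norm ((2 powr (- (c / 2))) ^ i :: real))"
    by (simp add: summable_geometric)
  have "(\<lambda>i. 2 powr (- c * real i) * (1 + real i) powr real m) \<in> O(\<lambda>i. 2 powr (- (c / 2) * real i))"
    using assms by real_asymp
  then show "(\<lambda>i. 2 powr (- c * real i) * (1 + real i) ^ m) \<in> O(\<lambda>i. (2 powr (- (c / 2))) ^ i)"
    by (simp add: powr_realpow add_pos_nonneg powr_powr flip: powr_realpow[of "2 powr _"])
qed

text \<open>
  An index \<open>s\<close> is determined by the level \<open>\<lfloor>(s, \<gamma>)\<rfloor>\<close> and by \<open>s\<^sub>2, \<dots>, s\<^sub>d\<close>, because \<open>\<gamma>\<^sub>1 = 1\<close>.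
  On the level \<open>M\<close> each of \<open>s\<^sub>2, \<dots>, s\<^sub>\<nu>\<close> has at most \<open>M\<close> values, and the remaining coordinates
  are summed by geometric series.
\<close>

lemma hyperbolic_tail_sum:
  fixes c :: real and b \<gamma> :: "nat \<Rightarrow> real"
  assumes \<nu>: "1 \<le> \<nu>" "\<nu> \<le> d" and c: "c > 0"
    and \<gamma>: "\<And>j. j \<in> {1..\<nu>} \<Longrightarrow> \<gamma> j = 1" "\<And>j. j \<in> {\<nu>+1..d} \<Longrightarrow> 1 \<le> \<gamma> j"
    and b: "\<And>j. j \<in> {\<nu>+1..d} \<Longrightarrow> b j > 0"
  shows "\<exists>C>0. \<forall>n\<ge>1. \<forall>F. finite F \<and> F \<subseteq> block_indices d \<and> (\<forall>s\<in>F. real n \<le> dot d (\<lambda>j. real (s j)) \<gamma>) \<longrightarrow>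
    (\<Sum>s\<in>F. 2 powr (- c * dot d (\<lambda>j. real (s j)) \<gamma> - (\<Sum>j=\<nu>+1..d. b j * real (s j)))) \<le>
      C * 2 powr (- c * real n) * real n ^ (\<nu> - 1)"
proof -
  define K where "K = (\<Prod>j=\<nu>+1..d. 1 / (1 - 2 powr (- b j)))"
  define S where "S = (\<Sum>i. 2 powr (- c * real i) * (1 + real i) ^ (\<nu> - 1))"
  have "K > 0"
    unfolding K_def using b by (intro prod_pos) (auto simp: powr_minus_divide)
  have "S > 0"
    unfolding S_def by (intro suminf_pos summable_powr_times_power c) auto
  have main: "(\<Sum>s\<in>F. 2 powr (- c * dot d (\<lambda>j. real (s j)) \<gamma> - (\<Sum>j=\<nu>+1..d. b j * real (s j)))) \<le>
      K * S * 2 powr (- c * real n) * real n ^ (\<nu> - 1)"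
    if n: "n \<ge> 1" and F: "finite F" "F \<subseteq> block_indices d" "\<forall>s\<in>F. real n \<le> dot d (\<lambda>j. real (s j)) \<gamma>" for n F
  proof -
    define D where "D s = dot d (\<lambda>j. real (s j)) \<gamma>" for s :: "nat \<Rightarrow> nat"
    \<comment> \<open>The excess of the integer part of the level over \<open>n\<close>; the
      subtraction is exact on \<open>F\<close>, where the level is at least
      \<open>n\<close>.\<close>
    define i where "i s = nat \<lfloor>D s\<rfloor> - n" for s
    define \<psi> where "\<psi> j k = (if j \<le> \<nu> then 1 else 2 powr (- b j * real k))" for j k :: nat
    have s1: "s j \<ge> 1" if "s \<in> F" "j \<in> {1..d}" for s j
      using that F(2) by (auto simp: block_indices_def PiE_iff)
    have \<gamma>1: "1 \<le> \<gamma> j" if "j \<in> {1..d}" for j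
      using \<gamma>(1)[of j] \<gamma>(2)[of j] that by (cases "j \<le> \<nu>") auto
    have \<gamma>0: "0 \<le> \<gamma> j" if "j \<in> {1..d}" for j
      using \<gamma>1[OF that] by linarith
    have nD: "real n \<le> D s" if "s \<in> F" for s
      using F(3) that by (simp add: D_def)
    have iD: "real (n + i s) \<le> D s" "D s < real (n + i s) + 1" if "s \<in> F" for s
      using nD[OF that] unfolding i_def by linarith+
    have sjD: "real (s j) \<le> D s" if "s \<in> F" "j \<in> {1..d}" for s j
    proof -
      have "real (s j) \<le> real (s j) * \<gamma> j"
        using \<gamma>1[OF that(2)] by (simp add: mult_le_cancel_left1)
      also have "\<dots> \<le> D s"
        unfolding D_def dot_def using that by (intro member_le_sum) (use \<gamma>0 in auto)
      finally show ?thesis .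
    qed
    \<comment> \<open>A cutoff for all values that occur in the finite set \<open>F\<close>; the
      final estimate is uniform in it.\<close>
    define R where "R = Max (insert 1 (i ` F \<union> (\<Union>s\<in>F. s ` {1..d}))) + 1"
    have R: "i s < R" "\<And>j. j \<in> {1..d} \<Longrightarrow> s j \<le> R" if "s \<in> F" for s
    proof -
      have fin: "finite (insert 1 (i ` F \<union> (\<Union>s\<in>F. s ` {1..d})))" using F(1) by auto
      have "i s \<le> Max (insert 1 (i ` F \<union> (\<Union>s\<in>F. s ` {1..d})))"
        using \<open>s \<in> F\<close> by (intro Max_ge[OF fin]) auto
      then show "i s < R" by (simp add: R_def)
      show "s j \<le> R" if "j \<in> {1..d}" for j
      proof -
        have "s j \<le> Max (insert 1 (i ` F \<union> (\<Union>s\<in>F. s ` {1..d})))"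
          using \<open>s \<in> F\<close> that by (intro Max_ge[OF fin]) blast
        then show ?thesis by (simp add: R_def)
      qed
    qed
    define Y where "Y a = (\<Pi>\<^sub>E j\<in>{2..d}. if j \<le> \<nu> then {1..n + a} else {1..R})" for a
    define h where "h = (\<lambda>(a, t). 2 powr (- c * real (n + a)) * (\<Prod>j\<in>{2..d}. \<psi> j (t j)))"
    let ?\<phi> = "\<lambda>s. (i s, restrict s {2..d})"
    have inj: "inj_on ?\<phi> F"
    proof (rule inj_onI)
      fix s s' assume s: "s \<in> F" "s' \<in> F" "?\<phi> s = ?\<phi> s'"
      have eq: "s j = s' j" if "j \<in> {2..d}" for j
      proof -
        have "restrict s {2..d} j = restrict s' {2..d} j" using s(3) by simp
        then show ?thesis using that by simp
      qed
      have "{1..d} = insert 1 {2..d}" using \<nu> by auto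
      then have D: "D u = real (u 1) + (\<Sum>j=2..d. real (u j) * \<gamma> j)" for u
        using \<gamma>(1)[of 1] \<nu> by (simp add: D_def dot_def)
      have "(\<Sum>j=2..d. real (s j) * \<gamma> j) = (\<Sum>j=2..d. real (s' j) * \<gamma> j)"
        using eq by (intro sum.cong) auto
      then have "D s - D s' = real (s 1) - real (s' 1)"
        by (simp add: D)
      \<comment> \<open>Equal integer parts make the levels differ by less than 1, while their
        difference is an integer.\<close>
      then have "s 1 = s' 1"
        using iD[OF s(1)] iD[OF s(2)] s(3) by auto
      show "s = s'"
      proof (rule PiE_ext)
        show "s \<in> {1..d} \<rightarrow>\<^sub>E {1..}" "s' \<in> {1..d} \<rightarrow>\<^sub>E {1..}"
          using s F(2) by (auto simp: block_indices_def)
        fix j assume "j \<in> {1..d}"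
        then show "s j = s' j"
          using eq[of j] \<open>s 1 = s' 1\<close> by (cases "j = 1") auto
      qed
    qed
    have sub: "?\<phi> ` F \<subseteq> Sigma {..<R} Y"
    proof (rule image_subsetI)
      fix s assume s: "s \<in> F"
      have "restrict s {2..d} \<in> Y (i s)"
        unfolding Y_def
      proof (rule restrict_PiE_iff[THEN iffD2], rule ballI)
        fix j assume j: "j \<in> {2..d}"
        then have j1: "j \<in> {1..d}" by auto
        have "s j \<le> n + i s"
          using sjD[OF s j1] iD[OF s] by linarith
        then show "s j \<in> (if j \<le> \<nu> then {1..n + i s} else {1..R})"
          using s1[OF s j1] R(2)[OF s j1] by auto
      qed
      then show "?\<phi> s \<in> Sigma {..<R} Y"
        using R(1)[OF s] by auto
    qed
    have finY: "finite (Y a)" for a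
      unfolding Y_def by (intro finite_PiE) auto
    have h0: "0 \<le> h z" for z
      by (auto simp: h_def \<psi>_def case_prod_beta intro!: mult_nonneg_nonneg prod_nonneg)
    have "(\<Sum>s\<in>F. 2 powr (- c * D s - (\<Sum>j=\<nu>+1..d. b j * real (s j)))) \<le> (\<Sum>s\<in>F. h (?\<phi> s))"
    proof (rule sum_mono)
      fix s assume s: "s \<in> F"
      have "(\<Prod>j\<in>{2..d}. \<psi> j (s j)) = (\<Prod>j\<in>{\<nu>+1..d}. 2 powr (- b j * real (s j)))"
        using \<nu> by (intro prod.mono_neutral_cong_right) (auto simp: \<psi>_def)
      also have "\<dots> = 2 powr (- (\<Sum>j=\<nu>+1..d. b j * real (s j)))"
        by (simp add: powr_sum[symmetric] sum_negf)
      finally have prod: "(\<Prod>j\<in>{2..d}. \<psi> j (restrict s {2..d} j)) = 2 powr (- (\<Sum>j=\<nu>+1..d. b j * real (s j)))"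
        by simp
      have "2 powr (- c * D s - (\<Sum>j=\<nu>+1..d. b j * real (s j))) =
          2 powr (- c * D s) * 2 powr (- (\<Sum>j=\<nu>+1..d. b j * real (s j)))"
        by (simp flip: powr_add)
      also have "\<dots> \<le> 2 powr (- c * real (n + i s)) * 2 powr (- (\<Sum>j=\<nu>+1..d. b j * real (s j)))"
        using iD(1)[OF s] c by (intro mult_right_mono powr_mono) auto
      finally show "2 powr (- c * D s - (\<Sum>j=\<nu>+1..d. b j * real (s j))) \<le> h (?\<phi> s)"
        using prod by (simp add: h_def)
    qed
    also have "\<dots> = (\<Sum>z\<in>?\<phi> ` F. h z)"
      by (simp add: sum.reindex[OF inj])
    also have "\<dots> \<le> (\<Sum>z\<in>Sigma {..<R} Y. h z)"
      using sub finY h0 by (intro sum_mono2) auto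
    also have "\<dots> = (\<Sum>a<R. 2 powr (- c * real (n + a)) * (\<Sum>t\<in>Y a. \<Prod>j\<in>{2..d}. \<psi> j (t j)))"
      using sum.Sigma[of "{..<R}" Y "\<lambda>a t. h (a, t)"] finY by (simp add: h_def sum_distrib_left)
    also have "\<dots> \<le> (\<Sum>a<R. 2 powr (- c * real (n + a)) * (real (n + a) ^ (\<nu> - 1) * K))"
    proof (intro sum_mono mult_left_mono)
      fix a
      have "(\<Sum>t\<in>Y a. \<Prod>j\<in>{2..d}. \<psi> j (t j)) =
          (\<Prod>j\<in>{2..d}. \<Sum>k\<in>(if j \<le> \<nu> then {1..n + a} else {1..R}). \<psi> j k)"
        unfolding Y_def by (rule prod_sum_PiE[symmetric]) auto
      also have "\<dots> = (\<Prod>j\<in>{2..\<nu>} \<union> {\<nu>+1..d}. \<Sum>k\<in>(if j \<le> \<nu> then {1..n + a} else {1..R}). \<psi> j k)"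
        using \<nu> by (intro prod.cong) auto
      also have "\<dots> =
          (\<Prod>j\<in>{2..\<nu>}. \<Sum>k\<in>(if j \<le> \<nu> then {1..n + a} else {1..R}). \<psi> j k) *
          (\<Prod>j\<in>{\<nu>+1..d}. \<Sum>k\<in>(if j \<le> \<nu> then {1..n + a} else {1..R}). \<psi> j k)"
        by (rule prod.union_disjoint) auto
      also have "(\<Prod>j\<in>{2..\<nu>}. \<Sum>k\<in>(if j \<le> \<nu> then {1..n + a} else {1..R}). \<psi> j k) = (\<Prod>j\<in>{2..\<nu>}. real (n + a))"
        by (intro prod.cong) (auto simp: \<psi>_def)
      also have "\<dots> = real (n + a) ^ (\<nu> - 1)"
        using \<nu> by simp
      also have "(\<Prod>j\<in>{\<nu>+1..d}. \<Sum>k\<in>(if j \<le> \<nu> then {1..n + a} else {1..R}). \<psi> j k) =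
          (\<Prod>j\<in>{\<nu>+1..d}. \<Sum>k=1..R. 2 powr (- b j * real k))"
        by (intro prod.cong sum.cong) (auto simp: \<psi>_def)
      also have "\<dots> \<le> K"
        unfolding K_def by (intro prod_mono conjI sum_nonneg sum_geometric_powr_le b) auto
      finally show "(\<Sum>t\<in>Y a. \<Prod>j\<in>{2..d}. \<psi> j (t j)) \<le> real (n + a) ^ (\<nu> - 1) * K"
        by (simp add: mult_left_mono)
    qed auto
    also have "\<dots> \<le> (\<Sum>a<R. K * 2 powr (- c * real n) * real n ^ (\<nu> - 1) * (2 powr (- c * real a) * (1 + real a) ^ (\<nu> - 1)))"
    proof (rule sum_mono)
      fix a
      \<comment> \<open>This separates \<open>n\<close> from the excess \<open>a\<close>, leaving a
        convergent series in \<open>a\<close>; it uses n >= 1.\<close>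
      have "real (n + a) \<le> real n * (1 + real a)"
        using n mult_left_mono[of 1 "real n" "real a"] by (simp add: algebra_simps)
      then have "real (n + a) ^ (\<nu> - 1) \<le> (real n * (1 + real a)) ^ (\<nu> - 1)"
        by (intro power_mono) auto
      then have "2 powr (- c * real (n + a)) * (real (n + a) ^ (\<nu> - 1) * K) \<le>
          2 powr (- c * real (n + a)) * ((real n * (1 + real a)) ^ (\<nu> - 1) * K)"
        using \<open>K > 0\<close> by (intro mult_left_mono mult_right_mono) auto
      moreover have "2 powr (- (c * (real n + real a))) = 2 powr (- (c * real n)) * 2 powr (- (c * real a))"
        by (simp add: algebra_simps flip: powr_add)
      ultimately show "2 powr (- c * real (n + a)) * (real (n + a) ^ (\<nu> - 1) * K) \<le>
          K * 2 powr (- c * real n) * real n ^ (\<nu> - 1) * (2 powr (- c * real a) * (1 + real a) ^ (\<nu> - 1))"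
        by (simp add: power_mult_distrib mult_ac)
    qed
    also have "\<dots> = K * 2 powr (- c * real n) * real n ^ (\<nu> - 1) * (\<Sum>a<R. 2 powr (- c * real a) * (1 + real a) ^ (\<nu> - 1))"
      by (simp add: sum_distrib_left)
    also have "\<dots> \<le> K * 2 powr (- c * real n) * real n ^ (\<nu> - 1) * S"
      unfolding S_def using \<open>K > 0\<close>
      by (intro mult_left_mono sum_le_suminf summable_powr_times_power c) auto
    finally show ?thesis
      by (simp add: D_def mult_ac)
  qed
  show ?thesis
    by (rule exI[of _ "K * S"]) (use main \<open>K > 0\<close> \<open>S > 0\<close> in auto)
qed

text \<open>Young's inequality, summed after \<open>b\<close> is divided by the bound B powr (1 /
  \<theta>') for its conjugate norm.\<close>

lemma sum_mult_le_holder: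
  fixes a b :: "'i \<Rightarrow> real"
  assumes \<theta>: "1 < \<theta>" and \<theta>': "1 / \<theta> + 1 / \<theta>' = 1"
    and a: "\<And>i. i \<in> I \<Longrightarrow> 0 \<le> a i" and b: "\<And>i. i \<in> I \<Longrightarrow> 0 \<le> b i"
    and A: "(\<Sum>i\<in>I. a i powr \<theta>) \<le> 1" and B: "(\<Sum>i\<in>I. b i powr \<theta>') \<le> B" "0 < B"
  shows "(\<Sum>i\<in>I. a i * b i) \<le> B powr (1 / \<theta>')"
proof -
  have "\<theta>' > 1"
    using \<theta> \<theta>' by (smt (verit) divide_le_eq_1_pos divide_nonneg_nonpos divide_pos_pos le_divide_eq_1_pos zero_less_divide_1_iff)
  define \<beta> where "\<beta> = B powr (1 / \<theta>')"
  have "\<beta> > 0" using B by (simp add: \<beta>_def)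
  have "(\<Sum>i\<in>I. a i * (b i / \<beta>)) \<le> (\<Sum>i\<in>I. a i powr \<theta> / \<theta> + (b i / \<beta>) powr \<theta>' / \<theta>')"
    using \<theta> \<theta>' \<open>\<theta>' > 1\<close> a b \<open>\<beta> > 0\<close> by (intro sum_mono Youngs_inequality) auto
  also have "\<dots> = (\<Sum>i\<in>I. a i powr \<theta>) / \<theta> + (\<Sum>i\<in>I. b i powr \<theta>') / B / \<theta>'"
    using b B \<open>\<beta> > 0\<close> \<open>\<theta>' > 1\<close>
    by (simp add: sum.distrib sum_divide_distrib powr_divide \<beta>_def powr_powr cong: sum.cong)
  also have "\<dots> \<le> 1 / \<theta> + 1 / \<theta>'"
    using A B \<theta> \<open>\<theta>' > 1\<close> by (intro add_mono divide_right_mono) auto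
  finally have "(\<Sum>i\<in>I. a i * b i) / \<beta> \<le> 1"
    by (simp add: \<theta>' sum_divide_distrib)
  then show ?thesis
    using \<open>\<beta> > 0\<close> by (simp add: \<beta>_def)
qed

section \<open>Functions of mean zero as sums of their blocks\<close>

lemma character_update:
  assumes "j \<in> {1..d}" "k j = 0"
  shows "character d k (x(j := u)) = character d k x"
  unfolding character_prod using assms by (intro prod.cong) auto

lemma measurable_fun_upd_torus:
  assumes "j \<in> {1..d}"
  shows "(\<lambda>(x, u). x(j := u)) \<in> measurable (torus d \<Otimes>\<^sub>M circ) (torus d)"
    and "(\<lambda>(x, u). x(j := u)) \<in> measurable (PiM ({1..d} - {j}) (\<lambda>_. circ) \<Otimes>\<^sub>M circ) (torus d)"
proof -
  have "insert j {1..d} = {1..d}" "insert j ({1..d} - {j}) = {1..d}" using assms by auto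
  then show "(\<lambda>(x, u). x(j := u)) \<in> measurable (torus d \<Otimes>\<^sub>M circ) (torus d)"
    and "(\<lambda>(x, u). x(j := u)) \<in> measurable (PiM ({1..d} - {j}) (\<lambda>_. circ) \<Otimes>\<^sub>M circ) (torus d)"
    using measurable_add_dim[of j "{1..d}" "\<lambda>_. circ"] measurable_add_dim[of j "{1..d} - {j}" "\<lambda>_. circ"]
    by (simp_all add: torus_eq)
qed

text \<open>The character does not depend on x_j, so integrating in x_j first gives 0. The obstacle
  is that the hypothesis holds almost everywhere in d variables, while Fubini wants it almost
  everywhere in the other d - 1.\<close>

lemma fourier_coeff_eq_0_of_mean_zero:
  assumes f: "integrable (torus d) f" and j: "j \<in> {1..d}" and k: "k j = 0"
    and zero: "AE x in torus d. (LINT u:{0..<2 * pi}|lborel. f (x(j := u))) = 0"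
  shows "fourier_coeff d f k = 0"
proof -
  define I' where "I' = {1..d} - {j}"
  have I': "insert j I' = {1..d}" "finite I'" "j \<notin> I'" using j by (auto simp: I'_def)
  let ?P = "PiM I' (\<lambda>_. circ)"
  have [measurable]: "f \<in> borel_measurable (torus d)" using f by auto
  define F where "F x = f x * character d (\<lambda>j. - k j) x" for x
  have F: "integrable (torus d) F"
    unfolding F_def[abs_def] by (rule integrable_mult_character[OF f])
  then have Fm: "F \<in> borel_measurable (torus d)" by auto
  define G where "G x = (LINT u|circ. F (x(j := u)))" for x
  have Gm: "G \<in> borel_measurable (torus d)"
    unfolding G_def[abs_def]
    using measurable_compose[OF measurable_fun_upd_torus(1)[OF j] Fm]
    by (intro circ.borel_measurable_lebesgue_integral) (simp add: case_prod_beta')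
  have Gm': "G \<in> borel_measurable ?P"
    unfolding G_def[abs_def] I'_def
    using measurable_compose[OF measurable_fun_upd_torus(2)[OF j] Fm]
    by (intro circ.borel_measurable_lebesgue_integral) (simp add: case_prod_beta')
  have "AE x in torus d. G x = 0"
    using zero AE_space
  proof eventually_elim
    case (elim x)
    have "(\<lambda>u. x(j := u)) \<in> measurable circ (torus d)"
      using measurable_compose[OF measurable_Pair1'[OF elim(2)] measurable_fun_upd_torus(1)[OF j]] by simp
    then have "(\<lambda>u. f (x(j := u))) \<in> borel_measurable circ"
      by (rule measurable_compose) simp
    then have "(\<lambda>u. f (x(j := u))) \<in> borel_measurable borel"
      by (simp add: measurable_cong_sets[OF sets_circ refl])
    then have "(LINT u|circ. f (x(j := u))) = 0"
      using elim(1) by (simp add: integral_circ)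
    then show ?case
      using k by (simp add: G_def F_def character_update[OF j])
  qed
  \<comment> \<open>\<open>G\<close> ignores coordinate \<open>j\<close> and \<open>circ\<close> has
    mass 1, so the vanishing integral of |G| over the torus equals that over the remaining
    coordinates.\<close>
  then have "(\<integral>\<^sup>+x. ennreal (cmod (G x)) \<partial>torus d) = (\<integral>\<^sup>+x. 0 \<partial>torus d)"
    by (intro nn_integral_cong_AE) auto
  then have "0 = (\<integral>\<^sup>+x. ennreal (cmod (G x)) \<partial>PiM (insert j I') (\<lambda>_. circ))"
    by (simp add: I' torus_eq)
  also have "\<dots> = (\<integral>\<^sup>+x. (\<integral>\<^sup>+u. ennreal (cmod (G (x(j := u)))) \<partial>circ) \<partial>?P)"
    using Gm by (intro circs.product_nn_integral_insert I') (simp add: I' torus_eq)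
  also have "\<dots> = (\<integral>\<^sup>+x. ennreal (cmod (G x)) \<partial>?P)"
    by (simp add: G_def circ.emeasure_space_1[simplified])
  finally have "AE x in ?P. ennreal (cmod (G x)) = 0"
    using Gm' by (subst nn_integral_0_iff_AE[symmetric]) auto
  then have "AE x in ?P. G x = 0"
    by eventually_elim simp
  then have "(LINT x|?P. G x) = 0"
    by (subst integral_eq_zero_AE) auto
  moreover have "fourier_coeff d f k = (LINT x|PiM (insert j I') (\<lambda>_. circ). F x)"
    by (simp add: fourier_coeff_eq F_def I' torus_eq)
  moreover have "\<dots> = (LINT x|?P. G x)"
    unfolding G_def using F by (intro circs.product_integral_insert I') (simp add: I' torus_eq)
  ultimately show ?thesis by simp
qed

lemma Lp_integrable:
  assumes "f \<in> Lp d p" "1 \<le> p"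
  shows "integrable (torus d) f"
proof (rule integrableI_bounded)
  have f: "f \<in> borel_measurable (torus d)" "Lp_norm d p f < \<infinity>"
    using assms by (auto simp: Lp_def)
  show "f \<in> borel_measurable (torus d)" by fact
  note [measurable] = f(1)
  define B where "B = enn2real (Lp_norm d p f)"
  have B: "B \<ge> 0" "Lp_norm d p f = ennreal B"
    using f(2) by (simp_all add: B_def)
  have "(\<integral>\<^sup>+x. ennreal (cmod (f x)) \<partial>torus d) \<le> (\<integral>\<^sup>+x. 1 + ennreal (cmod (f x) powr p) \<partial>torus d)"
  proof (rule nn_integral_mono)
    fix x
    have "cmod (f x) \<le> 1 + cmod (f x) powr p"
    proof (cases "cmod (f x) \<le> 1")
      case False
      then have "cmod (f x) powr 1 \<le> cmod (f x) powr p"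
        using assms(2) by (intro powr_mono) auto
      then show ?thesis by simp
    qed (simp add: add_increasing2)
    then have "ennreal (cmod (f x)) \<le> ennreal (1 + cmod (f x) powr p)"
      by (rule ennreal_leI)
    then show "ennreal (cmod (f x)) \<le> 1 + ennreal (cmod (f x) powr p)"
      by simp
  qed
  also have "\<dots> = 1 + ennreal (B powr p)"
    using B assms(2) Lp_norm_eqD[of p B d f] by (simp add: nn_integral_add torus.emeasure_space_1)
  also have "\<dots> < \<infinity>" by simp
  finally show "(\<integral>\<^sup>+x. ennreal (norm (f x)) \<partial>torus d) < \<infinity>" .
qed

lemma Lp0_integrable:
  assumes "f \<in> Lp0 d p" "1 \<le> p"
  shows "integrable (torus d) f"
proof -
  have "f \<in> Lp d p" using assms(1) unfolding Lp0_def by blast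
  then show ?thesis using assms(2) by (rule Lp_integrable)
qed

lemma Lp0_fourier_coeff_eq_0:
  assumes "f \<in> Lp0 d p" "1 \<le> p" "j \<in> {1..d}" "k j = 0"
  shows "fourier_coeff d f k = 0"
proof -
  have f: "f \<in> Lp d p" and zero: "\<forall>j\<in>{1..d}. AE x in torus d. (LINT u:{0..<2 * pi}|lborel. f (x(j := u))) = 0"
    using assms(1) unfolding Lp0_def by blast+
  show ?thesis
    by (rule fourier_coeff_eq_0_of_mean_zero[where k = k and j = j, OF Lp_integrable[OF f assms(2)] assms(3,4) bspec[OF zero assms(3)]])
qed

lemma periodic_character: "j \<in> {1..d} \<Longrightarrow> character d k (x(j := x j + 2 * pi)) = character d k x"
proof -
  assume j: "j \<in> {1..d}"
  have "cis (of_int (k i) * (x(j := x j + 2 * pi)) i) = cis (of_int (k i) * x i)" for i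
  proof (cases "i = j")
    case True
    have "cis (of_int (k j) * (x j + 2 * pi)) = cis (of_int (k j) * x j) * cis (2 * pi * of_int (k j))"
      by (simp add: cis_mult algebra_simps)
    then show ?thesis using True by (simp add: cis_multiple_2pi)
  qed simp
  then show ?thesis by (simp add: character_prod)
qed

lemma periodic_trig_poly:
  assumes "T \<in> trig_polys d Q"
  shows "periodic_fun d T"
  using assms by (auto simp: trig_polys_def periodic_fun_def periodic_character[simplified])

lemma integral_trig_poly_slice:
  assumes T: "T \<in> trig_polys d Q" and j: "j \<in> {1..d}" and nz: "\<forall>k\<in>Q. k j \<noteq> 0"
  shows "(\<lambda>u. T (x(j := u))) \<in> borel_measurable borel"
    and "set_integrable lborel {0..<2 * pi} (\<lambda>u. T (x(j := u)))"
    and "(LINT u:{0..<2 * pi}|lborel. T (x(j := u))) = 0"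
proof -
  obtain c where c: "T = (\<lambda>x. \<Sum>k\<in>Q. c k * character d k x)"
    using T by (auto simp: trig_polys_def)
  have char: "character d k (x(j := u)) = (\<Prod>i\<in>{1..d} - {j}. cis (of_int (k i) * x i)) * cis (of_int (k j) * u)" for k u
  proof -
    have "(\<Prod>i\<in>{1..d} - {j}. cis (of_int (k i) * (x(j := u)) i)) = (\<Prod>i\<in>{1..d} - {j}. cis (of_int (k i) * x i))"
      by (rule prod.cong) auto
    then show ?thesis
      unfolding character_prod using prod.remove[of "{1..d}" j "\<lambda>i. cis (of_int (k i) * (x(j := u)) i)"] j
      by (simp only: finite_atLeastAtMost fun_upd_same mult.commute)
  qed
  define b where "b k = c k * (\<Prod>i\<in>{1..d} - {j}. cis (of_int (k i) * x i))" for k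
  have slice: "T (x(j := u)) = (\<Sum>k\<in>Q. b k * cis (of_int (k j) * u))" for u
    unfolding c char b_def by (simp add: mult_ac)
  show m: "(\<lambda>u. T (x(j := u))) \<in> borel_measurable borel"
    unfolding slice by measurable
  obtain B where B: "B \<ge> 0" "\<And>x. cmod (T x) \<le> B"
    using trig_poly_bounded[OF T] by blast
  show "set_integrable lborel {0..<2 * pi} (\<lambda>u. T (x(j := u)))"
    unfolding set_integrable_def
  proof (rule Bochner_Integration.integrable_bound)
    show "integrable lborel (\<lambda>u. indicator {0..<2 * pi} u *\<^sub>R B)"
      by (intro integrable_scaleR_left) simp
    show "AE u in lborel. cmod (indicator {0..<2 * pi} u *\<^sub>R T (x(j := u))) \<le> norm (indicator {0..<2 * pi} u *\<^sub>R B)"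
      using B by (auto simp: indicator_def)
    show "(\<lambda>u. indicator {0..<2 * pi} u *\<^sub>R T (x(j := u))) \<in> borel_measurable lborel"
      using m by (intro borel_measurable_scaleR borel_measurable_indicator) auto
  qed
  have "(LINT u|circ. T (x(j := u))) = (\<Sum>k\<in>Q. LINT u|circ. b k * cis (of_int (k j) * u))"
    unfolding slice
    by (rule Bochner_Integration.integral_sum) (auto intro!: integrable_mult_right integrable_circ_bounded[where B = 1])
  also have "\<dots> = 0"
    using nz by (simp add: integral_cis)
  finally show "(LINT u:{0..<2 * pi}|lborel. T (x(j := u))) = 0"
    using integral_circ[OF m] by simp
qed

text \<open>Slices of a polynomial whose frequencies have no zero coordinate integrate to 0.
  Periodicity, measurability and mean zero do not involve the exponent, which may therefore change
  from \<open>p\<close> to \<open>q\<close>.\<close>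

lemma Lp0_diff_trig_poly:
  assumes f: "f \<in> Lp0 d p" and T: "T \<in> trig_polys d Q"
    and nz: "\<And>k j. k \<in> Q \<Longrightarrow> j \<in> {1..d} \<Longrightarrow> k j \<noteq> 0"
    and fin: "Lp_norm d q (\<lambda>x. f x - T x) < \<infinity>"
  shows "(\<lambda>x. f x - T x) \<in> Lp0 d q"
proof -
  have fp: "periodic_fun d f" and fm: "f \<in> borel_measurable (torus d)"
    and f0: "\<forall>j\<in>{1..d}. AE x in torus d. (LINT u:{0..<2 * pi}|lborel. f (x(j := u))) = 0"
    using f unfolding Lp0_def Lp_def by blast+
  have 1: "periodic_fun d (\<lambda>x. f x - T x)"
    unfolding periodic_fun_def
  proof (intro ballI arg_cong2[of _ _ _ _ minus])
    fix x :: "nat \<Rightarrow> real" and j assume x: "x \<in> {1..d} \<rightarrow>\<^sub>E UNIV" "j \<in> {1..d}"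
    show "f (x(j := x j + 2 * pi)) = f x"
      by (rule bspec[OF bspec[OF fp[unfolded periodic_fun_def] x(1)] x(2)])
    show "T (x(j := x j + 2 * pi)) = T x"
      by (rule bspec[OF bspec[OF periodic_trig_poly[OF T, unfolded periodic_fun_def] x(1)] x(2)])
  qed
  have 2: "(\<lambda>x. f x - T x) \<in> borel_measurable (torus d)"
    using fm trig_poly_measurable[OF T] by (rule borel_measurable_diff)
  have 3: "AE x in torus d. (LINT u:{0..<2 * pi}|lborel. f (x(j := u)) - T (x(j := u))) = 0"
    if j: "j \<in> {1..d}" for j
  proof -
    have "AE x in torus d. (LINT u:{0..<2 * pi}|lborel. f (x(j := u))) = 0"
      using f0 j by (rule bspec)
    then show ?thesis
    proof eventually_elim
      case (elim x)
      have nz': "\<forall>k\<in>Q. k j \<noteq> 0" using nz j by blast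
      note T' = integral_trig_poly_slice[where j = j and x = x, OF T j nz']
      show ?case
      proof (cases "set_integrable lborel {0..<2 * pi} (\<lambda>u. f (x(j := u)))")
        case True
        then show ?thesis
          using set_integral_diff(2)[OF True T'(2)] elim T'(3) by (simp only: diff_self)
      next
        case False
        \<comment> \<open>Subtracting an integrable slice leaves a non-integrable one
          non-integrable, and its integral is 0 by convention.\<close>
        have "\<not> set_integrable lborel {0..<2 * pi} (\<lambda>u. f (x(j := u)) - T (x(j := u)))"
        proof
          assume "set_integrable lborel {0..<2 * pi} (\<lambda>u. f (x(j := u)) - T (x(j := u)))"
          from set_integral_add(1)[OF this T'(2)] False show False
            by (simp only: diff_add_cancel)
        qed
        then show ?thesis
          unfolding set_integrable_def set_lebesgue_integral_def by (rule not_integrable_integral_eq)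
      qed
    qed
  qed
  show ?thesis
    unfolding Lp0_def Lp_def by (intro CollectI conjI ballI 1 2 3 fin)
qed

lemma integral_norm_le_Lp_real:
  assumes T: "T \<in> trig_polys d Q" and q: "1 \<le> q"
  shows "(LINT x|torus d. cmod (T x)) \<le> Lp_real d q T"
proof -
  let ?c = "LINT x|torus d. cmod (T x)"
  have [measurable]: "T \<in> borel_measurable (torus d)" by (rule trig_poly_measurable[OF T])
  have "ennreal (?c powr q) \<le> ennreal (1 powr (q - 1)) * (\<integral>\<^sup>+x. ennreal (cmod (T x) powr q * 1) \<partial>torus d)"
  proof (rule powr_nn_integral_le[where w = "\<lambda>_. 1" and g = "\<lambda>x. cmod (T x)" and L = 1])
    have "(\<integral>\<^sup>+x. ennreal (cmod (T x) * 1) \<partial>torus d) = ennreal ?c"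
      using trig_poly_integrable[OF T] by (simp add: nn_integral_eq_integral)
    then show "ennreal ?c \<le> (\<integral>\<^sup>+x. ennreal (cmod (T x) * 1) \<partial>torus d)" by simp
  qed (use q in \<open>auto simp: torus.emeasure_space_1\<close>)
  also have "\<dots> = ennreal (Lp_real d q T powr q)"
  proof -
    have "(\<integral>\<^sup>+x. ennreal (cmod (T x) powr q) \<partial>torus d) = ennreal (Lp_real d q T powr q)"
      using q by (intro Lp_norm_eqD Lp_norm_trig_poly[OF T]) auto
    then show ?thesis by simp
  qed
  finally have "?c powr q \<le> Lp_real d q T powr q"
    by simp
  with q show ?thesis
    by (auto intro: powr_le_imp_base_le[of q "Lp_real d q T"])
qed

text \<open>
  A function of mean zero in each variable is the sum of its dyadic blocks as soon as their
  \<open>L\<^sub>q\<close>-norms are summable: the sum has the same Fourier coefficients.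
\<close>

lemma Lp_norm_finite_of_blocks:
  assumes f: "f \<in> Lp0 d p" "1 \<le> p" and q: "1 \<le> q" and d: "1 \<le> d"
    and w: "\<And>s. s \<in> block_indices d \<Longrightarrow> 0 < w s" "\<And>s. s \<in> block_indices d \<Longrightarrow> Lp_real d q (delta d s f) \<le> w s"
    and L: "\<And>F. finite F \<Longrightarrow> F \<subseteq> block_indices d \<Longrightarrow> (\<Sum>s\<in>F. w s) \<le> L"
  shows "Lp_norm d q f < \<infinity>"
proof -
  \<comment> \<open>An enumeration of the indices turns the blocks into a series, to which theorems
    on termwise integration apply.\<close>
  have "countable (block_indices d)"
    unfolding block_indices_def by (intro countable_PiE) auto
  moreover have "infinite (block_indices d)"
  proof
    assume fin: "finite (block_indices d)"
    have "inj_on (\<lambda>n::nat. \<lambda>j\<in>{1..d}. n) {1..}"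
    proof (rule inj_onI)
      fix m n :: nat assume "(\<lambda>j\<in>{1..d}. m) = (\<lambda>j\<in>{1..d}. n)"
      from fun_cong[OF this, of 1] show "m = n" using d by simp
    qed
    moreover have "(\<lambda>n::nat. \<lambda>j\<in>{1..d}. n) ` {1..} \<subseteq> block_indices d"
    proof (rule image_subsetI)
      fix n :: nat assume "n \<in> {1..}"
      then show "(\<lambda>j\<in>{1..d}. n) \<in> block_indices d"
        unfolding block_indices_def by (intro restrict_PiE_iff[THEN iffD2] ballI)
    qed
    ultimately have "finite {1::nat..}"
      using fin by (rule inj_on_finite)
    then show False by (simp add: infinite_Ici)
  qed
  ultimately obtain e :: "nat \<Rightarrow> nat \<Rightarrow> nat" where e: "bij_betw e UNIV (block_indices d)"
    using bij_betw_from_nat_into by blast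
  have eb: "e n \<in> block_indices d" for n
    using bij_betwE[OF e] by blast
  define T where "T n = delta d (e n) f" for n
  have T: "T n \<in> trig_polys d (rho d (e n))" for n
    unfolding T_def by (rule delta_in_trig_polys)
  have Ti: "integrable (torus d) (T n)" and [measurable]: "T n \<in> borel_measurable (torus d)" for n
    using trig_poly_integrable[OF T] trig_poly_measurable[OF T] by auto
  have wsum: "(\<Sum>n<N. w (e n)) \<le> L" for N
  proof -
    have "(\<Sum>n<N. w (e n)) = (\<Sum>s\<in>e ` {..<N}. w s)"
      by (subst sum.reindex) (auto intro: inj_on_subset[OF bij_betw_imp_inj_on[OF e]])
    also have "\<dots> \<le> L"
      using eb by (intro L) auto
    finally show ?thesis .
  qed
  have w0: "0 < w (e n)" for n using w(1) eb by blast
  have wsm: "summable (\<lambda>n. w (e n))"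
    by (rule summableI_nonneg_bounded[of _ L]) (auto simp: wsum less_imp_le[OF w0])
  have L_pos: "0 < L"
    using wsum[of 1] w0[of 0] by simp
  have Tw: "Lp_real d q (T n) \<le> w (e n)" for n
    unfolding T_def by (intro w eb)
  have norm_sums: "summable (\<lambda>n. LINT x|torus d. cmod (T n x))"
    by (rule summable_comparison_test'[OF wsm, of 0])
       (use order_trans[OF integral_norm_le_Lp_real[OF T q] Tw] in \<open>simp add: abs_of_nonneg\<close>)
  have AE_sum: "AE x in torus d. summable (\<lambda>n. cmod (T n x))"
  proof -
    have "(\<integral>\<^sup>+x. (\<Sum>n. ennreal (cmod (T n x))) \<partial>torus d) = (\<Sum>n. \<integral>\<^sup>+x. ennreal (cmod (T n x)) \<partial>torus d)"
      by (rule nn_integral_suminf) simp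
    also have "\<dots> = (\<Sum>n. ennreal (LINT x|torus d. cmod (T n x)))"
      using Ti by (intro suminf_cong nn_integral_eq_integral) auto
    also have "\<dots> < \<infinity>"
      using norm_sums by (simp add: ennreal_suminf_neq_top less_top[symmetric])
    finally have "AE x in torus d. (\<Sum>n. ennreal (cmod (T n x))) \<noteq> \<infinity>"
      by (intro nn_integral_PInf_AE) auto
    then show ?thesis
      by eventually_elim (auto intro: summable_suminf_not_top)
  qed
  define g where "g x = (\<Sum>n. T n x)" for x
  have gi: "integrable (torus d) g"
    unfolding g_def[abs_def] by (rule integrable_suminf[OF Ti AE_sum norm_sums])
  have fi: "integrable (torus d) f"
    using f by (rule Lp0_integrable)
  have "fourier_coeff d g k = fourier_coeff d f k" if k: "k \<in> {1..d} \<rightarrow>\<^sub>E UNIV" for k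
  proof -
    let ?ch = "character d (\<lambda>j. - k j)"
    have "(\<lambda>n. LINT x|torus d. T n x * ?ch x) sums (LINT x|torus d. (\<Sum>n. T n x * ?ch x))"
      by (rule sums_integral[OF integrable_mult_character[OF Ti]]) (simp_all add: norm_mult AE_sum norm_sums)
    also have "(LINT x|torus d. (\<Sum>n. T n x * ?ch x)) = (LINT x|torus d. g x * ?ch x)"
    proof (rule integral_cong_AE)
      show "AE x in torus d. (\<Sum>n. T n x * ?ch x) = g x * ?ch x"
        using AE_sum by eventually_elim (simp add: g_def suminf_mult2[symmetric] summable_norm_cancel)
      show "(\<lambda>x. g x * ?ch x) \<in> borel_measurable (torus d)"
        using gi by (intro borel_measurable_times) auto
    qed measurable
    finally have sums: "(\<lambda>n. fourier_coeff d (T n) k) sums fourier_coeff d g k"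
      by (simp add: fourier_coeff_eq)
    have T_k: "fourier_coeff d (T n) k = (if k \<in> rho d (e n) then fourier_coeff d f k else 0)" for n
      unfolding T_def by (rule fourier_coeff_delta[OF k])
    show ?thesis
    \<comment> \<open>A frequency without zero coordinate lies in exactly one block. The others lie
      in none, and mean zero makes the coefficient of \<open>f\<close> vanish there too.\<close>
    proof (cases "\<forall>j\<in>{1..d}. k j \<noteq> 0")
      case True
      then obtain s where s: "s \<in> block_indices d" "k \<in> rho d s"
        using rho_exists[OF k] by blast
      then obtain m where m: "s = e m"
        using bij_betw_imp_surj_on[OF e] by blast
      have "k \<in> rho d (e n) \<longleftrightarrow> n = m" for n
        using rho_unique[OF _ s(2) eb s(1), of n] s(2) m bij_betw_imp_inj_on[OF e] by (auto simp: inj_on_def)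
      then have "(\<lambda>n. fourier_coeff d (T n) k) = (\<lambda>n. if n = m then fourier_coeff d f k else 0)"
        by (simp add: T_k)
      then have "(\<lambda>n. fourier_coeff d (T n) k) sums fourier_coeff d f k"
        using sums_single[of m "\<lambda>_. fourier_coeff d f k"] by simp
      with sums show ?thesis by (rule sums_unique2)
    next
      case False
      then obtain j where j: "j \<in> {1..d}" "k j = 0" by blast
      have "k \<notin> rho d (e n)" for n
      proof
        assume "k \<in> rho d (e n)"
        then have "2 ^ (e n j - 1) \<le> \<bar>k j\<bar>" using j(1) unfolding rho_def by blast
        then show False using j(2) zero_less_power[of "2::int" "e n j - 1"] by simp
      qed
      then have "(\<lambda>n. fourier_coeff d (T n) k) sums 0"
        by (simp add: T_k)
      with sums have "fourier_coeff d g k = 0" by (rule sums_unique2)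
      then show ?thesis
        using Lp0_fourier_coeff_eq_0[where k = k and j = j, OF f j] by simp
    qed
  qed
  then have "AE x in torus d. f x - g x = 0"
    using fi gi by (intro fourier_coeff_unique) (auto simp: fourier_coeff_diff)
  then have fg: "AE x in torus d. f x = g x" by eventually_elim simp
  \<comment> \<open>Jensen's inequality for the series, with weights \<open>w (e n)\<close> and the
    function \<open>cmod (T n x) / w (e n)\<close>. The integral of each resulting term is at most
    \<open>w (e n)\<close>, and the weights are summable; the division is the reason for demanding 0
    < w.\<close>
  have "(\<integral>\<^sup>+x. ennreal (cmod (f x) powr q) \<partial>torus d) \<le>
      (\<integral>\<^sup>+x. ennreal (L powr (q - 1)) * (\<Sum>n. ennreal (cmod (T n x) powr q * w (e n) powr (1 - q))) \<partial>torus d)"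
  proof (rule nn_integral_mono_AE)
    show "AE x in torus d. ennreal (cmod (f x) powr q) \<le>
        ennreal (L powr (q - 1)) * (\<Sum>n. ennreal (cmod (T n x) powr q * w (e n) powr (1 - q)))"
      using fg AE_sum
    proof eventually_elim
      case (elim x)
      have "ennreal (cmod (g x) powr q) \<le> ennreal (L powr (q - 1)) *
          (\<integral>\<^sup>+n. ennreal ((cmod (T n x) / w (e n)) powr q * w (e n)) \<partial>count_space UNIV)"
      proof (rule powr_nn_integral_le[where w = "\<lambda>n. w (e n)" and g = "\<lambda>n. cmod (T n x) / w (e n)" and L = L])
        show "(\<integral>\<^sup>+n. ennreal (w (e n)) \<partial>count_space UNIV) \<le> ennreal L"
          unfolding nn_integral_count_space_nat
          using wsm wsum less_imp_le[OF w0]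
          by (subst suminf_ennreal2) (auto intro!: ennreal_leI suminf_le_const)
        have "cmod (g x) \<le> (\<Sum>n. cmod (T n x))"
          unfolding g_def by (rule summable_norm[OF elim(2)])
        then have "ennreal (cmod (g x)) \<le> ennreal (\<Sum>n. cmod (T n x))"
          by (rule ennreal_leI)
        also have "\<dots> = (\<Sum>n. ennreal (cmod (T n x)))"
          using elim(2) by (subst suminf_ennreal2) auto
        also have "\<dots> = (\<integral>\<^sup>+n. ennreal (cmod (T n x) / w (e n) * w (e n)) \<partial>count_space UNIV)"
          unfolding nn_integral_count_space_nat using w0 by (intro suminf_cong) (simp add: less_imp_neq[THEN not_sym])
        finally show "ennreal (cmod (g x)) \<le> (\<integral>\<^sup>+n. ennreal (cmod (T n x) / w (e n) * w (e n)) \<partial>count_space UNIV)" .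
      qed (use q L_pos less_imp_le[OF w0] in auto)
      also have "(\<integral>\<^sup>+n. ennreal ((cmod (T n x) / w (e n)) powr q * w (e n)) \<partial>count_space UNIV) =
          (\<Sum>n. ennreal (cmod (T n x) powr q * w (e n) powr (1 - q)))"
        unfolding nn_integral_count_space_nat
        using w0 by (intro suminf_cong arg_cong[of _ _ ennreal]) (simp add: powr_divide powr_diff less_imp_le)
      finally show ?case using elim(1) by simp
    qed
  qed
  also have "\<dots> = ennreal (L powr (q - 1)) * (\<Sum>n. \<integral>\<^sup>+x. ennreal (cmod (T n x) powr q * w (e n) powr (1 - q)) \<partial>torus d)"
    by (subst nn_integral_cmult, measurable, subst nn_integral_suminf, measurable)
  also have "\<dots> \<le> ennreal (L powr (q - 1)) * (\<Sum>n. ennreal (w (e n)))"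
  proof (intro mult_left_mono suminf_le)
    fix n
    have "(\<integral>\<^sup>+x. ennreal (cmod (T n x) powr q * w (e n) powr (1 - q)) \<partial>torus d) =
        (\<integral>\<^sup>+x. ennreal (cmod (T n x) powr q) \<partial>torus d) * ennreal (w (e n) powr (1 - q))"
      by (simp add: ennreal_mult nn_integral_multc)
    also have "(\<integral>\<^sup>+x. ennreal (cmod (T n x) powr q) \<partial>torus d) = ennreal (Lp_real d q (T n) powr q)"
      using q by (intro Lp_norm_eqD Lp_norm_trig_poly[OF T]) auto
    also have "\<dots> * ennreal (w (e n) powr (1 - q)) \<le> ennreal (w (e n) powr q) * ennreal (w (e n) powr (1 - q))"
      using Tw q by (intro mult_right_mono ennreal_leI powr_mono2) auto
    also have "\<dots> = ennreal (w (e n))"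
      using w0[of n] by (simp add: ennreal_mult[symmetric] flip: powr_add)
    finally show "(\<integral>\<^sup>+x. ennreal (cmod (T n x) powr q * w (e n) powr (1 - q)) \<partial>torus d) \<le> ennreal (w (e n))" .
  qed auto
  also have "(\<Sum>n. ennreal (w (e n))) \<noteq> \<infinity>"
    using wsm w0 by (simp add: ennreal_suminf_neq_top less_imp_le)
  then have "ennreal (L powr (q - 1)) * (\<Sum>n. ennreal (w (e n))) < \<infinity>"
    by (simp add: ennreal_mult_eq_top_iff less_top[symmetric])
  finally show ?thesis
    by (auto simp: Lp_norm_def epowr_def)
qed

section \<open>The upper bound\<close>

text \<open>Blocks with different indices are disjoint, so each lies entirely inside or entirely
  outside the cross.\<close>

lemma mem_hyp_cross_iff:
  assumes "k \<in> rho d s" "s \<in> block_indices d"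
  shows "k \<in> hyp_cross d \<gamma> n \<longleftrightarrow> dot d (\<lambda>j. real (s j)) \<gamma> < real n"
proof
  assume "k \<in> hyp_cross d \<gamma> n"
  then obtain s' where s': "s' \<in> block_indices d" "dot d (\<lambda>j. real (s' j)) \<gamma> < real n" "k \<in> rho d s'"
    unfolding hyp_cross_def by blast
  have "s = s'" by (rule rho_unique[OF assms(1) s'(3) assms(2) s'(1)])
  then show "dot d (\<lambda>j. real (s j)) \<gamma> < real n" using s'(2) by simp
next
  assume "dot d (\<lambda>j. real (s j)) \<gamma> < real n"
  then show "k \<in> hyp_cross d \<gamma> n" using assms unfolding hyp_cross_def by blast
qed

lemma hyp_cross_nonzero:
  assumes "k \<in> hyp_cross d \<gamma> n" "j \<in> {1..d}"
  shows "k j \<noteq> 0"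
proof
  assume "k j = 0"
  obtain s where "k \<in> rho d s" using assms(1) unfolding hyp_cross_def by blast
  then have "2 ^ (s j - 1) \<le> \<bar>k j\<bar>" using assms(2) unfolding rho_def by blast
  then show False using \<open>k j = 0\<close> zero_less_power[of "2::int" "s j - 1"] by simp
qed

lemma hyp_cross_subset: "hyp_cross d \<gamma> n \<subseteq> {1..d} \<rightarrow>\<^sub>E UNIV"
  using rho_subset unfolding hyp_cross_def by blast

lemma finite_hyp_cross:
  assumes \<gamma>: "\<And>j. j \<in> {1..d} \<Longrightarrow> 1 \<le> \<gamma> j"
  shows "finite (hyp_cross d \<gamma> n)"
proof -
  have "{s \<in> block_indices d. dot d (\<lambda>j. real (s j)) \<gamma> < real n} \<subseteq> ({1..d} \<rightarrow>\<^sub>E {..n})"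
  proof (rule subsetI)
    fix s assume "s \<in> {s \<in> block_indices d. dot d (\<lambda>j. real (s j)) \<gamma> < real n}"
    then have s: "s \<in> block_indices d" "dot d (\<lambda>j. real (s j)) \<gamma> < real n" by blast+
    have "s j \<le> n" if j: "j \<in> {1..d}" for j
    proof -
      have "real (s j) * 1 \<le> real (s j) * \<gamma> j"
        using \<gamma>[OF j] by (intro mult_left_mono) auto
      also have "\<dots> \<le> dot d (\<lambda>j. real (s j)) \<gamma>"
        unfolding dot_def
      proof (rule member_le_sum[OF j])
        fix i assume "i \<in> {1..d} - {j}"
        then have "1 \<le> \<gamma> i" by (intro \<gamma>) auto
        then show "0 \<le> real (s i) * \<gamma> i" by simp
      qed simp
      finally show ?thesis using s(2) by linarith
    qed
    with s(1) show "s \<in> {1..d} \<rightarrow>\<^sub>E {..n}"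
      unfolding block_indices_def PiE_iff by blast
  qed
  then have "finite {s \<in> block_indices d. dot d (\<lambda>j. real (s j)) \<gamma> < real n}"
    by (rule finite_subset) (simp add: finite_PiE)
  then show ?thesis
    unfolding hyp_cross_def by (intro finite_UN_I) auto
qed

lemma sum_le_infsum_ennreal:
  fixes h :: "'i \<Rightarrow> ennreal"
  assumes "finite F" "F \<subseteq> A"
  shows "(\<Sum>i\<in>F. h i) \<le> infsum h A"
proof -
  have "infsum h F \<le> infsum h A"
    by (rule infsum_mono_neutral) (use assms in \<open>auto simp: nonneg_summable_on_complete\<close>)
  then show ?thesis using assms(1) by simp
qed

lemma infsum_ennreal_le:
  fixes h :: "'i \<Rightarrow> ennreal"
  assumes "\<And>F. finite F \<Longrightarrow> F \<subseteq> A \<Longrightarrow> (\<Sum>i\<in>F. h i) \<le> b"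
  shows "infsum h A \<le> b"
  by (rule infsum_le_finite_sums) (use assms in \<open>auto simp: nonneg_summable_on_complete\<close>)

text \<open>Lets the outer root in \<open>besov_norm\<close> be dropped on the unit ball.\<close>

lemma epowr_le_1_iff:
  assumes "a > 0"
  shows "epowr x a \<le> 1 \<longleftrightarrow> x \<le> 1"
proof (cases x)
  case (real b)
  have "b powr a \<le> 1 \<longleftrightarrow> b \<le> 1"
  proof
    assume "b powr a \<le> 1"
    then show "b \<le> 1" using powr_le_imp_base_le[OF assms, of 1 b] by simp
  next
    assume "b \<le> 1"
    then show "b powr a \<le> 1" using powr_mono2[of a b 1] assms real by simp
  qed
  then show ?thesis using real by (simp add: epowr_def)
qed (simp add: epowr_def)

lemma Lp_real_zero: "q > 0 \<Longrightarrow> Lp_real d q (\<lambda>x. 0) = 0"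
  by (simp add: Lp_real_def Lp_norm_def epowr_def)

section \<open>Parameters of the theorem and the unit ball of the Besov norm\<close>

locale besov_setting =
  fixes d \<nu> :: nat and p q :: real and \<theta> :: ennreal and r \<gamma> :: "nat \<Rightarrow> real"
  assumes d: "d \<ge> 2"
    and p: "1 < p" and pq: "p < q"
    and \<theta>: "1 \<le> \<theta>"
    and \<nu>: "1 \<le> \<nu>" "\<nu> \<le> d"
    and r1: "0 < r 1"
    and r_eq: "\<forall>j\<in>{1..\<nu>}. r j = r 1"
    and r_jump: "\<nu> < d \<longrightarrow> r \<nu> < r (\<nu> + 1)"
    and r_mono: "mono_on {\<nu>+1..d} r"
    and \<gamma>_def: "\<gamma> = (\<lambda>j. r j / r 1)"
    and r1_gt: "r 1 > 1 / p - 1 / q"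
begin

text \<open>\<open>\<beta>\<close> is the loss per unit of |s| when Nikolskii's inequality passes
  from L_p to L_q, and \<open>\<alpha>\<close> is the decay that remains per unit of the
  level.\<close>

definition \<beta> :: real where "\<beta> = 1 / p - 1 / q"
definition \<alpha> :: real where "\<alpha> = r 1 - \<beta>"
definition level :: "(nat \<Rightarrow> nat) \<Rightarrow> real" where "level s = dot d (\<lambda>j. real (s j)) \<gamma>"
text \<open>Meaningful for finite \<open>\<theta>\<close> only; for
  \<open>\<theta> = \<infinity>\<close> the value is 0.\<close>

definition t :: real where "t = enn2real \<theta>"
definition rate :: "nat \<Rightarrow> real" where
  "rate n = 2 powr (- real n * (r 1 - 1 / p + 1 / q)) * real n powr ((real \<nu> - 1) * (1 - enn2real (1 / \<theta>)))"

lemma \<beta>_pos: "\<beta> > 0"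
  using p pq by (simp add: \<beta>_def field_simps)

lemma \<alpha>_pos: "\<alpha> > 0"
  using r1_gt by (simp add: \<alpha>_def \<beta>_def)

lemma \<gamma>_eq_1: "j \<in> {1..\<nu>} \<Longrightarrow> \<gamma> j = 1"
  using bspec[OF r_eq, of j] r1 by (simp add: \<gamma>_def)

lemma \<gamma>_gt_1: "j \<in> {\<nu>+1..d} \<Longrightarrow> 1 < \<gamma> j"
proof -
  assume j: "j \<in> {\<nu>+1..d}"
  then have "r \<nu> < r (\<nu> + 1)" using r_jump by simp
  also have "r (\<nu> + 1) \<le> r j"
    using j by (intro mono_onD[OF r_mono]) auto
  also have "r \<nu> = r 1" by (rule bspec[OF r_eq]) (use \<nu> in simp)
  finally show ?thesis using r1 by (simp add: \<gamma>_def)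
qed

lemma \<gamma>_ge_1: "j \<in> {1..d} \<Longrightarrow> 1 \<le> \<gamma> j"
  using \<gamma>_eq_1[of j] \<gamma>_gt_1[of j] by (cases "j \<le> \<nu>") auto

lemma dot_r: "dot d (\<lambda>j. real (s j)) r = r 1 * level s"
  unfolding level_def dot_def sum_distrib_left using r1 by (intro sum.cong refl) (simp add: \<gamma>_def)

text \<open>Since (s, r) = r 1 * level s and |s| is the level minus the sum of (\<gamma> j - 1) s j,
  the excess of \<gamma> over 1 becomes additional decay. It reduces the coordinates j > \<nu> to
  convergent geometric series.\<close>

lemma exponent_eq:
  "dot d (\<lambda>j. real (s j)) r - \<beta> * real (\<Sum>j\<in>{1..d}. s j) =
     \<alpha> * level s + (\<Sum>j=\<nu>+1..d. \<beta> * (\<gamma> j - 1) * real (s j))"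
proof -
  have "(\<Sum>j=\<nu>+1..d. \<beta> * (\<gamma> j - 1) * real (s j)) = (\<Sum>j=1..d. \<beta> * (\<gamma> j - 1) * real (s j))"
    using \<nu> by (intro sum.mono_neutral_left) (auto simp: \<gamma>_eq_1)
  also have "\<dots> = (\<Sum>j=1..d. \<beta> * (real (s j) * \<gamma> j) - \<beta> * real (s j))"
    by (intro sum.cong refl) (simp add: algebra_simps)
  also have "\<dots> = \<beta> * level s - \<beta> * real (\<Sum>j\<in>{1..d}. s j)"
    by (simp add: level_def dot_def sum_distrib_left sum_subtractf)
  finally show ?thesis
    by (simp add: dot_r \<alpha>_def algebra_simps)
qed

lemma level_ge_1:
  assumes "s \<in> block_indices d"
  shows "1 \<le> level s"
proof -
  have s: "1 \<le> s j" if "j \<in> {1..d}" for j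
    using assms that by (auto simp: block_indices_def PiE_iff)
  have "1 \<le> real (s 1) * \<gamma> 1"
    using s[of 1] d \<gamma>_eq_1[of 1] \<nu> by simp
  also have "\<dots> \<le> level s"
    unfolding level_def dot_def
  proof (rule member_le_sum[of 1 "{1..d}" "\<lambda>j. real (s j) * \<gamma> j"])
    fix i assume "i \<in> {1..d} - {1}"
    then have "1 \<le> \<gamma> i" by (intro \<gamma>_ge_1) auto
    then show "0 \<le> real (s i) * \<gamma> i" by simp
  qed (use d in auto)
  finally show ?thesis .
qed

lemma t_ge_1: "\<theta> \<noteq> \<infinity> \<Longrightarrow> 1 \<le> t"
  using \<theta> enn2real_mono[of 1 \<theta>] by (simp add: t_def less_top)

definition wcoeff :: "((nat \<Rightarrow> real) \<Rightarrow> complex) \<Rightarrow> (nat \<Rightarrow> nat) \<Rightarrow> real" where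
  "wcoeff f s = 2 powr (dot d (\<lambda>j. real (s j)) r) * Lp_real d p (delta d s f)"

lemma wcoeff_nonneg: "0 \<le> wcoeff f s"
  by (simp add: wcoeff_def)

lemma delta_norm: "Lp_norm d p (delta d s f) = ennreal (Lp_real d p (delta d s f))"
  using p by (intro Lp_norm_trig_poly[OF delta_in_trig_polys]) auto

lemma besov_term:
  assumes "\<theta> \<noteq> \<infinity>"
  shows "ennreal (2 powr (dot d (\<lambda>j. real (s j)) r * t)) * epowr (Lp_norm d p (delta d s f)) t =
    ennreal (wcoeff f s powr t)"
  by (simp add: delta_norm epowr_def wcoeff_def powr_mult powr_powr ennreal_mult)

text \<open>Real sums over finite sets of blocks: the form in which the upper bound uses the unit
  ball and the lower bound verifies membership in it.\<close>

lemma besov_norm_le_1_iff: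
  "besov_norm d r p \<theta> f \<le> 1 \<longleftrightarrow>
     (if \<theta> = \<infinity> then \<forall>s\<in>block_indices d. wcoeff f s \<le> 1
      else \<forall>F. finite F \<and> F \<subseteq> block_indices d \<longrightarrow> (\<Sum>s\<in>F. wcoeff f s powr t) \<le> 1)"
proof (cases "\<theta> = \<infinity>")
  case True
  have "ennreal (2 powr dot d (\<lambda>j. real (s j)) r) * Lp_norm d p (delta d s f) = ennreal (wcoeff f s)" for s
    by (simp add: delta_norm wcoeff_def ennreal_mult)
  then show ?thesis
    using True by (simp add: besov_norm_def SUP_le_iff wcoeff_nonneg)
next
  case False
  have t: "1 / t > 0" using t_ge_1[OF False] by simp
  have eq: "(\<Sum>s\<in>F. ennreal (wcoeff f s powr t)) \<le> 1 \<longleftrightarrow> (\<Sum>s\<in>F. wcoeff f s powr t) \<le> 1" for F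
    by (subst sum_ennreal) auto
  have "besov_norm d r p \<theta> f \<le> 1 \<longleftrightarrow> infsum (\<lambda>s. ennreal (wcoeff f s powr t)) (block_indices d) \<le> 1"
    using False epowr_le_1_iff[OF t] besov_term[OF False] by (simp add: besov_norm_def t_def)
  also have "\<dots> \<longleftrightarrow> (\<forall>F. finite F \<and> F \<subseteq> block_indices d \<longrightarrow> (\<Sum>s\<in>F. ennreal (wcoeff f s powr t)) \<le> 1)"
  proof (intro iffI allI impI)
    fix F assume "infsum (\<lambda>s. ennreal (wcoeff f s powr t)) (block_indices d) \<le> 1"
      and "finite F \<and> F \<subseteq> block_indices d"
    then show "(\<Sum>s\<in>F. ennreal (wcoeff f s powr t)) \<le> 1"
      using sum_le_infsum_ennreal[of F "block_indices d"] by (blast intro: order_trans)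
  next
    assume "\<forall>F. finite F \<and> F \<subseteq> block_indices d \<longrightarrow> (\<Sum>s\<in>F. ennreal (wcoeff f s powr t)) \<le> 1"
    then show "infsum (\<lambda>s. ennreal (wcoeff f s powr t)) (block_indices d) \<le> 1"
      by (intro infsum_ennreal_le) blast
  qed
  finally show ?thesis
    using False by (simp add: eq)
qed

lemma wcoeff_le_1:
  assumes "besov_norm d r p \<theta> f \<le> 1" "s \<in> block_indices d"
  shows "wcoeff f s \<le> 1"
proof (cases "\<theta> = \<infinity>")
  case True
  then show ?thesis using assms unfolding besov_norm_le_1_iff if_P[OF True] by blast
next
  case False
  then have "\<forall>F. finite F \<and> F \<subseteq> block_indices d \<longrightarrow> (\<Sum>s\<in>F. wcoeff f s powr t) \<le> 1"
    using assms(1) unfolding besov_norm_le_1_iff by simp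
  from spec[OF this, of "{s}"] have "wcoeff f s powr t \<le> 1 powr t"
    using assms(2) by simp
  then show ?thesis
    using t_ge_1[OF False] by (rule_tac powr_le_imp_base_le[of t 1]) auto
qed

lemma delta_Lq_le:
  "Lp_real d q (delta d s f) \<le>
     30 ^ d * (wcoeff f s * 2 powr (- \<alpha> * level s - (\<Sum>j=\<nu>+1..d. \<beta> * (\<gamma> j - 1) * real (s j))))"
proof -
  have k: "\<bar>k j\<bar> \<le> 2 ^ s j" if "k \<in> rho d s" "j \<in> {1..d}" for k j
    using that unfolding rho_def by (auto intro: less_imp_le)
  have "Lp_real d q (delta d s f) \<le> 30 ^ d * 2 powr (real (\<Sum>j\<in>{1..d}. s j) * (1 / p - 1 / q)) * Lp_real d p (delta d s f)"
    by (rule nikolskii_inequality[OF delta_in_trig_polys finite_rho rho_subset]) (use k p pq in auto)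
  also have "Lp_real d p (delta d s f) = wcoeff f s * 2 powr (- dot d (\<lambda>j. real (s j)) r)"
    by (simp add: wcoeff_def powr_minus)
  also have "30 ^ d * 2 powr (real (\<Sum>j\<in>{1..d}. s j) * (1 / p - 1 / q)) * (wcoeff f s * 2 powr (- dot d (\<lambda>j. real (s j)) r)) =
      30 ^ d * (wcoeff f s * 2 powr (\<beta> * real (\<Sum>j\<in>{1..d}. s j) - dot d (\<lambda>j. real (s j)) r))"
  proof -
    have "2 powr (real (\<Sum>j\<in>{1..d}. s j) * (1 / p - 1 / q)) * 2 powr (- dot d (\<lambda>j. real (s j)) r) =
        2 powr (\<beta> * real (\<Sum>j\<in>{1..d}. s j) - dot d (\<lambda>j. real (s j)) r)"
      unfolding powr_add[symmetric] \<beta>_def by (simp only: mult.commute diff_conv_add_uminus)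
    then show ?thesis by (simp only: mult.commute mult.left_commute)
  qed
  also have "\<beta> * real (\<Sum>j\<in>{1..d}. s j) - dot d (\<lambda>j. real (s j)) r =
      - \<alpha> * level s - (\<Sum>j=\<nu>+1..d. \<beta> * (\<gamma> j - 1) * real (s j))"
    using exponent_eq[of s] by linarith
  finally show ?thesis .
qed

text \<open>\<open>\<tau>\<close> is the conjugate exponent in Hoelder's inequality; \<tau> = 1
  serves \<theta> = \<infinity> and the finiteness in L_q. The power multiplies all decay rates by
  \<tau>, so \<open>hyperbolic_tail_sum\<close> applies.\<close>

lemma decay_sum:
  assumes "\<tau> > 0"
  shows "\<exists>C>0. \<forall>n\<ge>1. \<forall>F. finite F \<and> F \<subseteq> block_indices d \<and> (\<forall>s\<in>F. real n \<le> level s) \<longrightarrow>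
    (\<Sum>s\<in>F. (2 powr (- \<alpha> * level s - (\<Sum>j=\<nu>+1..d. \<beta> * (\<gamma> j - 1) * real (s j)))) powr \<tau>) \<le>
      C * 2 powr (- \<alpha> * \<tau> * real n) * real n powr (real \<nu> - 1)"
proof -
  have "\<exists>C>0. \<forall>n\<ge>1. \<forall>F. finite F \<and> F \<subseteq> block_indices d \<and> (\<forall>s\<in>F. real n \<le> dot d (\<lambda>j. real (s j)) \<gamma>) \<longrightarrow>
    (\<Sum>s\<in>F. 2 powr (- (\<alpha> * \<tau>) * dot d (\<lambda>j. real (s j)) \<gamma> - (\<Sum>j=\<nu>+1..d. (\<beta> * (\<gamma> j - 1) * \<tau>) * real (s j)))) \<le>
      C * 2 powr (- (\<alpha> * \<tau>) * real n) * real n ^ (\<nu> - 1)"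
  proof (rule hyperbolic_tail_sum)
    show "1 \<le> \<nu>" "\<nu> \<le> d" by (rule \<nu>)+
    show "\<alpha> * \<tau> > 0" using \<alpha>_pos assms by simp
    fix j
    show "\<gamma> j = 1" if "j \<in> {1..\<nu>}" using that by (rule \<gamma>_eq_1)
    assume j: "j \<in> {\<nu>+1..d}"
    show "1 \<le> \<gamma> j" using \<gamma>_gt_1[OF j] by simp
    show "\<beta> * (\<gamma> j - 1) * \<tau> > 0" using \<gamma>_gt_1[OF j] \<beta>_pos assms by simp
  qed
  then obtain C where C: "C > 0" and tail: "\<forall>n\<ge>1. \<forall>F. finite F \<and> F \<subseteq> block_indices d \<and> (\<forall>s\<in>F. real n \<le> level s) \<longrightarrow>
    (\<Sum>s\<in>F. 2 powr (- (\<alpha> * \<tau>) * level s - (\<Sum>j=\<nu>+1..d. (\<beta> * (\<gamma> j - 1) * \<tau>) * real (s j)))) \<le>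
      C * 2 powr (- (\<alpha> * \<tau>) * real n) * real n ^ (\<nu> - 1)"
    unfolding level_def[symmetric] by (elim exE conjE) (rule that)
  have eq: "(2 powr (- \<alpha> * level s - (\<Sum>j=\<nu>+1..d. \<beta> * (\<gamma> j - 1) * real (s j)))) powr \<tau> =
      2 powr (- (\<alpha> * \<tau>) * level s - (\<Sum>j=\<nu>+1..d. (\<beta> * (\<gamma> j - 1) * \<tau>) * real (s j)))" for s
    unfolding powr_powr left_diff_distrib sum_distrib_right by (simp add: mult_ac)
  show ?thesis
  proof (intro exI conjI allI impI)
    show "C > 0" by (rule C)
    fix n F assume n: "1 \<le> (n::nat)" and F: "finite F \<and> F \<subseteq> block_indices d \<and> (\<forall>s\<in>F. real n \<le> level s)"
    have "real n ^ (\<nu> - 1) = real n powr (real \<nu> - 1)"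
      using n \<nu> by (simp add: powr_realpow[symmetric] of_nat_diff)
    moreover have "- (\<alpha> * \<tau>) * real n = - \<alpha> * \<tau> * real n" by simp
    ultimately show "(\<Sum>s\<in>F. (2 powr (- \<alpha> * level s - (\<Sum>j=\<nu>+1..d. \<beta> * (\<gamma> j - 1) * real (s j)))) powr \<tau>) \<le>
        C * 2 powr (- \<alpha> * \<tau> * real n) * real n powr (real \<nu> - 1)"
      using tail[rule_format, OF n F] by (simp only: eq)
  qed
qed

lemma tail_bound:
  "\<exists>C>0. \<forall>n\<ge>1. \<forall>f. besov_norm d r p \<theta> f \<le> 1 \<longrightarrow>
     (\<forall>F. finite F \<and> F \<subseteq> block_indices d \<and> (\<forall>s\<in>F. real n \<le> level s) \<longrightarrow>
       (\<Sum>s\<in>F. Lp_real d q (delta d s f)) \<le> C * rate n)"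
proof -
  define E where "E s = 2 powr (- \<alpha> * level s - (\<Sum>j=\<nu>+1..d. \<beta> * (\<gamma> j - 1) * real (s j)))" for s
  have E: "E s > 0" for s by (simp add: E_def)
  have \<alpha>_eq: "r 1 - 1 / p + 1 / q = \<alpha>" by (simp add: \<alpha>_def \<beta>_def)
  have le: "(\<Sum>s\<in>F. Lp_real d q (delta d s f)) \<le> 30 ^ d * (\<Sum>s\<in>F. wcoeff f s * E s)" for f F
    unfolding sum_distrib_left E_def by (intro sum_mono delta_Lq_le)
  have "\<exists>C>0. \<forall>n\<ge>1. \<forall>f. besov_norm d r p \<theta> f \<le> 1 \<longrightarrow>
     (\<forall>F. finite F \<and> F \<subseteq> block_indices d \<and> (\<forall>s\<in>F. real n \<le> level s) \<longrightarrow>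
       (\<Sum>s\<in>F. wcoeff f s * E s) \<le> C * rate n)"
  proof -
    \<comment> \<open>The conjugate exponent t / (t - 1) requires finite t > 1. At the endpoints one
      factor is bounded by its supremum: \<open>wcoeff\<close> for \<theta> = \<infinity>,
      \<open>E\<close> for \<theta> = 1.\<close>
    consider "\<theta> = \<infinity>" | "\<theta> \<noteq> \<infinity>" "t = 1" | "\<theta> \<noteq> \<infinity>" "1 < t"
      using t_ge_1 by fastforce
    then show ?thesis
    proof cases
      case 1
      obtain C where C: "C > 0" "\<And>n F. 1 \<le> n \<Longrightarrow> finite F \<Longrightarrow> F \<subseteq> block_indices d \<Longrightarrow> \<forall>s\<in>F. real n \<le> level s \<Longrightarrow>
          (\<Sum>s\<in>F. E s powr 1) \<le> C * 2 powr (- \<alpha> * 1 * real n) * real n powr (real \<nu> - 1)"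
        using decay_sum[of 1] unfolding E_def by auto
      have "(\<Sum>s\<in>F. wcoeff f s * E s) \<le> C * rate n"
        if *: "1 \<le> n" "besov_norm d r p \<theta> f \<le> 1" "finite F" "F \<subseteq> block_indices d" "\<forall>s\<in>F. real n \<le> level s" for n f F
      proof -
        have "(\<Sum>s\<in>F. wcoeff f s * E s) \<le> (\<Sum>s\<in>F. E s powr 1)"
        proof (rule sum_mono)
          fix s assume "s \<in> F"
          then have "wcoeff f s \<le> 1" using * by (intro wcoeff_le_1) auto
          then show "wcoeff f s * E s \<le> E s powr 1"
            using E[of s] mult_right_mono[of "wcoeff f s" 1 "E s"] by simp
        qed
        also have "\<dots> \<le> C * 2 powr (- \<alpha> * 1 * real n) * real n powr (real \<nu> - 1)"
          using * by (intro C)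
        finally show ?thesis
          unfolding rate_def unfolding \<alpha>_eq 1 by (simp add: mult_ac)
      qed
      with C(1) show ?thesis by blast
    next
      case 2
      then have \<theta>1: "\<theta> = 1"
        by (metis ennreal_1 ennreal_enn2real infinity_ennreal_def less_top t_def)
      have "(\<Sum>s\<in>F. wcoeff f s * E s) \<le> 1 * rate n"
        if *: "1 \<le> n" "besov_norm d r p \<theta> f \<le> 1" "finite F" "F \<subseteq> block_indices d" "\<forall>s\<in>F. real n \<le> level s" for n f F
      proof -
        have "(\<Sum>s\<in>F. wcoeff f s * E s) \<le> (\<Sum>s\<in>F. wcoeff f s powr t * 2 powr (- \<alpha> * real n))"
        proof (rule sum_mono)
          fix s assume s: "s \<in> F"
          have "0 \<le> (\<Sum>j=\<nu>+1..d. \<beta> * (\<gamma> j - 1) * real (s j))"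
            using \<beta>_pos \<gamma>_gt_1 by (intro sum_nonneg mult_nonneg_nonneg) (auto simp: less_imp_le)
          moreover have "\<alpha> * real n \<le> \<alpha> * level s"
            using * s \<alpha>_pos by (intro mult_left_mono) auto
          ultimately have "E s \<le> 2 powr (- \<alpha> * real n)"
            unfolding E_def by (intro powr_mono) auto
          then show "wcoeff f s * E s \<le> wcoeff f s powr t * 2 powr (- \<alpha> * real n)"
            using wcoeff_nonneg[of f s] 2 by (simp add: mult_left_mono)
        qed
        also have "\<dots> = (\<Sum>s\<in>F. wcoeff f s powr t) * 2 powr (- \<alpha> * real n)"
          by (simp add: sum_distrib_right)
        also have "\<dots> \<le> 1 * 2 powr (- \<alpha> * real n)"
          using * 2 by (intro mult_right_mono) (auto simp: besov_norm_le_1_iff)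
        \<comment> \<open>For \<theta> = 1 the exponent of n in \<open>rate\<close> is 0, and n powr
          0 = 1 because n >= 1.\<close>
        finally show ?thesis
          using *(1) unfolding rate_def unfolding \<alpha>_eq \<theta>1 by (simp add: mult_ac)
      qed
      then show ?thesis by (intro exI[of _ 1]) auto
    next
      case 3
      define t' where "t' = t / (t - 1)"
      have t': "t' > 0" "1 / t + 1 / t' = 1" "1 / t' = 1 - 1 / t"
        using 3 by (auto simp: t'_def field_simps)
      obtain C where C: "C > 0" "\<And>n F. 1 \<le> n \<Longrightarrow> finite F \<Longrightarrow> F \<subseteq> block_indices d \<Longrightarrow> \<forall>s\<in>F. real n \<le> level s \<Longrightarrow>
          (\<Sum>s\<in>F. E s powr t') \<le> C * 2 powr (- \<alpha> * t' * real n) * real n powr (real \<nu> - 1)"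
        using decay_sum[OF t'(1)] unfolding E_def by auto
      have inv: "enn2real (1 / \<theta>) = 1 / t"
      proof -
        have "\<theta> = ennreal t" using 3 by (simp add: t_def less_top)
        then have "1 / \<theta> = ennreal (1 / t)"
          using 3 divide_ennreal[of 1 t] by simp
        then show ?thesis using 3 by simp
      qed
      have "(\<Sum>s\<in>F. wcoeff f s * E s) \<le> C powr (1 / t') * rate n"
        if *: "1 \<le> n" "besov_norm d r p \<theta> f \<le> 1" "finite F" "F \<subseteq> block_indices d" "\<forall>s\<in>F. real n \<le> level s" for n f F
      proof -
        have "(\<Sum>s\<in>F. wcoeff f s * E s) \<le> (C * 2 powr (- \<alpha> * t' * real n) * real n powr (real \<nu> - 1)) powr (1 / t')"
        proof (rule sum_mult_le_holder[OF 3(2) t'(2)])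
          show "(\<Sum>s\<in>F. wcoeff f s powr t) \<le> 1"
            using * 3 by (simp add: besov_norm_le_1_iff)
          show "(\<Sum>s\<in>F. E s powr t') \<le> C * 2 powr (- \<alpha> * t' * real n) * real n powr (real \<nu> - 1)"
            using * by (intro C)
        qed (use wcoeff_nonneg E C(1) *(1) in \<open>auto simp: less_imp_le\<close>)
        also have "\<dots> = C powr (1 / t') * rate n"
        proof -
          have "- \<alpha> * t' * real n * (1 / t') = - real n * \<alpha>"
            using t'(1) by simp
          then show ?thesis
            using C(1) by (simp only: powr_mult powr_powr rate_def \<alpha>_eq inv t'(3)[symmetric] mult.assoc)
        qed
        finally show ?thesis .
      qed
      moreover have "C powr (1 / t') > 0" using C(1) by simp
      ultimately show ?thesis by blast
    qed
  qed
  then obtain C where C: "C > 0" "\<And>n f F. 1 \<le> n \<Longrightarrow> besov_norm d r p \<theta> f \<le> 1 \<Longrightarrow> finite F \<Longrightarrow> F \<subseteq> block_indices d \<Longrightarrow>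
      \<forall>s\<in>F. real n \<le> level s \<Longrightarrow> (\<Sum>s\<in>F. wcoeff f s * E s) \<le> C * rate n"
    by auto
  have "(\<Sum>s\<in>F. Lp_real d q (delta d s f)) \<le> (30 ^ d * C) * rate n"
    if "1 \<le> n" "besov_norm d r p \<theta> f \<le> 1" "finite F" "F \<subseteq> block_indices d" "\<forall>s\<in>F. real n \<le> level s" for n f F
  proof -
    have "(\<Sum>s\<in>F. Lp_real d q (delta d s f)) \<le> 30 ^ d * (\<Sum>s\<in>F. wcoeff f s * E s)" by (rule le)
    also have "\<dots> \<le> 30 ^ d * (C * rate n)"
      using that by (intro mult_left_mono C) auto
    finally show ?thesis by (simp add: mult.assoc)
  qed
  with C(1) show ?thesis
    by (intro exI[of _ "30 ^ d * C"]) auto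
qed

text \<open>Every level is at least 1, so \<open>decay_sum\<close> with n = 1 covers all
  blocks.\<close>

lemma besov_class_Lq_finite:
  assumes "f \<in> besov_class d r p \<theta>"
  shows "Lp_norm d q f < \<infinity>"
proof -
  have f: "f \<in> Lp0 d p" "besov_norm d r p \<theta> f \<le> 1"
    using assms unfolding besov_class_def by blast+
  define w where "w s = 30 ^ d * 2 powr (- \<alpha> * level s - (\<Sum>j=\<nu>+1..d. \<beta> * (\<gamma> j - 1) * real (s j)))" for s
  obtain C where C: "C > 0" "\<And>F. finite F \<Longrightarrow> F \<subseteq> block_indices d \<Longrightarrow>
      (\<Sum>s\<in>F. (2 powr (- \<alpha> * level s - (\<Sum>j=\<nu>+1..d. \<beta> * (\<gamma> j - 1) * real (s j)))) powr 1) \<le> C * 2 powr (- \<alpha> * 1 * 1) * 1 powr (real \<nu> - 1)"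
  proof -
    obtain C where C: "C > 0" "\<forall>n\<ge>1. \<forall>F. finite F \<and> F \<subseteq> block_indices d \<and> (\<forall>s\<in>F. real n \<le> level s) \<longrightarrow>
      (\<Sum>s\<in>F. (2 powr (- \<alpha> * level s - (\<Sum>j=\<nu>+1..d. \<beta> * (\<gamma> j - 1) * real (s j)))) powr 1) \<le>
        C * 2 powr (- \<alpha> * 1 * real n) * real n powr (real \<nu> - 1)"
      using decay_sum[of 1] by auto
    show ?thesis
      using C(1) spec[OF C(2), of 1] level_ge_1 by (intro that[of C]) auto
  qed
  show ?thesis
  proof (rule Lp_norm_finite_of_blocks[OF f(1)])
    show "1 \<le> p" "1 \<le> q" "1 \<le> d" using p pq d by auto
    show "0 < w s" for s by (simp add: w_def)
    show "Lp_real d q (delta d s f) \<le> w s" if "s \<in> block_indices d" for s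
    proof -
      have "wcoeff f s * 2 powr (- \<alpha> * level s - (\<Sum>j=\<nu>+1..d. \<beta> * (\<gamma> j - 1) * real (s j))) \<le>
          1 * 2 powr (- \<alpha> * level s - (\<Sum>j=\<nu>+1..d. \<beta> * (\<gamma> j - 1) * real (s j)))"
        by (intro mult_right_mono wcoeff_le_1[OF f(2) that]) auto
      then show ?thesis
        unfolding w_def by (intro order_trans[OF delta_Lq_le] mult_left_mono) auto
    qed
    fix F assume "finite F" "F \<subseteq> block_indices d"
    from C(2)[OF this] show "(\<Sum>s\<in>F. w s) \<le> 30 ^ d * (C * 2 powr (- \<alpha>))"
      unfolding w_def sum_distrib_left[symmetric] by (intro mult_left_mono) auto
  qed
qed

text \<open>The constant 24 ^ d consists of 6 ^ d from the kernel of \<open>A_op\<close>, 2 ^ d from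
  \<open>Lp_norm_sum_le\<close> over the corners, and 2 ^ d from the number of corners.\<close>

lemma upper_bound:
  "\<exists>C>0. \<forall>n\<ge>1. fourier_approx d (hyp_cross d \<gamma> n) (besov_class d r p \<theta>) (Bq1_norm d q) \<le> ennreal (C * rate n)"
proof -
  obtain C where C: "C > 0" "\<And>n f F. 1 \<le> n \<Longrightarrow> besov_norm d r p \<theta> f \<le> 1 \<Longrightarrow> finite F \<Longrightarrow> F \<subseteq> block_indices d \<Longrightarrow>
      \<forall>s\<in>F. real n \<le> level s \<Longrightarrow> (\<Sum>s\<in>F. Lp_real d q (delta d s f)) \<le> C * rate n"
    using tail_bound by auto
  have q: "1 \<le> q" "q > 0" using p pq by auto
  have "Bq1_norm d q (\<lambda>x. f x - fourier_sum d (hyp_cross d \<gamma> n) f x) \<le> ennreal (24 ^ d * C * rate n)"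
    if n: "n \<ge> 1" and fB: "f \<in> besov_class d r p \<theta>" for n f
  proof -
    have f: "f \<in> Lp0 d p" "besov_norm d r p \<theta> f \<le> 1"
      using fB unfolding besov_class_def by blast+
    have fi: "integrable (torus d) f"
      using f(1) p by (intro Lp0_integrable) auto
    define Q where "Q = hyp_cross d \<gamma> n"
    have Q: "finite Q" "Q \<subseteq> {1..d} \<rightarrow>\<^sub>E UNIV"
      unfolding Q_def by (rule finite_hyp_cross[OF \<gamma>_ge_1], assumption) (rule hyp_cross_subset)
    define S where "S = fourier_sum d Q f"
    have S: "S \<in> trig_polys d Q" unfolding S_def by (rule fourier_sum_in_trig_polys)
    define h where "h x = f x - S x" for x
    have hi: "integrable (torus d) h"
      unfolding h_def[abs_def] by (intro Bochner_Integration.integrable_diff fi trig_poly_integrable[OF S])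
    \<comment> \<open>\<open>Bq1_norm\<close> is infinite outside L_q^0, so membership of the error
      has to be secured first.\<close>
    have fin: "Lp_norm d q h < \<infinity>"
    proof -
      define T where "T i = (if i = (0::nat) then f else (\<lambda>x. (- 1) * S x))" for i
      have T1: "T 1 \<in> trig_polys d Q" unfolding T_def using S by (simp only: if_False one_neq_zero trig_polys_scale)
      have "Lp_norm d q (T i) \<le> ennreal (Lp_real d q (T i))" if "i \<in> {0, 1}" for i
      proof (cases "i = 0")
        case True
        then show ?thesis using besov_class_Lq_finite[OF fB] by (simp add: T_def Lp_real_def)
      next
        case False
        then show ?thesis using that Lp_norm_trig_poly[OF T1 q(2)] by auto
      qed
      moreover have "T i \<in> borel_measurable (torus d)" if "i \<in> {0, 1}" for i
        using that borel_measurable_integrable[OF fi] trig_poly_measurable[OF T1] by (auto simp: T_def)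
      ultimately have "Lp_norm d q (\<lambda>x. \<Sum>i\<in>{0, 1}. T i x) \<le> ennreal (real (card {0::nat, 1}) * (\<Sum>i\<in>{0, 1}. Lp_real d q (T i)))"
        by (intro Lp_norm_sum_le q) auto
      moreover have "(\<lambda>x. \<Sum>i\<in>{0, 1}. T i x) = h" by (simp add: fun_eq_iff T_def h_def)
      ultimately have "Lp_norm d q h \<le> ennreal (real (card {0::nat, 1}) * (\<Sum>i\<in>{0, 1}. Lp_real d q (T i)))" by simp
      then show ?thesis by (rule le_less_trans) simp
    qed
    have h0: "h \<in> Lp0 d q"
      unfolding h_def[abs_def] by (rule Lp0_diff_trig_poly[OF f(1) S])
        (use hyp_cross_nonzero fin in \<open>auto simp: Q_def h_def[abs_def] simp del: atLeastAtMost_iff\<close>)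
    have delta_h: "delta d s h = (if level s < real n then (\<lambda>x. 0) else delta d s f)" if s: "s \<in> block_indices d" for s
    proof -
      have "fourier_coeff d h k = (if level s < real n then 0 else fourier_coeff d f k)" if k: "k \<in> rho d s" for k
      proof -
        have k': "k \<in> {1..d} \<rightarrow>\<^sub>E UNIV" using k rho_subset by blast
        have "fourier_coeff d h k = fourier_coeff d f k - fourier_coeff d S k"
          unfolding h_def[abs_def] by (rule fourier_coeff_diff[OF fi trig_poly_integrable[OF S]])
        also have "fourier_coeff d S k = (if k \<in> Q then fourier_coeff d f k else 0)"
          unfolding S_def fourier_sum_def by (rule fourier_coeff_trig_poly[OF Q(2,1) k'])
        finally show ?thesis
          using mem_hyp_cross_iff[OF k s, of \<gamma> n] by (simp add: Q_def level_def)
      qed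
      then show ?thesis
        by (simp add: delta_def fourier_sum_def fun_eq_iff)
    qed
    have A: "Lp_norm d q (A_op d s h) \<le> ennreal (\<Sum>e\<in>corners d. 12 ^ d * Lp_real d q (delta d (shift_index d s e) h))"
      if s: "s \<in> block_indices d" for s
    proof -
      let ?T = "\<lambda>e. A_op d s (delta d (shift_index d s e) h)"
      have Ti: "integrable (torus d) (delta d (shift_index d s e) h)" for e
        by (rule trig_poly_integrable[OF delta_in_trig_polys])
      have eq: "A_op d s h = (\<lambda>x. \<Sum>e\<in>corners d. ?T e x)"
        by (rule ext) (rule A_op_decompose[OF hi s])
      have "Lp_norm d q (\<lambda>x. \<Sum>e\<in>corners d. ?T e x) \<le> ennreal (real (card (corners d)) * (\<Sum>e\<in>corners d. 6 ^ d * Lp_real d q (delta d (shift_index d s e) h)))"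
      proof (rule Lp_norm_sum_le)
        fix e
        show "?T e \<in> borel_measurable (torus d)"
          by (rule trig_poly_measurable[OF A_op_in_trig_polys[OF Ti s]])
        have "Lp_norm d q (?T e) \<le> ennreal (6 ^ d) * Lp_norm d q (delta d (shift_index d s e) h)"
          by (rule Lp_norm_A_op_le[OF Ti q(1) s])
        also have "\<dots> = ennreal (6 ^ d * Lp_real d q (delta d (shift_index d s e) h))"
          by (simp add: Lp_norm_trig_poly[OF delta_in_trig_polys q(2)] ennreal_mult)
        finally show "Lp_norm d q (?T e) \<le> ennreal (6 ^ d * Lp_real d q (delta d (shift_index d s e) h))" .
      qed (use q in auto)
      also have "real (card (corners d)) * (\<Sum>e\<in>corners d. 6 ^ d * Lp_real d q (delta d (shift_index d s e) h)) =
          (\<Sum>e\<in>corners d. 12 ^ d * Lp_real d q (delta d (shift_index d s e) h))"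
        by (simp add: card_corners sum_distrib_left mult.assoc[symmetric] flip: power_mult_distrib)
      finally show ?thesis unfolding eq .
    qed
    have "Bq1_norm d q h = infsum (\<lambda>s. Lp_norm d q (A_op d s h)) (block_indices d)"
      using h0 by (simp add: Bq1_norm_def)
    also have "\<dots> \<le> ennreal (24 ^ d * C * rate n)"
    proof (rule infsum_ennreal_le)
      fix F assume F: "finite F" "F \<subseteq> block_indices d"
      have "(\<Sum>s\<in>F. Lp_norm d q (A_op d s h)) \<le> (\<Sum>s\<in>F. ennreal (\<Sum>e\<in>corners d. 12 ^ d * Lp_real d q (delta d (shift_index d s e) h)))"
        using F by (intro sum_mono A) auto
      also have "\<dots> = ennreal (\<Sum>s\<in>F. \<Sum>e\<in>corners d. 12 ^ d * Lp_real d q (delta d (shift_index d s e) h))"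
        by (intro sum_ennreal sum_nonneg) auto
      also have "(\<Sum>s\<in>F. \<Sum>e\<in>corners d. 12 ^ d * Lp_real d q (delta d (shift_index d s e) h)) =
          (\<Sum>e\<in>corners d. 12 ^ d * (\<Sum>s\<in>F. Lp_real d q (delta d (shift_index d s e) h)))"
        unfolding sum_distrib_left by (rule sum.swap)
      also have "\<dots> \<le> (\<Sum>e\<in>corners d. 12 ^ d * (C * rate n))"
      proof (intro sum_mono mult_left_mono)
        fix e assume e: "e \<in> corners d"
        \<comment> \<open>For a fixed corner the shift is injective, so the sum runs over distinct
          blocks of \<open>h\<close>; those inside the cross vanish.\<close>
        let ?F = "(\<lambda>s. shift_index d s e) ` F"
        have F': "finite ?F" "?F \<subseteq> block_indices d" using F shift_index_in by auto
        have "(\<Sum>s\<in>F. Lp_real d q (delta d (shift_index d s e) h)) = (\<Sum>s\<in>?F. Lp_real d q (delta d s h))"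
          by (subst sum.reindex[OF inj_on_subset[OF inj_shift_index[OF e] F(2)]]) simp
        also have "\<dots> = (\<Sum>s\<in>{s\<in>?F. real n \<le> level s}. Lp_real d q (delta d s f))"
          using F' by (intro sum.mono_neutral_cong_right) (auto simp: delta_h Lp_real_zero q subset_iff)
        also have "\<dots> \<le> C * rate n"
          using F' by (intro C(2)[OF n f(2)]) auto
        finally show "(\<Sum>s\<in>F. Lp_real d q (delta d (shift_index d s e) h)) \<le> C * rate n" .
      qed auto
      also have "\<dots> = 24 ^ d * C * rate n"
        by (simp add: card_corners mult.assoc[symmetric] flip: power_mult_distrib)
      finally show "(\<Sum>s\<in>F. Lp_norm d q (A_op d s h)) \<le> ennreal (24 ^ d * C * rate n)"
        by (simp add: ennreal_leI)
    qed
    finally show ?thesis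
      unfolding h_def[abs_def] S_def Q_def .
  qed
  then show ?thesis
    using C(1) unfolding fourier_approx_def by (intro exI[of _ "24 ^ d * C"]) (auto intro!: SUP_least)
qed

lemma best_approx_le_fourier_approx:
  "best_approx d Q F N \<le> fourier_approx d Q F N"
  unfolding best_approx_def fourier_approx_def
proof (rule SUP_mono')
  fix f
  show "(INF t\<in>trig_polys d Q. N (\<lambda>x. f x - t x)) \<le> N (\<lambda>x. f x - fourier_sum d Q f x)"
    by (rule INF_lower[OF fourier_sum_in_trig_polys[of d Q f], of "\<lambda>t. N (\<lambda>x. f x - t x)"])
qed

end

section \<open>The lower bound\<close>

text \<open>With N = 2 ^ (l - 2) and l >= 2, the positive half of the dyadic range is [2N, 4N).
  Modulation by its midpoint 3N moves the frequencies of the Fejer kernel of order N, which lie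
  strictly between -N and N, into it.\<close>

definition bump :: "nat \<Rightarrow> real \<Rightarrow> complex" where
  "bump l u = cis (of_int (3 * 2 ^ (l - 2)) * u) * complex_of_real (fejer (2 ^ (l - 2)) u)"

definition bumps :: "nat \<Rightarrow> (nat \<Rightarrow> nat) \<Rightarrow> (nat \<Rightarrow> real) \<Rightarrow> complex" where
  "bumps d s x = (\<Prod>j\<in>{1..d}. bump (s j) (x j))"

text \<open>The pairs of \<open>fejer_cis\<close> in each variable; different pairs may yield the
  same frequency.\<close>

definition bump_index :: "nat \<Rightarrow> (nat \<Rightarrow> nat) \<Rightarrow> (nat \<Rightarrow> nat \<times> nat) set" where
  "bump_index d s = (\<Pi>\<^sub>E j\<in>{1..d}. {..<2 ^ (s j - 2)} \<times> {..<2 ^ (s j - 2)})"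

definition bump_freq :: "nat \<Rightarrow> (nat \<Rightarrow> nat) \<Rightarrow> (nat \<Rightarrow> nat \<times> nat) \<Rightarrow> nat \<Rightarrow> int" where
  "bump_freq d s h = (\<lambda>j\<in>{1..d}. 3 * 2 ^ (s j - 2) + int (fst (h j)) - int (snd (h j)))"

lemma bumps_eq:
  "bumps d s x = (\<Sum>h\<in>bump_index d s. (\<Prod>j\<in>{1..d}. 1 / of_nat (2 ^ (s j - 2))) * character d (bump_freq d s h) x)"
proof -
  have "bump l u = (\<Sum>ab\<in>{..<2 ^ (l - 2)} \<times> {..<2 ^ (l - 2)}.
      1 / of_nat (2 ^ (l - 2)) * cis (of_int (3 * 2 ^ (l - 2) + int (fst ab) - int (snd ab)) * u))" for l u
    unfolding bump_def fejer_cis sum_divide_distrib sum_distrib_left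
    by (intro sum.cong refl) (auto simp: cis_mult algebra_simps)
  then have "bumps d s x = (\<Prod>j\<in>{1..d}. \<Sum>ab\<in>{..<2 ^ (s j - 2)} \<times> {..<2 ^ (s j - 2)}.
      1 / of_nat (2 ^ (s j - 2)) * cis (of_int (3 * 2 ^ (s j - 2) + int (fst ab) - int (snd ab)) * x j))"
    by (simp only: bumps_def)
  also have "\<dots> = (\<Sum>h\<in>bump_index d s. \<Prod>j\<in>{1..d}.
      1 / of_nat (2 ^ (s j - 2)) * cis (of_int (3 * 2 ^ (s j - 2) + int (fst (h j)) - int (snd (h j))) * x j))"
    unfolding bump_index_def by (rule prod_sum_PiE) auto
  also have "\<dots> = (\<Sum>h\<in>bump_index d s. (\<Prod>j\<in>{1..d}. 1 / of_nat (2 ^ (s j - 2))) * character d (bump_freq d s h) x)"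
    unfolding character_prod prod.distrib[symmetric]
    by (intro sum.cong prod.cong refl) (simp add: bump_freq_def)
  finally show ?thesis .
qed

lemma bump_freq_in_rho:
  assumes s: "\<And>j. j \<in> {1..d} \<Longrightarrow> 2 \<le> s j" and h: "h \<in> bump_index d s"
  shows "bump_freq d s h \<in> rho d s"
proof -
  have "2 ^ (s j - 1) \<le> \<bar>bump_freq d s h j\<bar> \<and> \<bar>bump_freq d s h j\<bar> < 2 ^ s j" if j: "j \<in> {1..d}" for j
  proof -
    define m where "m = s j - 2"
    have m: "s j = m + 2" using s[OF j] by (simp add: m_def)
    have "h j \<in> {..<2 ^ m} \<times> {..<2 ^ m}"
      using h j unfolding bump_index_def m_def by (rule PiE_mem)
    then have "fst (h j) < 2 ^ m" "snd (h j) < 2 ^ m" by (auto simp: mem_Times_iff)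
    define M :: int where "M = 2 ^ m"
    have less: "int (fst (h j)) < M" "int (snd (h j)) < M"
      using \<open>fst (h j) < 2 ^ m\<close> \<open>snd (h j) < 2 ^ m\<close> by (simp_all add: M_def)
    have freq: "bump_freq d s h j = 3 * M + int (fst (h j)) - int (snd (h j))"
      using j by (simp add: bump_freq_def m_def M_def)
    have pow: "(2::int) ^ (s j - 1) = 2 * M" "(2::int) ^ s j = 4 * M"
      by (simp_all add: m M_def)
    show ?thesis
      unfolding freq pow using less by arith
  qed
  moreover have "bump_freq d s h \<in> {1..d} \<rightarrow>\<^sub>E UNIV"
    unfolding bump_freq_def by (rule restrict_PiE_iff[THEN iffD2]) simp
  ultimately show ?thesis unfolding rho_def by blast
qed

lemma bumps_in_trig_polys:
  assumes "\<And>j. j \<in> {1..d} \<Longrightarrow> 2 \<le> s j"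
  shows "bumps d s \<in> trig_polys d (rho d s)"
  unfolding bumps_eq[abs_def]
  by (intro trig_polys_sum trig_polys_scale trig_polys_character finite_rho bump_freq_in_rho assms)

text \<open>On the bump the ramp equals 1/2 + (a - b) / (2N). The antisymmetric part cancels over
  all pairs, leaving N * N / 2 before the division by N.\<close>

lemma sum_a_coeff_bump:
  assumes "2 \<le> l"
  shows "(\<Sum>ab\<in>{..<2 ^ (l - 2)} \<times> {..<2 ^ (l - 2)}. a_coeff l (3 * 2 ^ (l - 2) + int (fst ab) - int (snd ab))) / real (2 ^ (l - 2)) =
    2 ^ (l - 2) / 2"
proof -
  obtain m where m: "l = m + 2" using le_Suc_ex[OF assms] by auto
  define N :: nat where "N = 2 ^ m"
  have "N > 0" by (simp add: N_def)
  have l: "(2::real) ^ (l - 1) = 2 * real N" "(2::int) ^ (l - 1) = 2 * int N" "(2::int) ^ l = 4 * int N"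
    by (simp_all add: m N_def)
  have "a_coeff l (3 * int N + int a - int b) = 1 / 2 + (real a - real b) / (2 * real N)" if "a < N" "b < N" for a b
  proof -
    have "2 ^ (l - 1) \<le> \<bar>3 * int N + int a - int b\<bar>" "\<bar>3 * int N + int a - int b\<bar> \<le> 2 ^ l"
      unfolding l using that by arith+
    then have "a_coeff l (3 * int N + int a - int b) = real_of_int \<bar>3 * int N + int a - int b\<bar> / 2 ^ (l - 1) - 1"
      by (rule a_coeff_ramp[OF assms])
    also have "real_of_int \<bar>3 * int N + int a - int b\<bar> = 3 * real N + real a - real b"
      using that by simp
    also have "(3 * real N + real a - real b) / 2 ^ (l - 1) - 1 = 1 / 2 + (real a - real b) / (2 * real N)"
      unfolding l(1) using \<open>N > 0\<close> by (simp add: field_simps)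
    finally show ?thesis .
  qed
  then have "(\<Sum>ab\<in>{..<N} \<times> {..<N}. a_coeff l (3 * int N + int (fst ab) - int (snd ab))) =
      (\<Sum>ab\<in>{..<N} \<times> {..<N}. 1 / 2 + (real (fst ab) - real (snd ab)) / (2 * real N))"
    by (intro sum.cong) (simp_all add: mem_Times_iff)
  also have "\<dots> = (\<Sum>a<N. \<Sum>b<N. 1 / 2 + (real a - real b) / (2 * real N))"
    unfolding sum.cartesian_product by (intro sum.cong) auto
  also have "\<dots> = real N * real N / 2 + ((\<Sum>a<N. \<Sum>b<N. real a) - (\<Sum>a<N. \<Sum>b<N. real b)) / (2 * real N)"
    by (simp add: sum.distrib sum_subtractf flip: sum_divide_distrib)
  also have "(\<Sum>a<N. \<Sum>b<N. real a) = (\<Sum>a<N. \<Sum>b<N. real b)"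
    by (rule sum.swap)
  finally have "(\<Sum>ab\<in>{..<N} \<times> {..<N}. a_coeff l (3 * int N + int (fst ab) - int (snd ab))) / real N = real N / 2"
    using \<open>N > 0\<close> by simp
  then show ?thesis
    by (simp add: m N_def)
qed

text \<open>At the origin all characters are 1, so the value is the sum of the coefficients times
  the multiplier, which factors over the coordinates.\<close>

lemma A_op_bumps_at_0:
  assumes s: "s \<in> block_indices d" and s2: "\<And>j. j \<in> {1..d} \<Longrightarrow> 2 \<le> s j"
  shows "A_op d s (bumps d s) (\<lambda>j\<in>{1..d}. 0) = complex_of_real (\<Prod>j\<in>{1..d}. 2 ^ (s j - 2) / 2)"
proof -
  let ?x = "\<lambda>j\<in>{1..d}. 0 :: real"
  have char1: "character d k ?x = 1" for k
    by (simp add: character_prod)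
  define c where "c = (\<Prod>j\<in>{1..d}. 1 / of_nat (2 ^ (s j - 2)) :: complex)"
  let ?a = "\<lambda>k. complex_of_real (\<Prod>j\<in>{1..d}. a_coeff (s j) (k j))"
  have sub: "bump_freq d s h \<in> wide_block d s" if "h \<in> bump_index d s" for h
  proof -
    have "k \<in> wide_block d s" if "k \<in> rho d s" for k
    proof -
      have "(2::int) ^ s j \<le> 2 ^ (s j + 1)" for j by simp
      then show ?thesis
        using that unfolding rho_eq wide_block_def PiE_iff by (auto intro: less_le_trans)
    qed
    then show ?thesis using bump_freq_in_rho[OF s2 that] by blast
  qed
  have fin: "finite (bump_index d s)" unfolding bump_index_def by (intro finite_PiE) auto
  have coeff: "fourier_coeff d (bumps d s) k = (\<Sum>h\<in>bump_index d s. c * (if k = bump_freq d s h then 1 else 0))"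
    if k: "k \<in> wide_block d s" for k
  proof -
    have "fourier_coeff d (bumps d s) k = (\<Sum>h\<in>bump_index d s. c * fourier_coeff d (character d (bump_freq d s h)) k)"
      unfolding bumps_eq[abs_def] c_def by (rule fourier_coeff_sum) (rule integrable_character)
    also have "\<dots> = (\<Sum>h\<in>bump_index d s. c * (if k = bump_freq d s h then 1 else 0))"
      using k sub wide_block_subset by (intro sum.cong refl arg_cong2[of _ _ _ _ "(*)"] fourier_coeff_character) blast+
    finally show ?thesis .
  qed
  have "A_op d s (bumps d s) ?x = (\<Sum>k\<in>wide_block d s. ?a k * fourier_coeff d (bumps d s) k)"
    using A_op_eq[OF trig_poly_integrable[OF bumps_in_trig_polys[where s = s, OF s2]] s, of ?x]
    by (simp only: char1 mult_1_right)
  also have "\<dots> = (\<Sum>k\<in>wide_block d s. \<Sum>h\<in>bump_index d s. if k = bump_freq d s h then c * ?a k else 0)"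
    by (intro sum.cong refl) (simp add: coeff sum_distrib_left if_distrib mult.commute cong: if_cong)
  also have "\<dots> = (\<Sum>h\<in>bump_index d s. \<Sum>k\<in>wide_block d s. if k = bump_freq d s h then c * ?a k else 0)"
    by (rule sum.swap)
  also have "\<dots> = (\<Sum>h\<in>bump_index d s. c * ?a (bump_freq d s h))"
    using sub by (intro sum.cong refl) (simp add: sum.delta)
  also have "\<dots> = complex_of_real (\<Sum>h\<in>bump_index d s. \<Prod>j\<in>{1..d}.
      a_coeff (s j) (3 * 2 ^ (s j - 2) + int (fst (h j)) - int (snd (h j))) / real (2 ^ (s j - 2)))"
    unfolding of_real_sum c_def
  proof (intro sum.cong refl)
    fix h
    have "(\<Prod>j\<in>{1..d}. a_coeff (s j) (bump_freq d s h j)) =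
        (\<Prod>j\<in>{1..d}. a_coeff (s j) (3 * 2 ^ (s j - 2) + int (fst (h j)) - int (snd (h j))))"
      by (intro prod.cong refl) (simp add: bump_freq_def)
    then show "(\<Prod>j\<in>{1..d}. 1 / of_nat (2 ^ (s j - 2))) * ?a (bump_freq d s h) = complex_of_real (\<Prod>j\<in>{1..d}.
        a_coeff (s j) (3 * 2 ^ (s j - 2) + int (fst (h j)) - int (snd (h j))) / real (2 ^ (s j - 2)))"
      by (simp add: prod_dividef)
  qed
  also have "(\<Sum>h\<in>bump_index d s. \<Prod>j\<in>{1..d}.
      a_coeff (s j) (3 * 2 ^ (s j - 2) + int (fst (h j)) - int (snd (h j))) / real (2 ^ (s j - 2))) =
      (\<Prod>j\<in>{1..d}. \<Sum>ab\<in>{..<2 ^ (s j - 2)} \<times> {..<2 ^ (s j - 2)}.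
        a_coeff (s j) (3 * 2 ^ (s j - 2) + int (fst ab) - int (snd ab)) / real (2 ^ (s j - 2)))"
    unfolding bump_index_def by (rule prod_sum_PiE[symmetric]) auto
  also have "\<dots> = (\<Prod>j\<in>{1..d}. 2 ^ (s j - 2) / 2)"
    by (intro prod.cong refl) (simp only: sum_divide_distrib[symmetric] sum_a_coeff_bump[OF s2])
  finally show ?thesis .
qed

text \<open>The modulation has modulus 1, and a Fejer kernel F of order N lies between 0 and N with
  mean 1, so F powr p has mean at most N powr (p - 1).\<close>

lemma Lp_real_bumps_le:
  assumes p: "1 < p" and s2: "\<And>j. j \<in> {1..d} \<Longrightarrow> 2 \<le> s j"
  shows "Lp_real d p (bumps d s) \<le> (\<Prod>j\<in>{1..d}. 2 ^ (s j - 2)) powr (1 - 1 / p)"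
proof -
  define P where "P = (\<Prod>j\<in>{1..d}. 2 ^ (s j - 2) :: real)"
  have P: "P > 0" unfolding P_def by (intro prod_pos) auto
  have m: "(\<lambda>u. ennreal (fejer N u)) \<in> borel_measurable circ" for N
    unfolding measurable_cong_sets[OF sets_circ refl] by measurable
  have "(\<integral>\<^sup>+x. ennreal (cmod (bumps d s x) powr p) \<partial>torus d) \<le>
      (\<integral>\<^sup>+x. (\<Prod>j\<in>{1..d}. ennreal ((2 ^ (s j - 2)) powr (p - 1)) * ennreal (fejer (2 ^ (s j - 2)) (x j))) \<partial>torus d)"
  proof (rule nn_integral_mono)
    fix x
    have "cmod (bumps d s x) powr p = (\<Prod>j\<in>{1..d}. fejer (2 ^ (s j - 2)) (x j) powr p)"
      by (simp add: bumps_def bump_def norm_mult fejer_nonneg prod_powr_distrib flip: prod_norm)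
    also have "\<dots> \<le> (\<Prod>j\<in>{1..d}. (2 ^ (s j - 2)) powr (p - 1) * fejer (2 ^ (s j - 2)) (x j))"
    proof (intro prod_mono conjI)
      fix j
      let ?F = "fejer (2 ^ (s j - 2)) (x j)"
      have "?F powr p = ?F * ?F powr (p - 1)"
        using powr_mult_base[of ?F "p - 1"] fejer_nonneg by simp
      also have "\<dots> \<le> ?F * (2 ^ (s j - 2)) powr (p - 1)"
        using p fejer_le[of "2 ^ (s j - 2)" "x j"] by (intro mult_left_mono powr_mono2 fejer_nonneg) auto
      finally show "?F powr p \<le> (2 ^ (s j - 2)) powr (p - 1) * ?F"
        by (simp only: mult.commute)
    qed simp
    finally have "ennreal (cmod (bumps d s x) powr p) \<le>
        ennreal (\<Prod>j\<in>{1..d}. (2 ^ (s j - 2)) powr (p - 1) * fejer (2 ^ (s j - 2)) (x j))"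
      by (rule ennreal_leI)
    also have "\<dots> = (\<Prod>j\<in>{1..d}. ennreal ((2 ^ (s j - 2)) powr (p - 1) * fejer (2 ^ (s j - 2)) (x j)))"
      by (rule prod_ennreal[symmetric]) (intro mult_nonneg_nonneg powr_ge_zero fejer_nonneg)
    also have "\<dots> = (\<Prod>j\<in>{1..d}. ennreal ((2 ^ (s j - 2)) powr (p - 1)) * ennreal (fejer (2 ^ (s j - 2)) (x j)))"
      by (intro prod.cong refl ennreal_mult powr_ge_zero fejer_nonneg)
    finally show "ennreal (cmod (bumps d s x) powr p) \<le>
        (\<Prod>j\<in>{1..d}. ennreal ((2 ^ (s j - 2)) powr (p - 1)) * ennreal (fejer (2 ^ (s j - 2)) (x j)))" .
  qed
  also have "\<dots> = (\<Prod>j\<in>{1..d}. \<integral>\<^sup>+u. ennreal ((2 ^ (s j - 2)) powr (p - 1)) * ennreal (fejer (2 ^ (s j - 2)) u) \<partial>circ)"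
    unfolding torus_eq
    by (intro circs.product_nn_integral_prod borel_measurable_times_ennreal borel_measurable_const m finite_atLeastAtMost)
  also have "\<dots> = (\<Prod>j\<in>{1..d}. ennreal ((2 ^ (s j - 2)) powr (p - 1)))"
  proof (intro prod.cong refl)
    fix j
    have "(\<integral>\<^sup>+u. ennreal (fejer (2 ^ (s j - 2)) (u - 0)) \<partial>circ) = 1"
      by (rule nn_integral_fejer(2)) simp
    then show "(\<integral>\<^sup>+u. ennreal ((2 ^ (s j - 2)) powr (p - 1)) * ennreal (fejer (2 ^ (s j - 2)) u) \<partial>circ) =
        ennreal ((2 ^ (s j - 2)) powr (p - 1))"
      by (simp add: nn_integral_cmult[OF m])
  qed
  also have "\<dots> = ennreal (P powr (p - 1))"
    by (simp add: prod_ennreal P_def prod_powr_distrib)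
  also have "P powr (p - 1) = (P powr (1 - 1 / p)) powr p"
    using p by (simp add: powr_powr algebra_simps)
  finally have "Lp_norm d p (bumps d s) \<le> ennreal (P powr (1 - 1 / p))"
    using p by (subst Lp_norm_le_iff) auto
  then show ?thesis
    using Lp_norm_trig_poly[where p = p, OF bumps_in_trig_polys[where s = s, OF s2]] p by (simp add: P_def)
qed

context besov_setting
begin

text \<open>
  All indices of the test function have \<open>s\<^sub>j \<ge> 2\<close> and lie on the layer \<open>s\<^sub>1 + \<dots> + s\<^sub>d = n + 2d\<close>, so the
  block of one index is never a shift of the block of another.
\<close>

definition layer_index :: "nat \<Rightarrow> (nat \<Rightarrow> nat) \<Rightarrow> nat \<Rightarrow> nat" where
  "layer_index n h = (\<lambda>j\<in>{1..d}. if j = 1 then n + 2 * \<nu> - (\<Sum>i=2..\<nu>. h i) else if j \<le> \<nu> then h j else 2)"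

definition layer :: "nat \<Rightarrow> (nat \<Rightarrow> nat) set" where
  "layer n = layer_index n ` ({2..\<nu>} \<rightarrow>\<^sub>E {2..n div \<nu> + 2})"

text \<open>The coordinates 2, ..., \<nu> exceed 2 by at most n div \<nu> each, together by at most
  n. So the truncated subtraction in the first coordinate is exact and leaves at least 2.\<close>

lemma layer_index_props:
  assumes h: "h \<in> {2..\<nu>} \<rightarrow>\<^sub>E {2..n div \<nu> + 2}"
  shows "layer_index n h \<in> block_indices d"
    and "\<And>j. j \<in> {1..d} \<Longrightarrow> 2 \<le> layer_index n h j"
    and "(\<Sum>j=1..\<nu>. layer_index n h j) = n + 2 * \<nu>"
    and "(\<Sum>j=1..d. layer_index n h j) = n + 2 * d"
proof -
  have hb: "2 \<le> h i" "h i \<le> n div \<nu> + 2" if "i \<in> {2..\<nu>}" for i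
    using PiE_mem[OF h that] by auto
  have "(\<Sum>i=2..\<nu>. h i) \<le> (\<nu> - 1) * (n div \<nu> + 2)"
    using sum_bounded_above[of "{2..\<nu>}" h "n div \<nu> + 2"] hb by simp
  also have "\<dots> \<le> n + 2 * \<nu> - 2"
  proof -
    have "(\<nu> - 1) * (n div \<nu>) \<le> \<nu> * (n div \<nu>)" by (intro mult_right_mono) auto
    also have "\<dots> \<le> n" by simp
    finally show ?thesis using \<nu> by (simp add: algebra_simps diff_mult_distrib2)
  qed
  finally have first: "(\<Sum>i=2..\<nu>. h i) + 2 \<le> n + 2 * \<nu>" using \<nu> by simp
  show two: "2 \<le> layer_index n h j" if "j \<in> {1..d}" for j
    using that first hb[of j] by (auto simp: layer_index_def)
  show "layer_index n h \<in> block_indices d"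
    unfolding block_indices_def
  proof (rule PiE_I)
    fix j assume "j \<in> {1..d}"
    from two[OF this] show "layer_index n h j \<in> {1..}" by simp
  next
    fix j assume "j \<notin> {1..d}"
    then show "layer_index n h j = undefined"
      unfolding layer_index_def restrict_def by (rule if_not_P)
  qed
  have "{1..\<nu>} = insert 1 {2..\<nu>}" using \<nu> by auto
  then have "(\<Sum>j=1..\<nu>. layer_index n h j) = layer_index n h 1 + (\<Sum>j=2..\<nu>. layer_index n h j)" by simp
  also have "(\<Sum>j=2..\<nu>. layer_index n h j) = (\<Sum>j=2..\<nu>. h j)"
    using \<nu> by (intro sum.cong) (auto simp: layer_index_def)
  also have "layer_index n h 1 = n + 2 * \<nu> - (\<Sum>i=2..\<nu>. h i)"
    using \<nu> by (simp add: layer_index_def)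
  finally show S1: "(\<Sum>j=1..\<nu>. layer_index n h j) = n + 2 * \<nu>" using first by simp
  have "{1..d} = {1..\<nu>} \<union> {\<nu>+1..d}" using \<nu> by auto
  then have "(\<Sum>j=1..d. layer_index n h j) = (\<Sum>j=1..\<nu>. layer_index n h j) + (\<Sum>j=\<nu>+1..d. layer_index n h j)"
    by (simp only:) (rule sum.union_disjoint, auto)
  also have "(\<Sum>j=\<nu>+1..d. layer_index n h j) = (\<Sum>j=\<nu>+1..d. 2)"
    using \<nu> by (intro sum.cong) (auto simp: layer_index_def)
  also have "\<dots> = 2 * (d - \<nu>)" by simp
  finally show "(\<Sum>j=1..d. layer_index n h j) = n + 2 * d" using S1 \<nu> by simp
qed

lemma layer_props:
  assumes "s \<in> layer n"
  shows "s \<in> block_indices d" and "\<And>j. j \<in> {1..d} \<Longrightarrow> 2 \<le> s j" and "(\<Sum>j=1..d. s j) = n + 2 * d"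
    and "level s = real n + (2 * real \<nu> + (\<Sum>j=\<nu>+1..d. 2 * \<gamma> j))"
proof -
  obtain h where h: "h \<in> {2..\<nu>} \<rightarrow>\<^sub>E {2..n div \<nu> + 2}" and s: "s = layer_index n h"
    using assms unfolding layer_def by blast
  show "s \<in> block_indices d" "\<And>j. j \<in> {1..d} \<Longrightarrow> 2 \<le> s j" "(\<Sum>j=1..d. s j) = n + 2 * d"
    unfolding s by (rule layer_index_props[OF h]; assumption)+
  have "{1..d} = {1..\<nu>} \<union> {\<nu>+1..d}" using \<nu> by auto
  then have "level s = (\<Sum>j=1..\<nu>. real (s j) * \<gamma> j) + (\<Sum>j=\<nu>+1..d. real (s j) * \<gamma> j)"
    unfolding level_def dot_def by (simp only:) (rule sum.union_disjoint, auto)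
  also have "(\<Sum>j=1..\<nu>. real (s j) * \<gamma> j) = real (\<Sum>j=1..\<nu>. s j)"
    unfolding of_nat_sum by (intro sum.cong refl) (simp only: \<gamma>_eq_1 mult_1_right)
  also have "(\<Sum>j=1..\<nu>. s j) = n + 2 * \<nu>"
    unfolding s by (rule layer_index_props(3)[OF h])
  also have "(\<Sum>j=\<nu>+1..d. real (s j) * \<gamma> j) = (\<Sum>j=\<nu>+1..d. 2 * \<gamma> j)"
    unfolding s using \<nu> by (intro sum.cong) (auto simp: layer_index_def)
  finally show "level s = real n + (2 * real \<nu> + (\<Sum>j=\<nu>+1..d. 2 * \<gamma> j))" by simp
qed

lemma finite_layer: "finite (layer n)"
  unfolding layer_def by (intro finite_imageI finite_PiE) auto

text \<open>There are \<nu> - 1 free coordinates with n div \<nu> + 1 values each.\<close>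

lemma card_layer: "(real n / real \<nu>) ^ (\<nu> - 1) \<le> real (card (layer n))"
proof -
  have "inj_on (layer_index n) ({2..\<nu>} \<rightarrow>\<^sub>E {2..n div \<nu> + 2})"
  proof (rule inj_onI)
    fix h h' assume h: "h \<in> {2..\<nu>} \<rightarrow>\<^sub>E {2..n div \<nu> + 2}" "h' \<in> {2..\<nu>} \<rightarrow>\<^sub>E {2..n div \<nu> + 2}"
      and eq: "layer_index n h = layer_index n h'"
    show "h = h'"
    proof (rule PiE_ext[OF h])
      fix j assume "j \<in> {2..\<nu>}"
      then show "h j = h' j"
        using fun_cong[OF eq, of j] \<nu> by (simp add: layer_index_def)
    qed
  qed
  then have "card (layer n) = (n div \<nu> + 1) ^ (\<nu> - 1)"
    unfolding layer_def by (simp add: card_image card_PiE)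
  moreover have "real n / real \<nu> \<le> real (n div \<nu> + 1)"
  proof -
    have "n \<le> (n div \<nu> + 1) * \<nu>"
      using \<nu> dividend_less_div_times[of \<nu> n] by simp
    then have "real n \<le> real (n div \<nu> + 1) * real \<nu>"
      unfolding of_nat_mult[symmetric] of_nat_le_iff .
    then show ?thesis using \<nu> by (simp add: divide_le_eq)
  qed
  ultimately show ?thesis
    by (simp add: power_mono)
qed

lemma layer_shift:
  assumes "s \<in> layer n" "s' \<in> layer n" "e \<in> corners d" "s' = shift_index d s e"
  shows "s' = s"
proof -
  have "(\<Sum>j=1..d. s' j) = (\<Sum>j=1..d. s j) + (\<Sum>j=1..d. e j)"
    unfolding assms(4) by (simp add: shift_index_def sum.distrib)
  then have "(\<Sum>j=1..d. e j) = 0"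
    using layer_props(3)[OF assms(1)] layer_props(3)[OF assms(2)] by simp
  then have e0: "e j = 0" if "j \<in> {1..d}" for j
    using that by simp
  show ?thesis
  proof (rule PiE_ext)
    show "s' \<in> {1..d} \<rightarrow>\<^sub>E {1..}" "s \<in> {1..d} \<rightarrow>\<^sub>E {1..}"
      using layer_props(1)[OF assms(1)] layer_props(1)[OF assms(2)] unfolding block_indices_def by blast+
    fix j assume j: "j \<in> {1..d}"
    then show "s' j = s j"
      unfolding assms(4) using e0[OF j] by (simp add: shift_index_def)
  qed
qed

lemma lower_bound:
  "\<exists>c>0. \<forall>n\<ge>1. ennreal (c * rate n) \<le> best_approx d (hyp_cross d \<gamma> n) (besov_class d r p \<theta>) (Bq1_norm d q)"
proof -
  define e where "e = enn2real (1 / \<theta>)"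
  \<comment> \<open>The amount by which the level of the test blocks exceeds n, see
    \<open>layer_props\<close>.\<close>
  define K where "K = 2 * real \<nu> + (\<Sum>j=\<nu>+1..d. 2 * \<gamma> j)"
  \<comment> \<open>60 ^ d = 2 ^ d * 30 ^ d joins the halves of \<open>A_op_bumps_at_0\<close> to
    the constant of \<open>trig_poly_sup_bound\<close>; 3d is the excess over n of the sum of the s
    j + 1, which bound the frequencies of \<open>A_op d s f\<close>.\<close>
  define b where "b = 2 powr (- r 1 * K) / (60 ^ d * 2 powr (3 * real d / q))"
  have K: "K \<ge> 0"
    unfolding K_def using \<gamma>_gt_1 by (intro add_nonneg_nonneg sum_nonneg) (auto simp: less_imp_le order_trans[of 0 1])
  have q: "1 \<le> q" "q > 0" using p pq by auto
  have e01: "0 \<le> e" "e \<le> 1" and e_t: "\<theta> \<noteq> \<infinity> \<Longrightarrow> e = 1 / t" and e_inf: "\<theta> = \<infinity> \<Longrightarrow> e = 0"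
  proof -
    show e_t: "e = 1 / t" if "\<theta> \<noteq> \<infinity>"
    proof -
      have "\<theta> = ennreal t" using that by (simp add: t_def less_top)
      then have "1 / \<theta> = ennreal (1 / t)"
        using t_ge_1[OF that] divide_ennreal[of 1 t] by simp
      then show ?thesis using t_ge_1[OF that] by (simp add: e_def)
    qed
    show e_inf: "e = 0" if "\<theta> = \<infinity>" using that by (simp add: e_def)
    show "0 \<le> e" by (simp add: e_def)
    show "e \<le> 1"
      using e_t e_inf t_ge_1 by (cases "\<theta> = \<infinity>") auto
  qed
  have "ennreal (b * (1 / real \<nu>) powr ((real \<nu> - 1) * (1 - e)) * rate n) \<le>
      best_approx d (hyp_cross d \<gamma> n) (besov_class d r p \<theta>) (Bq1_norm d q)" if n: "n \<ge> 1" for n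
  proof -
    define M where "M = real (card (layer n))"
    have M_ge: "(real n / real \<nu>) ^ (\<nu> - 1) \<le> M" unfolding M_def by (rule card_layer)
    have "0 < (real n / real \<nu>) ^ (\<nu> - 1)" using n \<nu> by simp
    then have M0: "M > 0" using M_ge by linarith
    \<comment> \<open>Chosen so that 2 powr (s, r) times c times the bound 2 powr (n (1 - 1/p)) for
      the L_p norm of a bump is M powr (- e); for finite \<theta> the t-th powers of M such terms
      add up to 1.\<close>
    define c where "c = 2 powr (- r 1 * K - real n * (r 1 + 1 - 1 / p)) * M powr (- e)"
    have c: "c > 0" unfolding c_def using M0 by simp
    define f where "f x = (\<Sum>s\<in>layer n. complex_of_real c * bumps d s x)" for x
    have bumps: "bumps d s \<in> trig_polys d (rho d s)" if "s \<in> layer n" for s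
      using layer_props(2)[OF that] by (intro bumps_in_trig_polys)
    have prod_eq: "(\<Prod>j\<in>{1..d}. 2 ^ (s j - 2) :: real) = 2 powr real n" if s: "s \<in> layer n" for s
    proof -
      have "(\<Sum>j=1..d. s j - 2) + (\<Sum>j=1..d. 2) = (\<Sum>j=1..d. s j)"
        unfolding sum.distrib[symmetric] by (intro sum.cong refl le_add_diff_inverse2 layer_props(2)[OF s])
      then have "(\<Sum>j=1..d. s j - 2) = n" using layer_props(3)[OF s] by simp
      then show ?thesis by (simp add: power_sum[symmetric] powr_realpow)
    qed
    define R where "R = (\<Union>s\<in>layer n. rho d s)"
    have R: "finite R" "R \<subseteq> {1..d} \<rightarrow>\<^sub>E UNIV"
      unfolding R_def by (rule finite_UN_I[OF finite_layer finite_rho]) (rule UN_least[OF rho_subset])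
    have fT: "f \<in> trig_polys d R"
      unfolding f_def[abs_def] using R
      by (intro trig_polys_sum trig_polys_scale trig_polys_mono[OF bumps]) (auto simp: R_def)
    have fi: "integrable (torus d) f" by (rule trig_poly_integrable[OF fT])
    have coeff: "fourier_coeff d f k = (\<Sum>s\<in>layer n. complex_of_real c * fourier_coeff d (bumps d s) k)" for k
      unfolding f_def[abs_def] by (rule fourier_coeff_sum) (rule trig_poly_integrable[OF bumps])
    have coeff_block: "fourier_coeff d f k = (if s' \<in> layer n then complex_of_real c * fourier_coeff d (bumps d s') k else 0)"
      if s': "s' \<in> block_indices d" and k: "k \<in> rho d s'" for k s'
    proof -
      have k': "k \<in> {1..d} \<rightarrow>\<^sub>E UNIV" using k rho_subset by blast
      have "fourier_coeff d (bumps d s) k = 0" if s: "s \<in> layer n" "s \<noteq> s'" for s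
      proof (rule fourier_coeff_trig_poly_eq_0[OF bumps[OF s(1)] rho_subset finite_rho k'])
        show "k \<notin> rho d s" using rho_unique[OF _ k layer_props(1)[OF s(1)] s'] s(2) by blast
      qed
      then have "fourier_coeff d f k = (\<Sum>s\<in>layer n. if s = s' then complex_of_real c * fourier_coeff d (bumps d s') k else 0)"
        unfolding coeff by (intro sum.cong) auto
      then show ?thesis by (simp add: finite_layer)
    qed
    have delta_f: "delta d s f = (if s \<in> layer n then (\<lambda>x. complex_of_real c * bumps d s x) else (\<lambda>x. 0))"
      if s: "s \<in> block_indices d" for s
    proof (cases "s \<in> layer n")
      case True
      have "delta d s f x = complex_of_real c * fourier_sum d (rho d s) (bumps d s) x" for x
        unfolding delta_def fourier_sum_def sum_distrib_left
        by (intro sum.cong refl) (simp add: coeff_block[OF s] True mult.assoc)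
      then show ?thesis
        using True by (simp add: fourier_sum_trig_poly[OF bumps[OF True] rho_subset finite_rho] fun_eq_iff)
    next
      case False
      then show ?thesis
        by (simp add: delta_def fourier_sum_def coeff_block[OF s] fun_eq_iff)
    qed
    have wcoeff_f: "wcoeff f s \<le> M powr (- e)" if s: "s \<in> layer n" for s
    proof -
      have sb: "s \<in> block_indices d" by (rule layer_props(1)[OF s])
      have "Lp_norm d p (delta d s f) \<le> ennreal (c * Lp_real d p (bumps d s))"
      proof (subst Lp_norm_le_iff)
        have "(\<integral>\<^sup>+x. ennreal (cmod (delta d s f x) powr p) \<partial>torus d) =
            (\<integral>\<^sup>+x. ennreal (c powr p) * ennreal (cmod (bumps d s x) powr p) \<partial>torus d)"
          using c s by (intro nn_integral_cong) (simp add: delta_f[OF sb] norm_mult powr_mult ennreal_mult)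
        also have "\<dots> = ennreal (c powr p) * (\<integral>\<^sup>+x. ennreal (cmod (bumps d s x) powr p) \<partial>torus d)"
          using trig_poly_measurable[OF bumps[OF s]] by (intro nn_integral_cmult) simp
        also have "(\<integral>\<^sup>+x. ennreal (cmod (bumps d s x) powr p) \<partial>torus d) = ennreal (Lp_real d p (bumps d s) powr p)"
          using p by (intro Lp_norm_eqD Lp_norm_trig_poly[OF bumps[OF s]]) auto
        finally show "(\<integral>\<^sup>+x. ennreal (cmod (delta d s f x) powr p) \<partial>torus d) \<le> ennreal ((c * Lp_real d p (bumps d s)) powr p)"
          using c by (simp add: powr_mult ennreal_mult)
      qed (use p c in auto)
      then have "Lp_real d p (delta d s f) \<le> c * Lp_real d p (bumps d s)"
        unfolding delta_norm using c by simp
      also have "c * Lp_real d p (bumps d s) \<le> c * 2 powr (real n * (1 - 1 / p))"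
      proof (rule mult_left_mono)
        show "Lp_real d p (bumps d s) \<le> 2 powr (real n * (1 - 1 / p))"
          using Lp_real_bumps_le[where d = d and s = s, OF p layer_props(2)[OF s]] unfolding prod_eq[OF s] powr_powr by simp
      qed (use c in simp)
      finally have "wcoeff f s \<le> 2 powr (r 1 * (real n + K)) * (c * 2 powr (real n * (1 - 1 / p)))"
        unfolding wcoeff_def dot_r layer_props(4)[OF s] K_def by (intro mult_left_mono) auto
      also have "\<dots> = 2 powr (r 1 * (real n + K) + (- r 1 * K - real n * (r 1 + 1 - 1 / p)) + real n * (1 - 1 / p)) * M powr (- e)"
        unfolding c_def powr_add by (simp only: mult_ac)
      also have "r 1 * (real n + K) + (- r 1 * K - real n * (r 1 + 1 - 1 / p)) + real n * (1 - 1 / p) = 0"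
        by (simp add: algebra_simps)
      finally show ?thesis by simp
    qed
    have wcoeff_0: "wcoeff f s = 0" if "s \<in> block_indices d" "s \<notin> layer n" for s
      using that p by (simp add: wcoeff_def delta_f Lp_real_zero)
    have norm: "besov_norm d r p \<theta> f \<le> 1"
      unfolding besov_norm_le_1_iff
    proof (split if_split, intro conjI impI allI ballI)
      fix s assume "\<theta> = \<infinity>" and s: "s \<in> block_indices d"
      then have "M powr (- e) = 1" using M0 e_inf by simp
      then show "wcoeff f s \<le> 1"
        using wcoeff_f[of s] wcoeff_0[OF s] by (cases "s \<in> layer n") auto
    next
      fix F assume fin: "\<theta> \<noteq> \<infinity>" and F: "finite F \<and> F \<subseteq> block_indices d"
      have t1: "t \<ge> 1" by (rule t_ge_1[OF fin])
      have "(\<Sum>s\<in>F. wcoeff f s powr t) \<le> (\<Sum>s\<in>F \<inter> layer n. wcoeff f s powr t)"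
      proof (rule eq_refl, rule sum.mono_neutral_right)
        show "finite F" "F \<inter> layer n \<subseteq> F" using F by blast+
        show "\<forall>s\<in>F - F \<inter> layer n. wcoeff f s powr t = 0"
        proof
          fix s assume "s \<in> F - F \<inter> layer n"
          then have "s \<in> block_indices d" "s \<notin> layer n" using F by blast+
          then show "wcoeff f s powr t = 0" by (simp add: wcoeff_0)
        qed
      qed
      also have "\<dots> \<le> (\<Sum>s\<in>F \<inter> layer n. 1 / M)"
      proof (rule sum_mono)
        fix s assume "s \<in> F \<inter> layer n"
        then have "wcoeff f s powr t \<le> (M powr (- e)) powr t"
          using wcoeff_f wcoeff_nonneg t1 by (intro powr_mono2) auto
        also have "\<dots> = 1 / M"
        proof -
          have "- e * t = - 1" using e_t[OF fin] t1 by simp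
          then show ?thesis unfolding powr_powr using M0 by (simp add: powr_minus_divide)
        qed
        finally show "wcoeff f s powr t \<le> 1 / M" .
      qed
      also have "\<dots> \<le> (\<Sum>s\<in>layer n. 1 / M)"
        using M0 finite_layer by (intro sum_mono2) auto
      also have "\<dots> = 1" using M0 by (simp add: M_def)
      finally show "(\<Sum>s\<in>F. wcoeff f s powr t) \<le> 1" .
    qed
    \<comment> \<open>\<open>f\<close> is written as 0 - (- 1) * f to make
      \<open>Lp0_diff_trig_poly\<close> applicable.\<close>
    have f0: "f \<in> Lp0 d p"
    proof -
      have zero: "(\<lambda>x. 0) \<in> Lp0 d p"
        using p by (simp add: Lp0_def Lp_def periodic_fun_def Lp_norm_def epowr_def set_lebesgue_integral_def)
      have T: "(\<lambda>x. (- 1) * f x) \<in> trig_polys d R" by (rule trig_polys_scale[OF fT])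
      have nz: "k j \<noteq> 0" if kR: "k \<in> R" and j: "j \<in> {1..d}" for k j
      proof
        assume "k j = 0"
        obtain s where "k \<in> rho d s" using kR unfolding R_def by blast
        then have "2 ^ (s j - 1) \<le> \<bar>k j\<bar>" using j unfolding rho_def by blast
        then show False using \<open>k j = 0\<close> zero_less_power[of "2::int" "s j - 1"] by simp
      qed
      have eq: "(\<lambda>x. 0 - (- 1) * f x) = f" by simp
      have "(\<lambda>x. 0 - (- 1) * f x) \<in> Lp0 d p"
      proof (rule Lp0_diff_trig_poly[OF zero T])
        show "k j \<noteq> 0" if "k \<in> R" "j \<in> {1..d}" for k j by (rule nz[OF that])
        show "Lp_norm d p (\<lambda>x. 0 - (- 1) * f x) < \<infinity>"
          unfolding eq using p by (intro trig_poly_Lp_norm_finite[OF fT]) auto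
      qed
      then show ?thesis unfolding eq .
    qed
    have fB: "f \<in> besov_class d r p \<theta>"
      unfolding besov_class_def using f0 norm by blast
    have A_lower: "b * M powr (- e) * 2 powr (- real n * (r 1 - 1 / p + 1 / q)) \<le> Lp_real d q (A_op d s f)" if s: "s \<in> layer n" for s
    proof -
      let ?x = "\<lambda>j\<in>{1..d}. 0 :: real"
      have sb: "s \<in> block_indices d" by (rule layer_props(1)[OF s])
      \<comment> \<open>\<open>A_op d s\<close> sees only its own test block: by
        \<open>layer_shift\<close> the other blocks in its spectrum are off the layer.\<close>
      have same: "fourier_coeff d f k = complex_of_real c * fourier_coeff d (bumps d s) k" if k: "k \<in> wide_block d s" for k
      proof -
        obtain a where a: "a \<in> corners d" "k \<in> rho d (shift_index d s a)"
          using k unfolding wide_block_eq[OF sb] by blast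
        have k': "k \<in> {1..d} \<rightarrow>\<^sub>E UNIV" using a rho_subset by blast
        show ?thesis
        proof (cases "shift_index d s a = s")
          case True
          then show ?thesis using coeff_block[OF sb, of k] a s by simp
        next
          case False
          then have "shift_index d s a \<notin> layer n" using layer_shift[OF s _ a(1) refl] by blast
          then have "fourier_coeff d f k = 0" using coeff_block[OF shift_index_in[OF sb] a(2)] by simp
          moreover have "k \<notin> rho d s"
            using rho_unique[OF a(2) _ shift_index_in[OF sb] sb] False by blast
          then have "fourier_coeff d (bumps d s) k = 0"
            by (rule fourier_coeff_trig_poly_eq_0[OF bumps[OF s] rho_subset finite_rho k'])
          ultimately show ?thesis by simp
        qed
      qed
      have "A_op d s f ?x = complex_of_real c * A_op d s (bumps d s) ?x"
        unfolding A_op_eq[OF fi sb] A_op_eq[OF trig_poly_integrable[OF bumps[OF s]] sb] sum_distrib_left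
        by (intro sum.cong refl) (simp add: same mult_ac)
      also have "A_op d s (bumps d s) ?x = complex_of_real (2 powr real n / 2 ^ d)"
      proof -
        have "(\<Prod>j\<in>{1..d}. 2 ^ (s j - 2) / 2) = 2 powr real n / 2 ^ d"
          unfolding prod_dividef prod_eq[OF s] by simp
        then show ?thesis
          using A_op_bumps_at_0[where s = s, OF sb layer_props(2)[OF s]] by (simp only:)
      qed
      finally have A0: "A_op d s f ?x = complex_of_real c * complex_of_real (2 powr real n / 2 ^ d)" .
      have A1: "cmod (A_op d s f ?x) = c * (2 powr real n / 2 ^ d)"
        unfolding A0 norm_mult norm_of_real using c by simp
      \<comment> \<open>The sup bound read backwards: a large value at one point forces a large L_q
        norm.\<close>
      have A2: "cmod (A_op d s f ?x) \<le> 30 ^ d * 2 powr (real (\<Sum>j\<in>{1..d}. s j + 1) / q) * Lp_real d q (A_op d s f)"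
      proof (rule trig_poly_sup_bound[OF A_op_in_trig_polys[OF fi sb] finite_wide_block wide_block_subset _ q(1)])
        show "?x \<in> space (torus d)" unfolding space_torus by (rule restrict_PiE_iff[THEN iffD2]) simp
        fix k j assume "k \<in> wide_block d s" "j \<in> {1..d}"
        then have "k j \<in> {k. 2 ^ (s j - 1) \<le> \<bar>k\<bar> \<and> \<bar>k\<bar> < 2 ^ (s j + 1)}"
          unfolding wide_block_def by (rule PiE_mem)
        then show "\<bar>k j\<bar> \<le> 2 ^ (s j + 1)" by simp
      qed
      have A3: "(\<Sum>j\<in>{1..d}. s j + 1) = n + 3 * d"
        unfolding sum.distrib layer_props(3)[OF s] by simp
      have "c * (2 powr real n / 2 ^ d) \<le> 30 ^ d * 2 powr (real (n + 3 * d) / q) * Lp_real d q (A_op d s f)"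
        using A2 unfolding A1 A3 .
      then have "c * (2 powr real n / 2 ^ d) / (30 ^ d * 2 powr (real (n + 3 * d) / q)) \<le> Lp_real d q (A_op d s f)"
        by (subst pos_divide_le_eq) (auto simp: mult.commute)
      also have "c * (2 powr real n / 2 ^ d) / (30 ^ d * 2 powr (real (n + 3 * d) / q)) =
          b * M powr (- e) * 2 powr (- real n * (r 1 - 1 / p + 1 / q))"
      proof -
        have "c * (2 powr real n / 2 ^ d) / (30 ^ d * 2 powr (real (n + 3 * d) / q)) =
            2 powr (- r 1 * K) * 2 powr (- real n * (r 1 + 1 - 1 / p)) * M powr (- e) * 2 powr real n /
            ((2 ^ d * 30 ^ d) * (2 powr (real n / q) * 2 powr (3 * real d / q)))"
          unfolding c_def by (simp add: add_divide_distrib flip: powr_add)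
        also have "\<dots> = 2 powr (- r 1 * K) / (60 ^ d * 2 powr (3 * real d / q)) * M powr (- e) *
            (2 powr (- real n * (r 1 + 1 - 1 / p)) * 2 powr real n / 2 powr (real n / q))"
          by (simp add: mult_ac flip: power_mult_distrib)
        also have "2 powr (- real n * (r 1 + 1 - 1 / p)) * 2 powr real n / 2 powr (real n / q) =
            2 powr (- real n * (r 1 - 1 / p + 1 / q))"
          unfolding powr_add[symmetric] powr_diff[symmetric] by (intro arg_cong2[of _ _ _ _ "(powr)"] refl) (simp add: algebra_simps)
        finally show ?thesis by (simp only: b_def)
      qed
      finally show ?thesis .
    qed
    have approx: "ennreal (b * (1 / real \<nu>) powr ((real \<nu> - 1) * (1 - e)) * rate n) \<le> Bq1_norm d q (\<lambda>x. f x - T x)"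
      if T: "T \<in> trig_polys d (hyp_cross d \<gamma> n)" for T
    proof (cases "(\<lambda>x. f x - T x) \<in> Lp0 d q")
      case False
      then show ?thesis by (simp add: Bq1_norm_def)
    next
      case True
      define g where "g x = f x - T x" for x
      have Ti: "integrable (torus d) T" by (rule trig_poly_integrable[OF T])
      have gi: "integrable (torus d) g"
        unfolding g_def[abs_def] by (intro Bochner_Integration.integrable_diff fi Ti)
      \<comment> \<open>Shifts never lower the level, so every block that \<open>A_op d s\<close>
        sees lies outside the cross, where \<open>T\<close> has no coefficients.\<close>
      have A_eq: "A_op d s g = A_op d s f" if s: "s \<in> layer n" for s
      proof (rule A_op_cong[OF gi fi layer_props(1)[OF s]])
        fix k assume "k \<in> wide_block d s"
        then obtain a where a: "a \<in> corners d" "k \<in> rho d (shift_index d s a)"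
          unfolding wide_block_eq[OF layer_props(1)[OF s]] by blast
        have sb: "shift_index d s a \<in> block_indices d" by (rule shift_index_in[OF layer_props(1)[OF s]])
        have "real n \<le> level s" using layer_props(4)[OF s] K by (simp add: K_def)
        also have "level s \<le> level (shift_index d s a)"
          unfolding level_def dot_def
        proof (intro sum_mono mult_right_mono)
          fix j assume j: "j \<in> {1..d}"
          show "real (s j) \<le> real (shift_index d s a j)" using j by (simp add: shift_index_def)
          show "0 \<le> \<gamma> j" using \<gamma>_ge_1[OF j] by simp
        qed
        finally have "k \<notin> hyp_cross d \<gamma> n"
          unfolding mem_hyp_cross_iff[OF a(2) sb] level_def by simp
        then have "fourier_coeff d T k = 0"
          using a(2) rho_subset by (intro fourier_coeff_trig_poly_eq_0[OF T hyp_cross_subset finite_hyp_cross[OF \<gamma>_ge_1]]) auto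
        then show "fourier_coeff d g k = fourier_coeff d f k"
          unfolding g_def[abs_def] fourier_coeff_diff[OF fi Ti] by simp
      qed
      \<comment> \<open>The M equal contributions give M * M powr (- e) = M powr (1 - e), and M is
        at least (n / \<nu>) powr (\<nu> - 1).\<close>
      have "b * (1 / real \<nu>) powr ((real \<nu> - 1) * (1 - e)) * rate n \<le>
          M * (b * M powr (- e) * 2 powr (- real n * (r 1 - 1 / p + 1 / q)))"
      proof -
        have "(real n / real \<nu>) powr (real \<nu> - 1) \<le> M"
          using M_ge n \<nu> by (simp add: powr_realpow[symmetric] of_nat_diff)
        then have "((real n / real \<nu>) powr (real \<nu> - 1)) powr (1 - e) \<le> M powr (1 - e)"
          using e01 by (intro powr_mono2) auto
        moreover have "((real n / real \<nu>) powr (real \<nu> - 1)) powr (1 - e) =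
            (1 / real \<nu>) powr ((real \<nu> - 1) * (1 - e)) * real n powr ((real \<nu> - 1) * (1 - e))"
          by (simp add: powr_powr powr_divide)
        moreover have "M powr (1 - e) = M * M powr (- e)"
          using M0 powr_mult_base[of M "- e"] by simp
        ultimately have "(1 / real \<nu>) powr ((real \<nu> - 1) * (1 - e)) * real n powr ((real \<nu> - 1) * (1 - e)) \<le> M * M powr (- e)"
          by simp
        then have "b * 2 powr (- real n * (r 1 - 1 / p + 1 / q)) *
            ((1 / real \<nu>) powr ((real \<nu> - 1) * (1 - e)) * real n powr ((real \<nu> - 1) * (1 - e))) \<le>
            b * 2 powr (- real n * (r 1 - 1 / p + 1 / q)) * (M * M powr (- e))"
          by (intro mult_left_mono) (auto simp: b_def)
        then show ?thesis
          unfolding rate_def e_def[symmetric] by (simp only: mult_ac)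
      qed
      also have "\<dots> = (\<Sum>s\<in>layer n. b * M powr (- e) * 2 powr (- real n * (r 1 - 1 / p + 1 / q)))"
        by (simp add: M_def)
      also have "\<dots> \<le> (\<Sum>s\<in>layer n. Lp_real d q (A_op d s f))"
        by (intro sum_mono A_lower)
      finally have "ennreal (b * (1 / real \<nu>) powr ((real \<nu> - 1) * (1 - e)) * rate n) \<le>
          ennreal (\<Sum>s\<in>layer n. Lp_real d q (A_op d s f))"
        by (rule ennreal_leI)
      also have "\<dots> = (\<Sum>s\<in>layer n. ennreal (Lp_real d q (A_op d s f)))"
        by (simp add: sum_ennreal)
      also have "\<dots> = (\<Sum>s\<in>layer n. Lp_norm d q (A_op d s g))"
        by (intro sum.cong refl)
          (simp only: A_eq Lp_norm_trig_poly[OF A_op_in_trig_polys[OF fi layer_props(1)] q(2)])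
      also have "\<dots> \<le> infsum (\<lambda>s. Lp_norm d q (A_op d s g)) (block_indices d)"
        using layer_props(1) by (intro sum_le_infsum_ennreal finite_layer) blast
      also have "\<dots> = Bq1_norm d q (\<lambda>x. f x - T x)"
        unfolding Bq1_norm_def if_P[OF True] g_def[abs_def] ..
      finally show ?thesis .
    qed
    show ?thesis
      unfolding best_approx_def by (rule SUP_upper2[OF fB]) (intro INF_greatest approx)
  qed
  moreover have "b * (1 / real \<nu>) powr ((real \<nu> - 1) * (1 - e)) > 0"
    unfolding b_def using \<nu> by simp
  ultimately show ?thesis by blast
qed

end

text \<open>Both comparisons are read off from one chain: c * rate n, best approximation,
  approximation by Fourier sums, C * rate n, each at most the next.\<close>

theorem theorem3p1:
  fixes d \<nu> :: nat and p q :: real and \<theta> :: ennreal and r \<gamma> :: "nat \<Rightarrow> real"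
  assumes "d \<ge> 2"
    and "1 < p" and "p < q"
    and "1 \<le> \<theta>"
    and "1 \<le> \<nu>" and "\<nu> \<le> d"
    and "0 < r 1"
    and "\<forall>j\<in>{1..\<nu>}. r j = r 1"
    and "\<nu> < d \<longrightarrow> r \<nu> < r (\<nu> + 1)"
    and "mono_on {\<nu>+1..d} r"
    and "\<gamma> = (\<lambda>j. r j / r 1)"
    and "r 1 > 1 / p - 1 / q"
  shows "same_order
           (\<lambda>n. fourier_approx d (hyp_cross d \<gamma> n) (besov_class d r p \<theta>) (Bq1_norm d q))
           (\<lambda>n. best_approx d (hyp_cross d \<gamma> n) (besov_class d r p \<theta>) (Bq1_norm d q))
       \<and> same_order
           (\<lambda>n. best_approx d (hyp_cross d \<gamma> n) (besov_class d r p \<theta>) (Bq1_norm d q))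
           (\<lambda>n. ennreal (2 powr (- real n * (r 1 - 1 / p + 1 / q))
                  * real n powr ((real \<nu> - 1) * (1 - enn2real (1 / \<theta>)))))"
proof -
  interpret besov_setting d \<nu> p q \<theta> r \<gamma>
    by unfold_locales (fact assms)+
  let ?E = "\<lambda>n. best_approx d (hyp_cross d \<gamma> n) (besov_class d r p \<theta>) (Bq1_norm d q)"
  let ?S = "\<lambda>n. fourier_approx d (hyp_cross d \<gamma> n) (besov_class d r p \<theta>) (Bq1_norm d q)"
  obtain C where C: "C > 0" "\<forall>n\<ge>1. ?S n \<le> ennreal (C * rate n)"
    using upper_bound by blast
  obtain c where c: "c > 0" "\<forall>n\<ge>1. ennreal (c * rate n) \<le> ?E n"
    using lower_bound by blast
  have rate_nonneg: "0 \<le> rate n" for n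
    by (simp add: rate_def)
  have ES: "?E n \<le> ?S n" for n
    by (rule best_approx_le_fourier_approx)
  have S_le: "ennreal (c / C) * ?S n \<le> ?E n" if "n \<ge> 1" for n
  proof -
    have "ennreal (c / C) * ?S n \<le> ennreal (c / C) * ennreal (C * rate n)"
      using C(2) that by (intro mult_left_mono) auto
    also have "\<dots> = ennreal (c * rate n)"
      using C(1) c(1) rate_nonneg[of n] by (simp add: ennreal_mult[symmetric])
    also have "\<dots> \<le> ?E n"
      using c(2) that by blast
    finally show ?thesis .
  qed
  have E_le: "ennreal (1 / C) * ?E n \<le> ennreal (rate n)" if "n \<ge> 1" for n
  proof -
    have "ennreal (1 / C) * ?E n \<le> ennreal (1 / C) * ennreal (C * rate n)"
      using C(2) ES[of n] that by (intro mult_left_mono) (auto intro: order_trans)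
    also have "\<dots> = ennreal (rate n)"
      using C(1) rate_nonneg[of n] by (simp add: ennreal_mult[symmetric])
    finally show ?thesis .
  qed
  have rate_le: "ennreal (rate n) \<le> ennreal (1 / c) * ?E n" if "n \<ge> 1" for n
  proof -
    have "ennreal (rate n) = ennreal (1 / c) * ennreal (c * rate n)"
      using c(1) rate_nonneg[of n] by (simp add: ennreal_mult[symmetric])
    also have "\<dots> \<le> ennreal (1 / c) * ?E n"
      using c(2) that by (intro mult_left_mono) auto
    finally show ?thesis .
  qed
  have "same_order ?S ?E"
    unfolding same_order_def
    by (rule exI[of _ "c / C"], rule exI[of _ 1]) (use C(1) c(1) S_le ES in simp)
  moreover have "same_order ?E (\<lambda>n. ennreal (rate n))"
    unfolding same_order_def
    by (rule exI[of _ "1 / C"], rule exI[of _ "1 / c"]) (use C(1) c(1) E_le rate_le in simp)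
  ultimately show ?thesis
    unfolding rate_def by blast
qed

end
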